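(* Let $X$ be a finite poset of dimension $n\ge2$ with a unique minimal element and a unique maximal element. Let $(B,M)$ be a local domain containing $\mathbb Q$ with $B/M$ uncountable, $|B|=|B/M|$, and $\operatorname{depth}(B)\ge2$. Suppose $\psi:X\to\operatorname{Spec}(B)$ is a dimension-preserving saturated embedding such that whenever $x\in X$ with $\operatorname{ht}(x)=1$, $Q\in\operatorname{Spec}(B)$ with $\psi(x)\subsetneq Q$, and $b\in B$, we have $Q\not\subseteq\mathfrak q$ for every $\mathfrak q\in\operatorname{Ass}(B/bB)$ and $\operatorname{depth}(B_Q)\ge2$. Let $x_1,\dots,x_m$ be the height one elements of $X$. Then there exists a local unique factorization domain $(A,M\cap A)$ such that: (1) $A\subseteq B$; (2) the inclusion induces $\widehat A=\widehat B$; (3) there are distinct nonzero elements $\widetilde{x_1},\dots,\widetilde{x_m}\in A$ with $\psi(x_i)\cap A=\widetilde{x_i}A$ for all $i$; (4) for $x,y\in X$ with $\operatorname{ht}(x)=1$, $x\le y$ if and only if $\psi(x)\cap A\subseteq\psi(y)\cap A$; (5) the map $f:\operatorname{Spec}(B)\to\operatorname{Spec}(A)$, $f(P)=A\cap P$, is surjective, and if $P\in\operatorname{Spec}(B)$ satisfies $\psi(x)\subsetneq P$ for some height one node $x$ of $X$, then $f(P)B=P$; in particular, if $P_1,P_2\in\operatorname{Spec}(B)$ each strictly contain $\psi(x)$ for some height one node $x$ and $f(P_1)=f(P_2)$, then $P_1=P_2$.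
   Context: $x<_cy$ means $x<y$ with nothing strictly between; chain length = number of elements minus one; $\dim$ = supremum of chain lengths; $\operatorname{ht}(x)$ = length of longest saturated chain from a minimal element to $x$. A saturated embedding $f$ satisfies $x\le y\iff f(x)\le f(y)$ and $x<_cy\Rightarrow f(x)<_cf(y)$; into $\operatorname{Spec}(B)$ (ordered by inclusion) it is dimension-preserving if $\dim X=\dim B$. Local = Noetherian with unique maximal ideal; $\widehat{R}$ is the completion. *)

theory Defs
  imports "HOL-Algebra.Algebra" "HOL-Library.Equipollence" "HOL-Library.Countable_Set"
    "HOL-Library.Extended_Nat"
begin

definition strictly :: "('a \<Rightarrow> 'a \<Rightarrow> bool) \<Rightarrow> 'a \<Rightarrow> 'a \<Rightarrow> bool" where
  "strictly lr x y \<longleftrightarrow> lr x y \<and> x \<noteq> y"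

definition covers :: "'a set \<Rightarrow> ('a \<Rightarrow> 'a \<Rightarrow> bool) \<Rightarrow> 'a \<Rightarrow> 'a \<Rightarrow> bool" where
  "covers S lr x y \<longleftrightarrow> x \<in> S \<and> y \<in> S \<and> strictly lr x y \<and>
     \<not> (\<exists>z\<in>S. strictly lr x z \<and> strictly lr z y)"

definition is_chain :: "'a set \<Rightarrow> ('a \<Rightarrow> 'a \<Rightarrow> bool) \<Rightarrow> 'a list \<Rightarrow> bool" where
  "is_chain S lr l \<longleftrightarrow> l \<noteq> [] \<and> set l \<subseteq> S \<and> sorted_wrt (strictly lr) l"

definition is_saturated_chain :: "'a set \<Rightarrow> ('a \<Rightarrow> 'a \<Rightarrow> bool) \<Rightarrow> 'a list \<Rightarrow> bool" where
  "is_saturated_chain S lr l \<longleftrightarrow> is_chain S lr l \<and>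
     (\<forall>i. Suc i < length l \<longrightarrow> covers S lr (l ! i) (l ! Suc i))"

definition poset_dim :: "'a set \<Rightarrow> ('a \<Rightarrow> 'a \<Rightarrow> bool) \<Rightarrow> enat" where
  "poset_dim S lr = Sup {enat (length l - 1) | l. is_chain S lr l}"

definition minimal_elems :: "'a set \<Rightarrow> ('a \<Rightarrow> 'a \<Rightarrow> bool) \<Rightarrow> 'a set" where
  "minimal_elems S lr = {m \<in> S. \<not> (\<exists>y\<in>S. strictly lr y m)}"

definition maximal_elems :: "'a set \<Rightarrow> ('a \<Rightarrow> 'a \<Rightarrow> bool) \<Rightarrow> 'a set" where
  "maximal_elems S lr = {m \<in> S. \<not> (\<exists>y\<in>S. strictly lr m y)}"

definition poset_ht :: "'a set \<Rightarrow> ('a \<Rightarrow> 'a \<Rightarrow> bool) \<Rightarrow> 'a \<Rightarrow> enat" where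
  "poset_ht S lr x = Sup {enat (length l - 1) | l. is_saturated_chain S lr l \<and>
      hd l \<in> minimal_elems S lr \<and> last l = x}"

definition saturated_embedding ::
  "'a set \<Rightarrow> ('a \<Rightarrow> 'a \<Rightarrow> bool) \<Rightarrow> 'b set \<Rightarrow> ('b \<Rightarrow> 'b \<Rightarrow> bool) \<Rightarrow> ('a \<Rightarrow> 'b) \<Rightarrow> bool" where
  "saturated_embedding S1 r1 S2 r2 g \<longleftrightarrow> (\<forall>x\<in>S1. g x \<in> S2) \<and>
     (\<forall>x\<in>S1. \<forall>y\<in>S1. r1 x y \<longleftrightarrow> r2 (g x) (g y)) \<and>
     (\<forall>x\<in>S1. \<forall>y\<in>S1. covers S1 r1 x y \<longrightarrow> covers S2 r2 (g x) (g y))"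

definition Spec :: "('a, 'b) ring_scheme \<Rightarrow> 'a set set" where
  "Spec R = {P. primeideal P R}"

definition local_ring :: "('a, 'b) ring_scheme \<Rightarrow> 'a set \<Rightarrow> bool" where
  "local_ring R M \<longleftrightarrow> noetherian_ring R \<and> cring R \<and> maximalideal M R \<and>
     (\<forall>N. maximalideal N R \<longrightarrow> N = M)"

definition local_domain :: "('a, 'b) ring_scheme \<Rightarrow> 'a set \<Rightarrow> bool" where
  "local_domain R M \<longleftrightarrow> local_ring R M \<and> domain R"

definition contains_rationals :: "('a, 'b) ring_scheme \<Rightarrow> bool" where
  "contains_rationals R \<longleftrightarrow> (\<forall>n::nat. 0 < n \<longrightarrow> [n] \<cdot>\<^bsub>R\<^esub> \<one>\<^bsub>R\<^esub> \<in> Units R)"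

definition regular_sequence :: "('a, 'b) ring_scheme \<Rightarrow> 'a set \<Rightarrow> 'a list \<Rightarrow> bool" where
  "regular_sequence R I xs \<longleftrightarrow> set xs \<subseteq> I \<and>
     (\<forall>i < length xs. \<forall>c\<in>carrier R.
        xs ! i \<otimes>\<^bsub>R\<^esub> c \<in> Idl\<^bsub>R\<^esub> (set (take i xs)) \<longrightarrow> c \<in> Idl\<^bsub>R\<^esub> (set (take i xs))) \<and>
     Idl\<^bsub>R\<^esub> (set xs) \<noteq> carrier R"

definition depth :: "('a, 'b) ring_scheme \<Rightarrow> 'a set \<Rightarrow> enat" where
  "depth R M = Sup {enat (length xs) | xs. regular_sequence R M xs}"

definition Ass_quot :: "('a, 'b) ring_scheme \<Rightarrow> 'a \<Rightarrow> 'a set set" where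
  "Ass_quot R b = {q. primeideal q R \<and>
     (\<exists>c\<in>carrier R. q = {x \<in> carrier R. x \<otimes>\<^bsub>R\<^esub> c \<in> PIdl\<^bsub>R\<^esub> b})}"

definition loc_rel :: "('a, 'b) ring_scheme \<Rightarrow> 'a set \<Rightarrow> (('a \<times> 'a) \<times> ('a \<times> 'a)) set" where
  "loc_rel R S = {((a, s), (b, t)). a \<in> carrier R \<and> b \<in> carrier R \<and> s \<in> S \<and> t \<in> S \<and>
     (\<exists>u\<in>S. u \<otimes>\<^bsub>R\<^esub> ((a \<otimes>\<^bsub>R\<^esub> t) \<ominus>\<^bsub>R\<^esub> (b \<otimes>\<^bsub>R\<^esub> s)) = \<zero>\<^bsub>R\<^esub>)}"

definition loc_class :: "('a, 'b) ring_scheme \<Rightarrow> 'a set \<Rightarrow> 'a \<Rightarrow> 'a \<Rightarrow> ('a \<times> 'a) set" where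
  "loc_class R S a s = loc_rel R S `` {(a, s)}"

definition loc_mult :: "('a, 'b) ring_scheme \<Rightarrow> 'a set \<Rightarrow> ('a \<times> 'a) set \<Rightarrow> ('a \<times> 'a) set \<Rightarrow> ('a \<times> 'a) set" where
  "loc_mult R S U V = loc_rel R S `` {(a \<otimes>\<^bsub>R\<^esub> b, s \<otimes>\<^bsub>R\<^esub> t) | a s b t. (a, s) \<in> U \<and> (b, t) \<in> V}"

definition loc_add :: "('a, 'b) ring_scheme \<Rightarrow> 'a set \<Rightarrow> ('a \<times> 'a) set \<Rightarrow> ('a \<times> 'a) set \<Rightarrow> ('a \<times> 'a) set" where
  "loc_add R S U V = loc_rel R S `` {((a \<otimes>\<^bsub>R\<^esub> t) \<oplus>\<^bsub>R\<^esub> (b \<otimes>\<^bsub>R\<^esub> s), s \<otimes>\<^bsub>R\<^esub> t) | a s b t.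
     (a, s) \<in> U \<and> (b, t) \<in> V}"

definition localization :: "('a, 'b) ring_scheme \<Rightarrow> 'a set \<Rightarrow> (('a \<times> 'a) set) ring" where
  "localization R S = \<lparr> carrier = (carrier R \<times> S) // loc_rel R S,
     monoid.mult = loc_mult R S,
     one = loc_class R S \<one>\<^bsub>R\<^esub> \<one>\<^bsub>R\<^esub>,
     ring.zero = loc_class R S \<zero>\<^bsub>R\<^esub> \<one>\<^bsub>R\<^esub>,
     ring.add = loc_add R S \<rparr>"

definition localize_at :: "('a, 'b) ring_scheme \<Rightarrow> 'a set \<Rightarrow> (('a \<times> 'a) set) ring" where
  "localize_at R Q = localization R (carrier R - Q)"

definition localized_max :: "('a, 'b) ring_scheme \<Rightarrow> 'a set \<Rightarrow> ('a \<times> 'a) set set" where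
  "localized_max R Q = Idl\<^bsub>localize_at R Q\<^esub> ((\<lambda>a. loc_class R (carrier R - Q) a \<one>\<^bsub>R\<^esub>) ` Q)"

fun ideal_pow :: "('a, 'b) ring_scheme \<Rightarrow> 'a set \<Rightarrow> nat \<Rightarrow> 'a set" where
  "ideal_pow R I 0 = carrier R"
| "ideal_pow R I (Suc n) = ideal_prod R I (ideal_pow R I n)"

text \<open>I-adic completion as the inverse limit of the R/I^n (compatible families of cosets)\<close>
definition completion :: "('a, 'b) ring_scheme \<Rightarrow> 'a set \<Rightarrow> (nat \<Rightarrow> 'a set) ring" where
  "completion R I = \<lparr>
     carrier = {f. (\<forall>n. f n \<in> carrier (R Quot ideal_pow R I n)) \<and> (\<forall>n. f (Suc n) \<subseteq> f n)},
     monoid.mult = (\<lambda>f g n. f n \<otimes>\<^bsub>R Quot ideal_pow R I n\<^esub> g n),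
     one = (\<lambda>n. \<one>\<^bsub>R Quot ideal_pow R I n\<^esub>),
     ring.zero = (\<lambda>n. \<zero>\<^bsub>R Quot ideal_pow R I n\<^esub>),
     ring.add = (\<lambda>f g n. f n \<oplus>\<^bsub>R Quot ideal_pow R I n\<^esub> g n) \<rparr>"

text \<open>for a subring A of B with M_A contained in M_B: the map of completions induced by inclusion\<close>
definition induced_completion_map ::
  "('a, 'b) ring_scheme \<Rightarrow> 'a set \<Rightarrow> (nat \<Rightarrow> 'a set) \<Rightarrow> (nat \<Rightarrow> 'a set)" where
  "induced_completion_map B M f = (\<lambda>n. f n <+>\<^bsub>B\<^esub> ideal_pow B M n)"

end

theory Submission
  imports Defs
begin

text \<open>
  \<open>A\<close> is the union of a transfinite chain of small subrings \<open>R\<close> of \<open>B\<close>, each factorial and closed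
  under the fractions lying in \<open>B\<close>, whose atoms \<open>p\<close> satisfy: \<open>B/pB\<close> is torsion free over \<open>R/pR\<close>.
  Replacing \<open>R\<close> by \<open>K(x) \<inter> B\<close>, with \<open>K\<close> the field of fractions of \<open>R\<close>, preserves this and the primes
  of \<open>R\<close> if \<open>x\<close> is transcendental over \<open>R\<close> modulo the finitely many associated primes of every atom,
  and such \<open>x\<close> exist in each coset \<open>b + J\<close> of an ideal \<open>J\<close> contained in none of those primes, because
  the residue field is larger than \<open>R\<close>.  The chain starts with generic elements of the height
  one primes \<open>\<psi>(x\<^sub>i)\<close>; afterwards \<open>A\<close> is made to meet all cosets of all ideals that lie in no
  associated prime of a principal ideal, and to contain solutions of \<open>c = y1 x1 + y2 x2\<close> for
  regular pairs \<open>y1, y2\<close> whenever \<open>B\<close> does.  This forces \<open>IB \<inter> A = I\<close> for all ideals of \<open>A\<close>, hence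
  that \<open>A\<close> is Noetherian with the same completion, and by Nakayama's lemma \<open>(P \<inter> A)B = P\<close> for all
  primes \<open>P\<close> strictly above some \<open>\<psi>(x\<^sub>i)\<close>.
\<close>

subsection \<open>Associated primes in Noetherian rings\<close>

text \<open>The obstacle is the two-generator case of \<open>IB \<inter> A = I\<close>. For one
  generator closure under fractions suffices, and a third generator can be absorbed because the
  coset of its coefficient modulo a dense ideal \<open>(z1, z2)\<close> meets \<open>A\<close>. With
  two generators the coefficients of a given \<open>c\<close> vary only along the syzygy
  \<open>(y2, - y1)\<close>, so a single parameter \<open>t\<close> must make
  \<open>b1 + y2 t\<close> or \<open>b2 - y1 t\<close> generic for each prime of \<open>R\<close>.
  Torsion freeness of \<open>B/pB\<close>, rather than mere primality of \<open>p\<close> in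
  \<open>R\<close>, turns coprimality in \<open>R\<close> into regularity in \<open>B\<close>, which
  both arguments need. Each hypothesis on size has one job: \<open>B/M\<close> uncountable makes the
  countable starting ring small, and \<open>|B| = |B/M|\<close> lets all tasks be scheduled along a
  well-order whose proper initial segments are smaller than the residue field. The rationals supply
  infinitely many scalars with unit differences. Finally \<open>n \<ge> 2\<close> puts
  \<open>M\<close> strictly above some \<open>\<psi>(x)\<close> with \<open>x\<close> of height one,
  so that all powers of \<open>M\<close> are dense; this gives the completion.\<close>

text \<open>The ascending chain condition replaces any continuity of \<open>P\<close>: a nonempty
  chain of ideals contains its own union, so Zorn's lemma applies to an arbitrary property.\<close>

lemma (in noetherian_ring) maximal_ideal_such_that:
  assumes "ideal I R" "P I"
  shows "\<exists>J. ideal J R \<and> P J \<and> (\<forall>K. ideal K R \<longrightarrow> P K \<longrightarrow> J \<subseteq> K \<longrightarrow> K = J)"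
proof -
  let ?F = "{I. ideal I R \<and> P I}"
  have "\<exists>J\<in>?F. \<forall>K\<in>?F. J \<subseteq> K \<longrightarrow> K = J"
  proof (rule subset_Zorn_nonempty)
    show "?F \<noteq> {}" using assms by blast
    fix C assume C: "C \<noteq> {}" "subset.chain ?F C"
    then have "subset.chain {I. ideal I R} C"
      unfolding subset.chain_def by auto
    then have "\<Union>C \<in> C" using ideal_chain_is_trivial C(1) by blast
    then show "\<Union>C \<in> ?F" using C(2) unfolding subset.chain_def by auto
  qed
  then show ?thesis by blast
qed

lemma (in cring) colon_ideal:
  assumes I: "ideal I R" and c: "c \<in> carrier R"
  shows "ideal {x \<in> carrier R. x \<otimes> c \<in> I} R"
proof -
  have "{x \<in> carrier R. x \<otimes> c \<in> I} = {x \<in> carrier R. c \<otimes> x \<in> I}"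
    using c m_comm by auto
  then show ?thesis using ideal.helper_max_prime[OF I is_cring c] by simp
qed

lemma (in cring) mem_PIdl_iff:
  "x \<in> PIdl a \<longleftrightarrow> (\<exists>c\<in>carrier R. x = c \<otimes> a)"
  unfolding cgenideal_def by blast

lemma (in cring) mem_PIdl_iff_divides:
  assumes "a \<in> carrier R"
  shows "x \<in> PIdl a \<longleftrightarrow> a divides x"
  unfolding mem_PIdl_iff factor_def using m_comm assms by auto

lemma (in cring) ideal_plus_PIdl:
  assumes "ideal I R" "a \<in> carrier R"
  shows "ideal (I <+> PIdl a) R" "I \<subseteq> I <+> PIdl a" "a \<in> I <+> PIdl a"
    "x \<in> I <+> PIdl a \<longleftrightarrow> (\<exists>i\<in>I. \<exists>c\<in>carrier R. x = i \<oplus> c \<otimes> a)"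
proof -
  interpret I: ideal I R by fact
  have eq: "x \<in> I <+> PIdl a \<longleftrightarrow> (\<exists>i\<in>I. \<exists>c\<in>carrier R. x = i \<oplus> c \<otimes> a)" for x
    unfolding set_add_def' UN_iff mem_PIdl_iff singleton_iff Bex_def by metis
  show "ideal (I <+> PIdl a) R"
    by (rule add_ideals[OF assms(1) cgenideal_ideal[OF assms(2)]])
  show "I \<subseteq> I <+> PIdl a"
  proof
    fix i assume i: "i \<in> I"
    then have "i = i \<oplus> \<zero> \<otimes> a" using assms(2) I.Icarr by simp
    then show "i \<in> I <+> PIdl a" unfolding eq using i by blast
  qed
  have "a = \<zero> \<oplus> \<one> \<otimes> a" using assms(2) by simp
  then show "a \<in> I <+> PIdl a" unfolding eq using I.zero_closed by blast
  show "x \<in> I <+> PIdl a \<longleftrightarrow> (\<exists>i\<in>I. \<exists>c\<in>carrier R. x = i \<oplus> c \<otimes> a)" by (rule eq)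
qed

text \<open>Krull's argument: in an ideal maximal among those that contain \<open>I\<close> and miss
  \<open>W\<close>, two outside elements with product inside would each put an element of
  \<open>W\<close> into an enlarged ideal, and the product of these two would lie in the ideal
  itself. It later yields primes lying over primes of \<open>A\<close> and the smaller prime in
  \<open>height_one_contraction\<close>.\<close>

lemma (in noetherian_ring) exists_prime_disjoint:
  assumes cr: "cring R" and I: "ideal I R" and W: "W \<subseteq> carrier R" "\<one> \<in> W"
    and W_mult: "\<And>a b. a \<in> W \<Longrightarrow> b \<in> W \<Longrightarrow> a \<otimes> b \<in> W" and dis: "I \<inter> W = {}"
  shows "\<exists>P. primeideal P R \<and> I \<subseteq> P \<and> P \<inter> W = {}"
proof -
  interpret cring R by fact
  obtain P where P: "ideal P R" "I \<subseteq> P \<and> P \<inter> W = {}"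
    and max: "\<forall>K. ideal K R \<longrightarrow> I \<subseteq> K \<and> K \<inter> W = {} \<longrightarrow> P \<subseteq> K \<longrightarrow> K = P"
    using maximal_ideal_such_that[of I "\<lambda>J. I \<subseteq> J \<and> J \<inter> W = {}"] I dis by blast
  interpret P: ideal P R by (rule P)
  have meets: "\<exists>p\<in>P. \<exists>c\<in>carrier R. p \<oplus> c \<otimes> a \<in> W" if "a \<in> carrier R" "a \<notin> P" for a
  proof (rule ccontr)
    assume "\<not> ?thesis"
    then have "(P <+> PIdl a) \<inter> W = {}"
      by (auto simp: ideal_plus_PIdl(4)[OF P.is_ideal that(1)])
    then have "P <+> PIdl a = P"
      using P(2) ideal_plus_PIdl(1,2)[OF P.is_ideal that(1)] by (intro max[rule_format]) auto
    then show False
      using ideal_plus_PIdl(3)[OF P.is_ideal that(1)] that(2) by blast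
  qed
  have "primeideal P R"
  proof (rule primeidealI[OF P.is_ideal is_cring])
    show "carrier R \<noteq> P" using P W by blast
    fix a b assume ab: "a \<in> carrier R" "b \<in> carrier R" "a \<otimes> b \<in> P"
    show "a \<in> P \<or> b \<in> P"
    proof (rule ccontr)
      assume "\<not> (a \<in> P \<or> b \<in> P)"
      then obtain p c q d where 1: "p \<in> P" "c \<in> carrier R" "p \<oplus> c \<otimes> a \<in> W"
          "q \<in> P" "d \<in> carrier R" "q \<oplus> d \<otimes> b \<in> W"
        using meets ab by meson
      have "p \<in> carrier R" "q \<in> carrier R" using 1 P.Icarr by auto
      then have "(p \<oplus> c \<otimes> a) \<otimes> (q \<oplus> d \<otimes> b) = p \<otimes> (q \<oplus> d \<otimes> b) \<oplus> ((c \<otimes> a) \<otimes> q \<oplus> (c \<otimes> d) \<otimes> (a \<otimes> b))"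
        using 1(2,5) ab by algebra
      moreover have "\<dots> \<in> P"
        using P.I_r_closed[OF 1(1), of "q \<oplus> d \<otimes> b"] P.I_l_closed[OF 1(4), of "c \<otimes> a"]
          P.I_l_closed[OF ab(3), of "c \<otimes> d"] 1(2,5) ab \<open>q \<in> carrier R\<close> by simp
      ultimately show False using W_mult[OF 1(3,6)] P by auto
    qed
  qed
  then show ?thesis using P by blast
qed

text \<open>A maximal annihilator of a nonzero element of \<open>R/I\<close> is prime. The inclusion
  of annihilators is recorded so that a given zero divisor modulo \<open>I\<close> can be placed in
  an associated prime.\<close>

lemma (in noetherian_ring) exists_prime_colon:
  assumes cr: "cring R" and I: "ideal I R" and c: "c \<in> carrier R" "c \<notin> I"
  shows "\<exists>d\<in>carrier R. d \<notin> I \<and> primeideal {x \<in> carrier R. x \<otimes> d \<in> I} R \<and>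
           {x \<in> carrier R. x \<otimes> c \<in> I} \<subseteq> {x \<in> carrier R. x \<otimes> d \<in> I}"
proof -
  interpret cring R by fact
  interpret I: ideal I R by fact
  let ?K = "\<lambda>d. {x \<in> carrier R. x \<otimes> d \<in> I}"
  define P where "P J \<longleftrightarrow> (\<exists>d\<in>carrier R. d \<notin> I \<and> ?K c \<subseteq> ?K d \<and> J = ?K d)" for J
  have "P (?K c)" unfolding P_def by (rule bexI[OF _ c(1)]) (simp add: c(2))
  then obtain Q where Q: "P Q" and max: "\<forall>J. ideal J R \<longrightarrow> P J \<longrightarrow> Q \<subseteq> J \<longrightarrow> J = Q"
    using maximal_ideal_such_that[of _ P, OF colon_ideal[OF I c(1)]] by blast
  obtain d where d: "d \<in> carrier R" "d \<notin> I" "?K c \<subseteq> ?K d" "Q = ?K d" using Q unfolding P_def by blast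
  have "primeideal Q R"
  proof (rule primeidealI)
    show "ideal Q R" using d colon_ideal[OF I] by simp
    show "cring R" by (rule is_cring)
    show "carrier R \<noteq> Q" using d by (metis (no_types, lifting) l_one mem_Collect_eq one_closed)
    fix a b assume ab: "a \<in> carrier R" "b \<in> carrier R" "a \<otimes> b \<in> Q"
    show "a \<in> Q \<or> b \<in> Q"
    proof (rule ccontr)
      assume n: "\<not> (a \<in> Q \<or> b \<in> Q)"
      \<comment> \<open>With \<open>b\<close> outside \<open>Q\<close>, the element
        \<open>b d\<close> is still nonzero modulo \<open>I\<close> and its annihilator contains
        \<open>Q\<close>, hence equals \<open>Q\<close> by maximality; but \<open>a\<close>
        annihilates it.\<close>
      then have bd: "b \<otimes> d \<notin> I" "b \<otimes> d \<in> carrier R" using ab d by auto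
      have sub: "Q \<subseteq> ?K (b \<otimes> d)"
      proof (rule subsetI)
        fix x assume x: "x \<in> Q"
        then have "x \<in> carrier R" "x \<otimes> d \<in> I" using d by auto
        moreover have "x \<otimes> (b \<otimes> d) = b \<otimes> (x \<otimes> d)" using ab d \<open>x \<in> carrier R\<close> by algebra
        ultimately show "x \<in> ?K (b \<otimes> d)" using I.I_l_closed ab by auto
      qed
      have "P (?K (b \<otimes> d))"
        unfolding P_def by (rule bexI[OF _ bd(2)]) (use bd(1) sub d(3,4) in simp)
      then have "?K (b \<otimes> d) = Q" by (rule max[rule_format, OF colon_ideal[OF I bd(2)] _ sub])
      moreover have "a \<in> ?K (b \<otimes> d)" using ab d by (auto simp: m_assoc)
      ultimately show False using n by blast
    qed
  qed
  then show ?thesis using d by blast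
qed

text \<open>
  A maximal ideal \<open>I\<close> for which only finitely many associated primes of \<open>b\<close> are annihilators
  modulo \<open>b\<close> of elements of \<open>I\<close> must be everything, since enlarging \<open>I\<close> by an element \<open>a\<close> whose
  colon ideal \<open>(I : a)\<close> is prime adds at most that prime.
\<close>
lemma (in noetherian_ring) finite_Ass_quot:
  assumes cr: "cring R" and b: "b \<in> carrier R"
  shows "finite (Ass_quot R b)"
proof -
  interpret cring R by fact
  let ?A = "\<lambda>I. {q. primeideal q R \<and> (\<exists>c\<in>I. q = {x \<in> carrier R. x \<otimes> c \<in> PIdl b})}"
  interpret b: ideal "PIdl b" R by (rule cgenideal_ideal[OF b])
  have "?A (PIdl b) = {}"
  proof -
    have False if q: "primeideal q R" "c \<in> PIdl b" "q = {x \<in> carrier R. x \<otimes> c \<in> PIdl b}" for q c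
    proof -
      have "q = carrier R" using q b.I_l_closed by blast
      then show False using primeideal.I_notcarr[OF q(1)] by simp
    qed
    then show ?thesis by blast
  qed
  then have "finite (?A (PIdl b))" by (simp only: finite.emptyI)
  then obtain I where I: "ideal I R" "PIdl b \<subseteq> I \<and> finite (?A I)"
    and max: "\<forall>K. ideal K R \<longrightarrow> PIdl b \<subseteq> K \<and> finite (?A K) \<longrightarrow> I \<subseteq> K \<longrightarrow> K = I"
    using maximal_ideal_such_that[of "PIdl b" "\<lambda>I. PIdl b \<subseteq> I \<and> finite (?A I)"] b.is_ideal by blast
  interpret I: ideal I R by (rule I)
  have "I = carrier R"
  proof (rule ccontr)
    assume "I \<noteq> carrier R"
    then obtain c where "c \<in> carrier R" "c \<notin> I" using I.a_subset by blast
    then obtain a where a: "a \<in> carrier R" "a \<notin> I" "primeideal {x \<in> carrier R. x \<otimes> a \<in> I} R"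
      using exists_prime_colon[OF cr I.is_ideal] by blast
    define P where "P = {x \<in> carrier R. x \<otimes> a \<in> I}"
    interpret P: primeideal P R using a P_def by simp
    have P_iff: "x \<in> P \<longleftrightarrow> x \<in> carrier R \<and> x \<otimes> a \<in> I" for x
      unfolding P_def by simp
    let ?J = "I <+>\<^bsub>R\<^esub> PIdl a"
    note J = ideal_plus_PIdl[OF I.is_ideal a(1)]
    have "?A ?J \<subseteq> insert P (?A I)"
    proof
      fix q assume "q \<in> ?A ?J"
      then obtain c where q: "primeideal q R" "c \<in> ?J" "q = {x \<in> carrier R. x \<otimes> c \<in> PIdl b}"
        by blast
      interpret q: primeideal q R by fact
      obtain i r where ir: "i \<in> I" "r \<in> carrier R" "c = i \<oplus> r \<otimes> a" using q(2) J(4) by blast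
      have ic: "i \<in> carrier R" using ir I.Icarr by simp
      have cc: "c \<in> carrier R" using ir ic a by simp
      \<comment> \<open>If some \<open>s\<close> outside \<open>q\<close> moves \<open>c\<close>
        into \<open>I\<close>, then \<open>s c\<close> has the same annihilator \<open>q\<close>
        modulo \<open>b\<close>. Otherwise annihilating \<open>c\<close> modulo \<open>b\<close> and
        modulo \<open>I\<close> mean the same, and modulo \<open>I\<close> only the summand
        \<open>r a\<close> of \<open>c\<close> matters.\<close>
      show "q \<in> insert P (?A I)"
      proof (cases "\<exists>s\<in>carrier R. s \<notin> q \<and> s \<otimes> c \<in> I")
        case True
        then obtain s where s: "s \<in> carrier R" "s \<notin> q" "s \<otimes> c \<in> I" by blast
        have mem: "x \<in> q \<longleftrightarrow> x \<otimes> (s \<otimes> c) \<in> PIdl b" if "x \<in> carrier R" for x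
        proof -
          have "x \<otimes> (s \<otimes> c) = (x \<otimes> s) \<otimes> c" using that s cc by algebra
          moreover have "x \<in> q \<longleftrightarrow> x \<otimes> s \<in> q"
            using s q.I_prime[OF that s(1)] q.I_r_closed[of x s] by auto
          moreover have "x \<otimes> s \<in> q \<longleftrightarrow> (x \<otimes> s) \<otimes> c \<in> PIdl b"
            using that s(1) by (subst q(3)) simp
          ultimately show ?thesis by simp
        qed
        have "q = {x \<in> carrier R. x \<otimes> (s \<otimes> c) \<in> PIdl b}"
          using mem q.a_subset by blast
        then show ?thesis using s(3) q(1) by (intro insertI2 CollectI conjI bexI)
      next
        case False
        have mem: "x \<in> q \<longleftrightarrow> x \<otimes> (r \<otimes> a) \<in> I" if x: "x \<in> carrier R" for x
        proof -
          have "x \<otimes> c = x \<otimes> i \<oplus> x \<otimes> (r \<otimes> a)" using x ir a ic by algebra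
          moreover have "x \<otimes> i \<in> I" using ir x I.I_l_closed by blast
          moreover have "x \<otimes> (r \<otimes> a) = x \<otimes> c \<ominus> x \<otimes> i" using x ir a ic by algebra
          ultimately have "x \<otimes> c \<in> I \<longleftrightarrow> x \<otimes> (r \<otimes> a) \<in> I"
            by (metis I.a_closed I.a_inv_closed a_minus_def)
          moreover have "x \<in> q \<Longrightarrow> x \<otimes> c \<in> I"
            using q(3) I(2) by blast
          moreover have "x \<otimes> c \<in> I \<Longrightarrow> x \<in> q"
            using False x by blast
          ultimately show ?thesis by blast
        qed
        have rP: "r \<notin> P"
        proof
          assume "r \<in> P"
          then have "\<one> \<otimes> (r \<otimes> a) \<in> I" using P_iff[of r] ir(2) a(1) by simp
          then have "\<one> \<in> q" using mem[OF one_closed] by simp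
          then show False using q.one_imp_carrier q.I_notcarr by simp
        qed
        have qP: "x \<in> q \<longleftrightarrow> x \<in> P" if x: "x \<in> carrier R" for x
        proof -
          have "x \<in> q \<longleftrightarrow> x \<otimes> r \<in> P" using mem[OF x] x ir(2) a(1) P_iff by (simp add: m_assoc)
          also have "\<dots> \<longleftrightarrow> x \<in> P" using P.I_prime[OF x ir(2)] rP P.I_r_closed[of x r] ir(2) by blast
          finally show ?thesis .
        qed
        have "q = P" by (intro equalityI subsetI) (use qP q.Icarr P.Icarr in metis)+
        then show ?thesis by simp
      qed
    qed
    then have "finite (?A ?J)" by (rule finite_subset) (use I(2) in simp)
    then have "?J = I" using J(1,2) I(2) by (intro max[rule_format]) auto
    then show False using J(3) a(2) by blast
  qed
  then show ?thesis using I unfolding Ass_quot_def by simp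
qed

subsection \<open>Regular elements of a local Noetherian domain\<close>

locale local_noetherian_domain = noetherian_domain B for B :: "('b, 'c) ring_scheme" (structure) +
  fixes M :: "'b set"
  assumes maximal: "maximalideal M B"
    and unique_maximal: "maximalideal N B \<Longrightarrow> N = M"
begin

sublocale M: maximalideal M B by (rule maximal)

lemma proper_ideal_subset_M:
  assumes "ideal I B" "I \<noteq> carrier B"
  shows "I \<subseteq> M"
proof -
  obtain N where N: "ideal N B" "I \<subseteq> N \<and> N \<noteq> carrier B"
    and max: "\<forall>J. ideal J B \<longrightarrow> I \<subseteq> J \<and> J \<noteq> carrier B \<longrightarrow> N \<subseteq> J \<longrightarrow> J = N"
    using maximal_ideal_such_that[of I "\<lambda>J. I \<subseteq> J \<and> J \<noteq> carrier B"] assms by blast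
  then have "maximalideal N B"
    by (intro maximalidealI) (use max in blast)+
  then show ?thesis using N unique_maximal by blast
qed

lemma prime_subset_M: "primeideal q B \<Longrightarrow> q \<subseteq> M"
  using proper_ideal_subset_M primeideal.I_notcarr primeideal.axioms(1) by metis

lemma one_notin_M: "\<one> \<notin> M"
  using M.one_imp_carrier M.I_notcarr by blast

lemma Units_iff: "x \<in> carrier B \<Longrightarrow> x \<in> Units B \<longleftrightarrow> x \<notin> M"
proof
  assume x: "x \<in> carrier B" "x \<in> Units B"
  show "x \<notin> M"
  proof
    assume "x \<in> M"
    then have "inv x \<otimes> x \<in> M" using M.I_l_closed x(2) by blast
    then show False using x one_notin_M by simp
  qed
next
  assume x: "x \<in> carrier B" "x \<notin> M"
  have "PIdl x = carrier B"
  proof (rule ccontr)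
    assume "PIdl x \<noteq> carrier B"
    then show False using proper_ideal_subset_M[OF cgenideal_ideal[OF x(1)]] cgenideal_self[OF x(1)] x by blast
  qed
  then have "x divides \<one>" using mem_PIdl_iff_divides[OF x(1)] by blast
  then show "x \<in> Units B" using divides_one[OF x(1)] by simp
qed

text \<open>Well-founded because \<open>b = m a\<close> with \<open>m\<close> in \<open>M\<close>
  makes \<open>(a)\<close> strictly larger than \<open>(b)\<close>: otherwise cancellation gives
  \<open>d m = 1\<close>. It serves in place of induction on the number of prime factors, which does
  not make sense in \<open>B\<close>.\<close>

lemma divisor_induct [consumes 2, case_names step]:
  assumes b: "b \<in> carrier B" "b \<noteq> \<zero>"
    and step: "\<And>b. b \<in> carrier B \<Longrightarrow> b \<noteq> \<zero> \<Longrightarrow>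
      (\<And>a m. a \<in> carrier B \<Longrightarrow> m \<in> M \<Longrightarrow> b = m \<otimes> a \<Longrightarrow> P a) \<Longrightarrow> P b"
  shows "P b"
proof (rule ccontr)
  assume "\<not> P b"
  define F where "F J \<longleftrightarrow> (\<exists>a. a \<in> carrier B \<and> a \<noteq> \<zero> \<and> \<not> P a \<and> J = PIdl a)" for J
  have "F (PIdl b)" unfolding F_def using b \<open>\<not> P b\<close> by blast
  then obtain I where "F I" and max: "\<forall>J. ideal J B \<longrightarrow> F J \<longrightarrow> I \<subseteq> J \<longrightarrow> J = I"
    using maximal_ideal_such_that[of _ F, OF cgenideal_ideal[OF b(1)]] by blast
  then obtain a where a: "a \<in> carrier B" "a \<noteq> \<zero>" "\<not> P a" "I = PIdl a" unfolding F_def by blast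
  show False
  proof (rule a(3)[THEN notE], rule step[OF a(1,2)])
    fix c m assume c: "c \<in> carrier B" "m \<in> M" "a = m \<otimes> c"
    have mc: "m \<in> carrier B" using c M.Icarr by blast
    show "P c"
    proof (rule ccontr)
      assume "\<not> P c"
      moreover have "c \<noteq> \<zero>" using a c mc by auto
      moreover have "PIdl a \<subseteq> PIdl c"
        using c(3) mc cgenideal_minimal[OF cgenideal_ideal[OF c(1)], of a] mem_PIdl_iff by blast
      ultimately have "PIdl c = PIdl a" using max[rule_format, of "PIdl c", unfolded F_def] cgenideal_ideal[OF c(1)] a(4) c(1) by blast
      then obtain d where d: "d \<in> carrier B" "c = d \<otimes> a"
        using cgenideal_self[OF c(1)] mem_PIdl_iff by auto
      have "(d \<otimes> m) \<otimes> c = \<one> \<otimes> c"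
      proof -
        have "\<one> \<otimes> c = d \<otimes> (m \<otimes> c)" using d c by simp
        then show ?thesis using d(1) mc c(1) by (simp add: m_assoc)
      qed
      then have "d \<otimes> m = \<one>" using m_rcancel[OF \<open>c \<noteq> \<zero>\<close> c(1), of "d \<otimes> m" \<one>] d(1) mc by blast
      then show False using M.I_l_closed[OF c(2) d(1)] one_notin_M by simp
    qed
  qed
qed

text \<open>Multiplication by \<open>r\<close> is injective on \<open>B/pB\<close>. Unlike for
  regular sequences no properness is imposed, so units are allowed in either place.\<close>

definition regular :: "'b \<Rightarrow> 'b \<Rightarrow> bool" where
  "regular r p \<longleftrightarrow> (\<forall>c\<in>carrier B. p divides (r \<otimes> c) \<longrightarrow> p divides c)"

lemma regularD: "regular r p \<Longrightarrow> c \<in> carrier B \<Longrightarrow> p divides (r \<otimes> c) \<Longrightarrow> p divides c"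
  unfolding regular_def by blast

lemma divides_carrier: "p divides a \<Longrightarrow> p \<in> carrier B \<Longrightarrow> a \<in> carrier B"
  unfolding factor_def by auto

lemma divides_mult_right: "p divides a \<Longrightarrow> p \<in> carrier B \<Longrightarrow> c \<in> carrier B \<Longrightarrow> p divides (a \<otimes> c)"
  unfolding factor_def by (auto simp: m_assoc)

lemma divides_mult_left: "p divides a \<Longrightarrow> p \<in> carrier B \<Longrightarrow> c \<in> carrier B \<Longrightarrow> p divides (c \<otimes> a)"
  using divides_mult_right divides_carrier m_comm by metis

lemma divides_sum: "p divides a \<Longrightarrow> p divides b \<Longrightarrow> p \<in> carrier B \<Longrightarrow> p divides (a \<oplus> b)"
  unfolding factor_def by (metis a_closed r_distr)

lemma divides_minus: "p divides a \<Longrightarrow> p divides b \<Longrightarrow> p \<in> carrier B \<Longrightarrow> p divides (a \<ominus> b)"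
proof -
  assume a: "p divides a" "p divides b" "p \<in> carrier B"
  then obtain c d where c: "c \<in> carrier B" "a = p \<otimes> c" "d \<in> carrier B" "b = p \<otimes> d"
    unfolding factor_def by blast
  have "a \<ominus> b = p \<otimes> (c \<ominus> d)" using c a by algebra
  then show ?thesis unfolding factor_def using c by auto
qed

lemma divides_cancel:
  assumes "c \<noteq> \<zero>" "c \<in> carrier B" "a \<in> carrier B" "b \<in> carrier B"
  shows "(c \<otimes> a) divides (c \<otimes> b) \<longleftrightarrow> a divides b"
  using assms mult_divides divides_mult by blast

lemma regular_mult:
  assumes "regular r p" "regular s p" "r \<in> carrier B" "s \<in> carrier B"
  shows "regular (r \<otimes> s) p"
  unfolding regular_def
proof (intro ballI impI)
  fix c assume c: "c \<in> carrier B" "p divides ((r \<otimes> s) \<otimes> c)"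
  then have "p divides (r \<otimes> (s \<otimes> c))" using assms(3,4) by (simp add: m_assoc)
  then have "p divides (s \<otimes> c)" using regularD[OF assms(1)] assms(4) c(1) by simp
  then show "p divides c" by (rule regularD[OF assms(2) c(1)])
qed

lemma regular_multD:
  assumes "regular (r \<otimes> s) p" "r \<in> carrier B" "s \<in> carrier B" "p \<in> carrier B"
  shows "regular s p"
  unfolding regular_def
proof (intro ballI impI)
  fix c assume c: "c \<in> carrier B" "p divides (s \<otimes> c)"
  then have "p divides (r \<otimes> (s \<otimes> c))" using assms divides_mult_left by blast
  then show "p divides c" using assms c regularD[OF assms(1)] by (simp add: m_assoc)
qed

text \<open>In a domain a regular pair can be permuted without any argument on local rings:
  \<open>p c = r b\<close> forces \<open>b = p e\<close>, and cancelling the nonzero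
  \<open>p\<close> gives \<open>c = r e\<close>.\<close>

lemma regular_swap:
  assumes reg: "regular r p" and p: "p \<in> carrier B" "p \<noteq> \<zero>" and r: "r \<in> carrier B"
  shows "regular p r"
  unfolding regular_def
proof (intro ballI impI)
  fix c assume c: "c \<in> carrier B" "r divides (p \<otimes> c)"
  then obtain b where b: "b \<in> carrier B" "p \<otimes> c = r \<otimes> b" unfolding factor_def by blast
  have "p divides (r \<otimes> b)" using b c p by (metis factor_def)
  then obtain e where e: "e \<in> carrier B" "b = p \<otimes> e" using regularD[OF reg b(1)] unfolding factor_def by blast
  have "p \<otimes> c = p \<otimes> (r \<otimes> e)" using b(2) e p r by algebra
  then have "c = r \<otimes> e" using p c r e m_lcancel by simp
  then show "r divides c" unfolding factor_def using e by blast
qed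

lemma not_unit_divides: "p \<in> M \<Longrightarrow> \<not> p divides \<one>"
  using Units_iff divides_one M.Icarr by blast

lemma regular_not_divides:
  assumes "regular r p" "r \<in> carrier B" "p \<in> M"
  shows "\<not> p divides r"
proof
  assume "p divides r"
  then have "p divides (r \<otimes> \<one>)" using assms by simp
  then show False using regularD[OF assms(1)] not_unit_divides assms by blast
qed

lemma regular_unit:
  assumes "u \<in> Units B" "p \<in> carrier B"
  shows "regular u p"
  unfolding regular_def
proof (intro ballI impI)
  fix c assume c: "c \<in> carrier B" "p divides (u \<otimes> c)"
  then have "p divides (inv u \<otimes> (u \<otimes> c))" using assms divides_mult_left by simp
  moreover have "inv u \<otimes> (u \<otimes> c) = (inv u \<otimes> u) \<otimes> c" using assms c by (simp only: m_assoc Units_closed Units_inv_closed)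
  ultimately show "p divides c" using assms c by simp
qed

text \<open>With \<open>Ass_quotD\<close> this says that the zero divisors modulo \<open>p\<close>
  are the union of the associated primes of \<open>p\<close>, of which there are finitely many.
  Regularity thus becomes avoidance of finitely many primes.\<close>

lemma Ass_of_not_regular:
  assumes "p \<in> carrier B" "r \<in> carrier B" "\<not> regular r p"
  shows "\<exists>q\<in>Ass_quot B p. r \<in> q"
proof -
  obtain c where c: "c \<in> carrier B" "p divides (r \<otimes> c)" "\<not> p divides c"
    using assms unfolding regular_def by blast
  have "c \<notin> PIdl p" using c mem_PIdl_iff_divides assms by blast
  then obtain d where d: "d \<in> carrier B" "d \<notin> PIdl p" "primeideal {x \<in> carrier B. x \<otimes> d \<in> PIdl p} B"
     "{x \<in> carrier B. x \<otimes> c \<in> PIdl p} \<subseteq> {x \<in> carrier B. x \<otimes> d \<in> PIdl p}"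
    using exists_prime_colon[OF is_cring cgenideal_ideal[OF assms(1)] c(1)] by blast
  moreover have "r \<in> {x \<in> carrier B. x \<otimes> c \<in> PIdl p}"
    using c assms mem_PIdl_iff_divides by auto
  ultimately show ?thesis unfolding Ass_quot_def by blast
qed

lemma Ass_quotD:
  assumes "q \<in> Ass_quot B p" "p \<in> carrier B"
  shows "primeideal q B" "p \<in> q" "r \<in> q \<Longrightarrow> \<not> regular r p"
proof -
  obtain c where c: "primeideal q B" "c \<in> carrier B" "q = {x \<in> carrier B. x \<otimes> c \<in> PIdl p}"
    using assms unfolding Ass_quot_def by blast
  show "primeideal q B" by fact
  have "p divides (p \<otimes> c)" using c assms by (auto simp: factor_def)
  then show "p \<in> q" using c mem_PIdl_iff_divides assms by auto
  have "\<not> p divides c"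
  proof
    assume a: "p divides c"
    then have "q = carrier B" using c mem_PIdl_iff_divides[OF assms(2)] divides_mult_left assms(2) by blast
    then show False using c(1) primeideal.I_notcarr by blast
  qed
  then show "\<not> regular r p" if "r \<in> q"
    using that c mem_PIdl_iff_divides[OF assms(2)] unfolding regular_def by blast
qed


subsection \<open>Factorial subrings with torsion-free quotients\<close>

text \<open>This is \<open>D^{-1}T \<inter> B\<close>, formed without a field of fractions since
  \<open>B\<close> is a domain. Two parameters are kept because, besides \<open>D = T\<close>, the
  choice \<open>D = R\<close> is needed: there the coefficients of polynomials over \<open>R\<close>
  behave like a field.\<close>

definition fractions :: "'b set \<Rightarrow> 'b set \<Rightarrow> 'b set" where
  "fractions D T = {b \<in> carrier B. \<exists>d\<in>D. d \<noteq> \<zero> \<and> d \<otimes> b \<in> T}"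

lemma fractionsI: "b \<in> carrier B \<Longrightarrow> d \<in> D \<Longrightarrow> d \<noteq> \<zero> \<Longrightarrow> d \<otimes> b \<in> T \<Longrightarrow> b \<in> fractions D T"
  unfolding fractions_def by auto

lemma fractionsE:
  assumes "b \<in> fractions D T"
  obtains d where "b \<in> carrier B" "d \<in> D" "d \<noteq> \<zero>" "d \<otimes> b \<in> T"
  using assms unfolding fractions_def by auto

lemma fractions_subring:
  assumes D: "subring D B" and T: "subring T B" and DT: "D \<subseteq> T"
  shows "subring (fractions D T) B"
proof (rule subringI)
  note DE = subringE[OF D] and TE = subringE[OF T]
  show "fractions D T \<subseteq> carrier B" unfolding fractions_def by auto
  show "\<one> \<in> fractions D T"
    by (rule fractionsI[of _ \<one>]) (use DE(3) TE(3) in auto)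
  fix a assume "a \<in> fractions D T"
  then obtain d where a: "a \<in> carrier B" "d \<in> D" "d \<noteq> \<zero>" "d \<otimes> a \<in> T" by (rule fractionsE)
  have dc: "d \<in> carrier B" using a DE by auto
  have "d \<otimes> (\<ominus> a) = \<ominus> (d \<otimes> a)" using dc a(1) by algebra
  then show "\<ominus> a \<in> fractions D T"
    by (intro fractionsI[of _ d]) (use a TE(5) in auto)
  fix b assume "b \<in> fractions D T"
  then obtain e where b: "b \<in> carrier B" "e \<in> D" "e \<noteq> \<zero>" "e \<otimes> b \<in> T" by (rule fractionsE)
  have ec: "e \<in> carrier B" using b DE by auto
  have de: "d \<otimes> e \<in> D" "d \<otimes> e \<noteq> \<zero>" using a b DE(6) integral_iff dc ec by auto
  have "(d \<otimes> e) \<otimes> (a \<otimes> b) = (d \<otimes> a) \<otimes> (e \<otimes> b)" using a(1) b(1) dc ec by algebra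
  moreover have "\<dots> \<in> T" using TE(6) a(4) b(4) by blast
  ultimately show "a \<otimes> b \<in> fractions D T"
    by (intro fractionsI[of _ "d \<otimes> e"]) (use a(1) b(1) de in auto)
  have "(d \<otimes> e) \<otimes> (a \<oplus> b) = e \<otimes> (d \<otimes> a) \<oplus> d \<otimes> (e \<otimes> b)" using a(1) b(1) dc ec by algebra
  moreover have "\<dots> \<in> T" using TE(6,7) a(2,4) b(2,4) DT by blast
  ultimately show "a \<oplus> b \<in> fractions D T"
    by (intro fractionsI[of _ "d \<otimes> e"]) (use a(1) b(1) de in auto)
qed

lemma subset_fractions:
  assumes "subring D B" "subring T B"
  shows "T \<subseteq> fractions D T"
proof
  fix a assume a: "a \<in> T"
  then have "a \<in> carrier B" using subringE(1)[OF assms(2)] by blast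
  then show "a \<in> fractions D T"
    by (intro fractionsI[of _ \<one>]) (use a subringE(3)[OF assms(1)] in auto)
qed

text \<open>Equivalent to \<open>R = K \<inter> B\<close> for the field of fractions
  \<open>K\<close> of \<open>R\<close>. Hence divisibility by nonzero elements of \<open>R\<close>
  is the same in \<open>R\<close> and in \<open>B\<close>.\<close>

definition frac_closed :: "'b set \<Rightarrow> bool" where
  "frac_closed R \<longleftrightarrow> subring R B \<and> (\<forall>g\<in>R. \<forall>b\<in>carrier B. g \<noteq> \<zero> \<longrightarrow> g \<otimes> b \<in> R \<longrightarrow> b \<in> R)"

lemma frac_closedD:
  assumes "frac_closed R"
  shows "subring R B" "R \<subseteq> carrier B" "g \<in> R \<Longrightarrow> b \<in> carrier B \<Longrightarrow> g \<noteq> \<zero> \<Longrightarrow> g \<otimes> b \<in> R \<Longrightarrow> b \<in> R"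
  using assms subringE(1) unfolding frac_closed_def by blast+

lemma frac_closed_divides:
  assumes "frac_closed R" "g \<in> R" "g \<noteq> \<zero>" "r \<in> R" "g divides r"
  obtains b where "b \<in> R" "r = g \<otimes> b"
proof -
  obtain b where b: "b \<in> carrier B" "r = g \<otimes> b" using assms(5) unfolding factor_def by blast
  then show ?thesis using that[of b] frac_closedD(3)[OF assms(1,2) b(1) assms(3)] assms(4) by simp
qed

lemma frac_closed_fractions:
  assumes T: "subring T B"
  shows "frac_closed (fractions T T)"
  unfolding frac_closed_def
proof (intro conjI ballI impI)
  note TE = subringE[OF T]
  show "subring (fractions T T) B" using fractions_subring[OF T T] by blast
  fix g b assume "g \<in> fractions T T" and b: "b \<in> carrier B" and g0: "g \<noteq> \<zero>" and "g \<otimes> b \<in> fractions T T"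
  then obtain d e where d: "g \<in> carrier B" "d \<in> T" "d \<noteq> \<zero>" "d \<otimes> g \<in> T"
    and e: "e \<in> T" "e \<noteq> \<zero>" "e \<otimes> (g \<otimes> b) \<in> T"
    by (elim fractionsE)
  have c: "d \<in> carrier B" "e \<in> carrier B" using d e TE by auto
  have "(e \<otimes> (d \<otimes> g)) \<otimes> b = d \<otimes> (e \<otimes> (g \<otimes> b))" using c d(1) b by algebra
  moreover have "\<dots> \<in> T" using TE(6) d(2) e(3) by blast
  moreover have "e \<otimes> (d \<otimes> g) \<in> T" using TE(6) d(4) e(1) by blast
  moreover have "e \<otimes> (d \<otimes> g) \<noteq> \<zero>" using c d e g0 integral_iff by simp
  ultimately show "b \<in> fractions T T"
    by (intro fractionsI[of _ "e \<otimes> (d \<otimes> g)"]) (use b in auto)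
qed

lemma fractions_fractions:
  assumes D: "subring D B" and T: "subring T B" and DT: "D \<subseteq> T"
  shows "fractions (fractions D T) (fractions D T) = fractions T T"
proof
  let ?S = "fractions D T"
  have S: "?S \<subseteq> fractions T T" unfolding fractions_def using DT by blast
  have TS: "T \<subseteq> ?S" by (rule subset_fractions[OF D T])
  show "fractions T T \<subseteq> fractions ?S ?S"
  proof
    fix b assume "b \<in> fractions T T"
    then obtain d where "b \<in> carrier B" "d \<in> T" "d \<noteq> \<zero>" "d \<otimes> b \<in> T" by (rule fractionsE)
    then show "b \<in> fractions ?S ?S" using TS by (intro fractionsI[of b d]) auto
  qed
  show "fractions ?S ?S \<subseteq> fractions T T"
  proof
    fix b assume "b \<in> fractions ?S ?S"
    then obtain d where d: "b \<in> carrier B" "d \<in> ?S" "d \<noteq> \<zero>" "d \<otimes> b \<in> ?S" by (rule fractionsE)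
    show "b \<in> fractions T T"
      by (rule frac_closedD(3)[OF frac_closed_fractions[OF T] _ d(1,3)]) (use d(2,4) S in auto)
  qed
qed

text \<open>
  \<open>strong_prime R p\<close> makes \<open>B/pB\<close> torsion free over \<open>R/pR\<close>.  By the ascending chain condition
  in \<open>B\<close> the good subrings defined below are factorial.
\<close>
definition strong_prime :: "'b set \<Rightarrow> 'b \<Rightarrow> bool" where
  "strong_prime R p \<longleftrightarrow> p \<in> R \<and> p \<in> M \<and> p \<noteq> \<zero> \<and> (\<forall>r\<in>R. p divides r \<or> regular r p)"

text \<open>Nonunits are tested by membership in \<open>M\<close>: in a subring closed under
  fractions the inverse of an element outside \<open>M\<close> belongs to the subring, so for such
  subrings this is irreducibility.\<close>

definition atom :: "'b set \<Rightarrow> 'b \<Rightarrow> bool" where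
  "atom R p \<longleftrightarrow> p \<in> R \<and> p \<in> M \<and> p \<noteq> \<zero> \<and> (\<forall>a\<in>R. \<forall>b\<in>R. p = a \<otimes> b \<longrightarrow> a \<notin> M \<or> b \<notin> M)"

definition good :: "'b set \<Rightarrow> bool" where
  "good R \<longleftrightarrow> frac_closed R \<and> (\<forall>p. atom R p \<longrightarrow> strong_prime R p)"

text \<open>Persistence of strong primes does not follow from inclusion, since a new element may be
  a zero divisor modulo \<open>p\<close> without being a multiple of it. It is what carries goodness
  through limit stages.\<close>

definition extends :: "'b set \<Rightarrow> 'b set \<Rightarrow> bool" where
  "extends R S \<longleftrightarrow> R \<subseteq> S \<and> (\<forall>p. strong_prime R p \<longrightarrow> strong_prime S p)"

lemma extends_refl: "extends R R"
  unfolding extends_def by simp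

lemma extends_trans: "extends R S \<Longrightarrow> extends S T \<Longrightarrow> extends R T"
  unfolding extends_def by blast

lemma strong_primeD:
  assumes "strong_prime R p"
  shows "p \<in> R" "p \<in> M" "p \<noteq> \<zero>" "p \<in> carrier B" "r \<in> R \<Longrightarrow> p divides r \<or> regular r p"
  using assms M.Icarr unfolding strong_prime_def by auto

lemma strong_prime_imp_atom:
  assumes p: "strong_prime R p" and R: "R \<subseteq> carrier B"
  shows "atom R p"
  unfolding atom_def
proof (intro conjI ballI impI)
  note pD = strong_primeD[OF p]
  show "p \<in> R" "p \<in> M" "p \<noteq> \<zero>" by (rule pD)+
  have unit: "b \<notin> M" if ab: "a \<in> R" "b \<in> R" "p = a \<otimes> b" "p divides a" for a b
  proof
    assume bM: "b \<in> M"
    have c: "a \<in> carrier B" "b \<in> carrier B" using ab R by auto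
    obtain c where c': "c \<in> carrier B" "a = p \<otimes> c" using ab(4) unfolding factor_def by blast
    have "p \<otimes> \<one> = p \<otimes> (b \<otimes> c)"
    proof -
      have "p \<otimes> \<one> = a \<otimes> b" using ab(3) pD(4) by simp
      also have "\<dots> = p \<otimes> (b \<otimes> c)" using c' pD(4) c by algebra
      finally show ?thesis .
    qed
    then have "\<one> = b \<otimes> c" using m_lcancel[OF pD(3,4), of \<one> "b \<otimes> c"] c c' by simp
    then show False using M.I_r_closed[OF bM c'(1)] one_notin_M by simp
  qed
  fix a b assume ab: "a \<in> R" "b \<in> R" "p = a \<otimes> b"
  have c: "a \<in> carrier B" "b \<in> carrier B" using ab R by auto
  consider "p divides a" | "regular a p" using pD(5)[OF ab(1)] by blast
  then show "a \<notin> M \<or> b \<notin> M"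
  proof cases
    case 1 then show ?thesis using unit ab by blast
  next
    case 2
    have "p divides (a \<otimes> b)" using ab(3) pD(4) by simp
    then have "p divides b" using regularD[OF 2 c(2)] by simp
    moreover have "p = b \<otimes> a" using ab(3) c m_comm by simp
    ultimately show ?thesis using unit[OF ab(2,1)] by blast
  qed
qed

section \<open>Factorization into strong primes and cancellation\<close>

lemma atom_divisor:
  assumes R: "R \<subseteq> carrier B" and r: "r \<in> R" "r \<in> M" "r \<noteq> \<zero>"
    and mult: "\<And>a b. a \<in> R \<Longrightarrow> b \<in> R \<Longrightarrow> a \<otimes> b \<in> R"
  shows "\<exists>p c. atom R p \<and> c \<in> R \<and> r = p \<otimes> c \<or> atom R r"
proof -
  have rc: "r \<in> carrier B" using r R by blast
  have "r \<in> R \<longrightarrow> r \<in> M \<longrightarrow> atom R r \<or> (\<exists>p c. atom R p \<and> c \<in> R \<and> r = p \<otimes> c)"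
    using rc r(3)
  proof (induction rule: divisor_induct)
    case (step r)
    show ?case
    proof (intro impI)
      assume r: "r \<in> R" "r \<in> M"
      show "atom R r \<or> (\<exists>p c. atom R p \<and> c \<in> R \<and> r = p \<otimes> c)"
      proof (cases "atom R r")
        case False
        then obtain a b where ab: "a \<in> R" "b \<in> R" "r = a \<otimes> b" "a \<in> M" "b \<in> M"
          using r step(2) unfolding atom_def by blast
        have c: "a \<in> carrier B" "b \<in> carrier B" using ab R by auto
        have "r = b \<otimes> a" using ab c m_comm by simp
        then have "atom R a \<or> (\<exists>p c. atom R p \<and> c \<in> R \<and> a = p \<otimes> c)"
          using step(3)[OF c(1) ab(5)] ab(1,4) by simp
        then show ?thesis
        proof (elim disjE exE conjE)
          assume "atom R a" then show ?thesis using ab by blast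
        next
          fix p e assume p: "atom R p" "e \<in> R" "a = p \<otimes> e"
          have "p \<in> carrier B" "e \<in> carrier B" using p R unfolding atom_def by auto
          then have "r = p \<otimes> (e \<otimes> b)" using ab(3) p(3) c by (simp add: m_assoc)
          then show ?thesis using p mult[OF p(2) ab(2)] by blast
        qed
      qed simp
    qed
  qed
  then show ?thesis using r by blast
qed

lemma goodD:
  assumes "good R"
  shows "frac_closed R" "subring R B" "R \<subseteq> carrier B" "atom R p \<Longrightarrow> strong_prime R p"
  using assms frac_closedD unfolding good_def by auto

text \<open>Factoriality in the form in which it is used: a nonunit has an atom as a factor,
  goodness makes the atom a strong prime, and the cofactor generates a larger ideal of
  \<open>B\<close>.\<close>

lemma good_induct [consumes 3, case_names unit mult]:
  assumes R: "good R" and r: "r \<in> R" "r \<noteq> \<zero>"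
    and unit: "\<And>u. u \<in> R \<Longrightarrow> u \<notin> M \<Longrightarrow> P u"
    and mult: "\<And>p r. strong_prime R p \<Longrightarrow> r \<in> R \<Longrightarrow> r \<noteq> \<zero> \<Longrightarrow> P r \<Longrightarrow> P (p \<otimes> r)"
  shows "P r"
proof -
  note RE = subringE[OF goodD(2)[OF R]]
  have rc: "r \<in> carrier B" using r RE by blast
  have "r \<in> R \<longrightarrow> P r"
    using rc r(2)
  proof (induction rule: divisor_induct)
    case (step r)
    show ?case
    proof
      assume r: "r \<in> R"
      show "P r"
      proof (cases "r \<in> M")
        case True
        obtain p c where pc: "atom R p" "c \<in> R" "r = p \<otimes> c"
        proof -
          from atom_divisor[OF RE(1) r True step(2) RE(6)]
          consider p c where "atom R p" "c \<in> R" "r = p \<otimes> c" | "atom R r" by blast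
          then show ?thesis
          proof cases
            case 1 then show ?thesis using that by blast
          next
            case 2
            have "r = r \<otimes> \<one>" using step(1) by simp
            then show ?thesis using that[of r \<one>] 2 RE(3) by blast
          qed
        qed
        have p: "strong_prime R p" using goodD(4)[OF R pc(1)] .
        have cc: "c \<in> carrier B" using pc RE by blast
        have c0: "c \<noteq> \<zero>" using step(2) pc(3) strong_primeD(4)[OF p] by auto
        have "P c" using step(3)[OF cc strong_primeD(2)[OF p] pc(3)] pc(2) by blast
        then show ?thesis using mult[OF p pc(2) c0] pc(3) by simp
      qed (use unit r in blast)
    qed
  qed
  then show ?thesis using r by blast
qed

text \<open>The strong prime factors \<open>q\<close> of \<open>r\<close> are removed one by one:
  \<open>q (r b) = p e\<close> with \<open>p\<close> regular modulo \<open>q\<close> makes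
  \<open>q\<close> a factor of \<open>e\<close>, and \<open>q\<close> cancels. In other words
  \<open>r\<close> is regular modulo \<open>p\<close>.\<close>

lemma good_cancel_left:
  assumes R: "good R" and r: "r \<in> R" "r \<noteq> \<zero>" and p: "p \<in> carrier B"
    and reg: "\<And>q. strong_prime R q \<Longrightarrow> regular p q"
    and b: "b \<in> carrier B" "p divides (r \<otimes> b)"
  shows "p divides b"
proof -
  have "p divides (r \<otimes> b) \<longrightarrow> p divides b"
    using R r
  proof (induction rule: good_induct)
    case (unit u)
    then have "u \<in> Units B" using Units_iff goodD(3)[OF R] by blast
    then show ?case using regularD[OF regular_unit[OF _ p] b(1)] by blast
  next
    case (mult q r)
    note q = strong_primeD[OF mult(1)]
    have rc: "r \<in> carrier B" using mult goodD(3)[OF R] by blast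
    show ?case
    proof
      assume "p divides ((q \<otimes> r) \<otimes> b)"
      then obtain e where e: "e \<in> carrier B" "(q \<otimes> r) \<otimes> b = p \<otimes> e" unfolding factor_def by blast
      have "q \<otimes> (r \<otimes> b) = p \<otimes> e" using e q(4) rc b(1) by (simp add: m_assoc)
      then have "q divides (p \<otimes> e)" using rc b(1) unfolding factor_def by (metis m_closed)
      then have "q divides e" using regularD[OF reg[OF mult(1)] e(1)] by blast
      then obtain f where f: "f \<in> carrier B" "e = q \<otimes> f" unfolding factor_def by blast
      have "q \<otimes> (r \<otimes> b) = q \<otimes> (p \<otimes> f)" using \<open>q \<otimes> (r \<otimes> b) = p \<otimes> e\<close> f q(4) p by (simp add: m_lcomm)
      then have "r \<otimes> b = p \<otimes> f" using m_lcancel[OF q(3,4)] rc b(1) p f(1) by simp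
      then have "p divides (r \<otimes> b)" using f unfolding factor_def by blast
      then show "p divides b" using mult(4) by blast
    qed
  qed
  then show ?thesis using b by blast
qed

text \<open>The counterpart of \<open>good_cancel_left\<close> with the element of the subring as
  modulus: regularity of \<open>h\<close> modulo each prime factor of \<open>r\<close> accumulates
  to regularity modulo \<open>r\<close>.\<close>

lemma good_cancel_right:
  assumes R: "good R" and r: "r \<in> R" "r \<noteq> \<zero>" and h: "h \<in> carrier B"
    and reg: "\<And>q. strong_prime R q \<Longrightarrow> regular h q"
    and x: "x \<in> carrier B" "r divides (h \<otimes> x)"
  shows "r divides x"
proof -
  have "\<forall>x\<in>carrier B. r divides (h \<otimes> x) \<longrightarrow> r divides x"
    using R r
  proof (induction rule: good_induct)
    case (unit u)
    then have u: "u \<in> Units B" "u \<in> carrier B" using Units_iff goodD(3)[OF R] by blast+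
    show ?case
    proof (intro ballI impI)
      fix x assume x: "x \<in> carrier B"
      have "x = u \<otimes> (inv u \<otimes> x)" using u x by (simp add: m_assoc[symmetric])
      then show "u divides x" unfolding factor_def using u x by blast
    qed
  next
    case (mult q r)
    note q = strong_primeD[OF mult(1)]
    have rc: "r \<in> carrier B" using mult goodD(3)[OF R] by blast
    show ?case
    proof (intro ballI impI)
      fix x assume x: "x \<in> carrier B" "(q \<otimes> r) divides (h \<otimes> x)"
      then obtain e where e: "e \<in> carrier B" "h \<otimes> x = (q \<otimes> r) \<otimes> e" unfolding factor_def by blast
      have "h \<otimes> x = q \<otimes> (r \<otimes> e)" using e q(4) rc by (simp add: m_assoc)
      then have "q divides (h \<otimes> x)" using rc e unfolding factor_def by blast
      then have "q divides x" using regularD[OF reg[OF mult(1)] x(1)] by blast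
      then obtain f where f: "f \<in> carrier B" "x = q \<otimes> f" unfolding factor_def by blast
      have "q \<otimes> (h \<otimes> f) = q \<otimes> (r \<otimes> e)"
        using \<open>h \<otimes> x = q \<otimes> (r \<otimes> e)\<close> f q(4) h by (simp add: m_lcomm)
      then have "h \<otimes> f = r \<otimes> e" using m_lcancel[OF q(3,4)] rc e(1) h f(1) by simp
      then have "r divides (h \<otimes> f)" using e unfolding factor_def by blast
      then have "r divides f" using mult(4) f by blast
      then show "(q \<otimes> r) divides x" using divides_cancel[OF q(3,4) rc f(1)] f(2) by simp
    qed
  qed
  then show ?thesis using x by blast
qed

text \<open>Induction on the denominator \<open>g\<close> of \<open>s\<close>. If \<open>p\<close>
  divides \<open>g\<close>, it cancels from \<open>g\<close> and \<open>g s\<close>, and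
  \<open>div\<close> keeps the quotients in \<open>S\<close>; otherwise \<open>g\<close> is regular
  modulo \<open>p\<close> and the alternative for \<open>g s\<close> passes to
  \<open>s\<close>.\<close>

lemma strong_prime_fractions:
  assumes S: "subring S B" and p: "strong_prime S p"
    and div: "\<And>b. b \<in> carrier B \<Longrightarrow> p \<otimes> b \<in> S \<Longrightarrow> b \<in> S"
  shows "strong_prime (fractions S S) p"
proof -
  note pD = strong_primeD[OF p]
  have SS: "S \<subseteq> fractions S S" by (rule subset_fractions[OF S S])
  have main: "g \<in> S \<longrightarrow> g \<otimes> s \<in> S \<longrightarrow> p divides s \<or> regular s p"
    if g: "g \<in> carrier B" "g \<noteq> \<zero>" and s: "s \<in> carrier B" for g s
    using g
  proof (induction rule: divisor_induct)
    case (step g)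
    show ?case
    proof (intro impI)
      assume gS: "g \<in> S" "g \<otimes> s \<in> S"
      show "p divides s \<or> regular s p"
      proof (cases "p divides g")
        case True
        then obtain h where h: "h \<in> carrier B" "g = p \<otimes> h" unfolding factor_def by blast
        have "h \<in> S" using div h gS(1) by simp
        moreover have "h \<otimes> s \<in> S"
          using div[of "h \<otimes> s"] h gS(2) s pD(4) by (simp add: m_assoc)
        ultimately show ?thesis using step(3)[OF h(1) pD(2) h(2)] by blast
      next
        case False
        then have reg: "regular g p" using pD(5)[OF gS(1)] by blast
        show ?thesis
        proof (cases "p divides (g \<otimes> s)")
          case True then show ?thesis using regularD[OF reg s] by blast
        next
          case False
          then have "regular (g \<otimes> s) p" using pD(5)[OF gS(2)] by blast
          then show ?thesis using regular_multD step(1) s pD(4) by blast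
        qed
      qed
    qed
  qed
  show ?thesis
    unfolding strong_prime_def
  proof (intro conjI ballI)
    show "p \<in> fractions S S" using SS pD(1) by blast
    fix s assume "s \<in> fractions S S"
    then obtain d where d: "s \<in> carrier B" "d \<in> S" "d \<noteq> \<zero>" "d \<otimes> s \<in> S" by (rule fractionsE)
    then show "p divides s \<or> regular s p" using main[of d s] subringE(1)[OF S] by blast
  qed (use pD in auto)
qed


text \<open>In the spirit of Nagata's theorem: after inverting the nonzero elements of
  \<open>R\<close>, hypothesis \<open>bezout\<close> supplies greatest common divisors as linear
  combinations. An atom of the new ring is either associated to an old prime or free of old primes;
  in the second case the common divisor of \<open>p\<close> and \<open>s\<close>, stripped of its
  old primes, is associated to \<open>p\<close> or is a unit.\<close>

theorem good_extension:
  assumes R: "good R" and T: "subring T B" and RT: "R \<subseteq> T"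
    and reg: "\<And>q a. strong_prime R q \<Longrightarrow> a \<in> fractions R T \<Longrightarrow> q divides a \<or> regular a q"
    and bezout: "\<And>f g. f \<in> T \<Longrightarrow> g \<in> T \<Longrightarrow> f \<noteq> \<zero> \<Longrightarrow>
      \<exists>h\<in>T. \<exists>u\<in>T. \<exists>v\<in>T. \<exists>r\<in>R. h \<noteq> \<zero> \<and> r \<noteq> \<zero> \<and> h = u \<otimes> f \<oplus> v \<otimes> g \<and>
        h divides (r \<otimes> f) \<and> h divides (r \<otimes> g)"
  shows "good (fractions T T)" "extends R (fractions T T)"
proof -
  define S where "S = fractions T T"
  define S0 where "S0 = fractions R T"
  have Rs: "subring R B" and Rf: "frac_closed R" by (rule goodD[OF R])+
  note RE = subringE[OF Rs] and TE = subringE[OF T]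
  have S0s: "subring S0 B" unfolding S0_def by (rule fractions_subring[OF Rs T RT])
  have TS0: "T \<subseteq> S0" unfolding S0_def by (rule subset_fractions[OF Rs T])
  have S_S0: "fractions S0 S0 = S"
    unfolding S0_def S_def by (rule fractions_fractions[OF Rs T RT])
  have Sf: "frac_closed S" unfolding S_def by (rule frac_closed_fractions[OF T])
  note Ss = frac_closedD(1)[OF Sf]
  note SE = subringE[OF Ss]
  have TS: "T \<subseteq> S" unfolding S_def by (rule subset_fractions[OF T T])
  have RS: "R \<subseteq> S" using RT TS by blast
  have ext: "strong_prime S q" if q: "strong_prime R q" for q
  proof -
    note qD = strong_primeD[OF q]
    have "strong_prime S0 q"
      unfolding strong_prime_def using qD RT TS0 reg[OF q] S0_def by blast
    \<comment> \<open>The reason for working over \<open>fractions R T\<close> first: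
      \<open>q\<close> lies in \<open>R\<close>, so \<open>d q\<close> is again an admissible
      denominator. A quotient by \<open>q\<close> of an element of \<open>T\<close> need not lie in
      \<open>T\<close>.\<close>
    moreover have "b \<in> S0" if b: "b \<in> carrier B" "q \<otimes> b \<in> S0" for b
    proof -
      obtain d where d: "d \<in> R" "d \<noteq> \<zero>" "d \<otimes> (q \<otimes> b) \<in> T"
        using b(2) unfolding S0_def by (rule fractionsE)
      have dc: "d \<in> carrier B" using d(1) RE(1) by blast
      have "(d \<otimes> q) \<otimes> b \<in> T" using d(3) dc qD(4) b(1) by (simp add: m_assoc)
      moreover have "d \<otimes> q \<in> R" "d \<otimes> q \<noteq> \<zero>" using d qD RE(6) dc integral_iff by auto
      ultimately show ?thesis unfolding S0_def using b(1) by (intro fractionsI[of b "d \<otimes> q"])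
    qed
    ultimately have "strong_prime (fractions S0 S0) q" by (rule strong_prime_fractions[OF S0s])
    then show ?thesis using S_S0 by simp
  qed
  have strip: "\<exists>r\<in>R. \<exists>h'\<in>S. r \<noteq> \<zero> \<and> h = r \<otimes> h' \<and> (\<forall>q. strong_prime R q \<longrightarrow> \<not> q divides h')"
    if "h \<in> S" "h \<noteq> \<zero>" for h
  proof -
    have "h \<in> carrier B" using that SE(1) by blast
    then have "h \<in> S \<longrightarrow> ?thesis"
      using that(2)
    proof (induction rule: divisor_induct)
      case (step h)
      show ?case
      proof
        assume h: "h \<in> S"
        show "\<exists>r\<in>R. \<exists>h'\<in>S. r \<noteq> \<zero> \<and> h = r \<otimes> h' \<and> (\<forall>q. strong_prime R q \<longrightarrow> \<not> q divides h')"
        proof (cases "\<exists>q. strong_prime R q \<and> q divides h")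
          case False
          have "h = \<one> \<otimes> h" using step(1) by simp
          then show ?thesis using False h RE(3) one_not_zero by blast
        next
          case True
          then obtain q where q: "strong_prime R q" "q divides h" by blast
          note qD = strong_primeD[OF q(1)]
          obtain k where k: "k \<in> S" "h = q \<otimes> k"
            using frac_closed_divides[OF Sf _ qD(3) h q(2)] qD(1) RS by blast
          have kc: "k \<in> carrier B" using k SE(1) by blast
          obtain r h' where r: "r \<in> R" "h' \<in> S" "r \<noteq> \<zero>" "k = r \<otimes> h'" "\<forall>q. strong_prime R q \<longrightarrow> \<not> q divides h'"
            using step(3)[OF kc qD(2) k(2)] k(1) by blast
          have c: "r \<in> carrier B" "h' \<in> carrier B" using r(1,2) RE(1) SE(1) by auto
          have "h = (q \<otimes> r) \<otimes> h'" using k(2) r(4) c qD(4) by (simp add: m_assoc)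
          moreover have "q \<otimes> r \<in> R" "q \<otimes> r \<noteq> \<zero>" using qD r RE(6) c integral_iff by auto
          ultimately show ?thesis using r(2,5) by blast
        qed
      qed
    qed
    then show ?thesis using that by blast
  qed
  have prime: "p divides s \<or> regular s p" if p: "atom S p" and s: "s \<in> S" for p s
  proof (cases "\<exists>q. strong_prime R q \<and> q divides p")
    case True
    then obtain q where q: "strong_prime R q" "q divides p" by blast
    note qD = strong_primeD[OF ext[OF q(1)]]
    have pS: "p \<in> S" "p \<in> M" "p \<noteq> \<zero>" using p unfolding atom_def by auto
    obtain u where u: "u \<in> S" "p = q \<otimes> u" using frac_closed_divides[OF Sf qD(1,3) pS(1) q(2)] .
    have uc: "u \<in> carrier B" using u SE(1) by blast
    have "u \<notin> M" using p u qD(1,2) unfolding atom_def by blast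
    then have uU: "u \<in> Units B" using Units_iff uc by blast
    have sc: "s \<in> carrier B" using s SE(1) by blast
    have pc: "p \<in> carrier B" using pS SE(1) by blast
    have pq: "p divides y \<longleftrightarrow> q divides y" if y: "y \<in> carrier B" for y
    proof
      assume "p divides y"
      then show "q divides y" using q(2) divides_trans qD(4) by blast
    next
      assume "q divides y"
      then obtain z where z: "z \<in> carrier B" "y = q \<otimes> z" unfolding factor_def by blast
      have "y = (q \<otimes> (u \<otimes> inv u)) \<otimes> z" using z uU qD(4) by simp
      also have "\<dots> = p \<otimes> (inv u \<otimes> z)"
        unfolding u(2) using uc z(1) qD(4) Units_inv_closed[OF uU] by algebra
      finally show "p divides y" unfolding factor_def using uU z(1) by blast
    qed
    have "regular s q \<Longrightarrow> regular s p" unfolding regular_def using pq sc by simp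
    then show ?thesis using qD(5)[OF s] pq[OF sc] by blast
  next
    case False
    have pS: "p \<in> S" "p \<in> M" "p \<noteq> \<zero>" using p unfolding atom_def by auto
    have pc: "p \<in> carrier B" and sc: "s \<in> carrier B" using pS(1) s SE(1) by auto
    have p_reg: "regular p q" if q: "strong_prime R q" for q
      using strong_primeD(5)[OF ext[OF q] pS(1)] False q by blast
    obtain d where d: "d \<in> T" "d \<noteq> \<zero>" "d \<otimes> p \<in> T" using pS(1) unfolding S_def by (rule fractionsE)
    obtain e where e: "e \<in> T" "e \<noteq> \<zero>" "e \<otimes> s \<in> T" using s unfolding S_def by (rule fractionsE)
    have dec: "d \<in> carrier B" "e \<in> carrier B" using d(1) e(1) TE(1) by auto
    \<comment> \<open>A common denominator brings \<open>p\<close> and \<open>s\<close> into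
      \<open>T\<close>, where \<open>bezout\<close> applies; it is cancelled again through
      \<open>h = D h0\<close>.\<close>
    define D where "D = d \<otimes> e"
    have D: "D \<in> carrier B" "D \<noteq> \<zero>" unfolding D_def using dec d e integral_iff by auto
    have "D \<otimes> p = e \<otimes> (d \<otimes> p)" "D \<otimes> s = d \<otimes> (e \<otimes> s)"
      unfolding D_def using dec pc sc by algebra+
    then have DpT: "D \<otimes> p \<in> T" and DsT: "D \<otimes> s \<in> T"
      using TE(6)[OF e(1) d(3)] TE(6)[OF d(1) e(3)] by (simp_all only:)
    have Dp0: "D \<otimes> p \<noteq> \<zero>" using D pc pS(3) integral_iff by blast
    obtain h u v r where h: "h \<in> T" "u \<in> T" "v \<in> T" "r \<in> R" "h \<noteq> \<zero>" "r \<noteq> \<zero>"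
        "h = u \<otimes> (D \<otimes> p) \<oplus> v \<otimes> (D \<otimes> s)" "h divides (r \<otimes> (D \<otimes> p))" "h divides (r \<otimes> (D \<otimes> s))"
      using bezout[OF DpT DsT Dp0] by blast
    have c: "u \<in> carrier B" "v \<in> carrier B" "r \<in> carrier B" using h(2-4) TE(1) RE(1) by auto
    define h0 where "h0 = u \<otimes> p \<oplus> v \<otimes> s"
    have h0S: "h0 \<in> S" unfolding h0_def
      by (rule SE(7)[OF SE(6)[OF subsetD[OF TS h(2)] pS(1)] SE(6)[OF subsetD[OF TS h(3)] s]])
    have h0c: "h0 \<in> carrier B" using h0S SE(1) by blast
    have hD: "h = D \<otimes> h0" unfolding h(7) h0_def using c pc sc D(1) by algebra
    then have h00: "h0 \<noteq> \<zero>" using h(5) D(1) by auto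
    have h0p: "h0 divides (r \<otimes> y)" if "h divides (r \<otimes> (D \<otimes> y))" "y \<in> carrier B" for y
    proof -
      have "(D \<otimes> h0) divides (D \<otimes> (r \<otimes> y))"
        using that c(3) D(1) hD by (simp add: m_lcomm)
      then show ?thesis using divides_cancel[OF D(2,1) h0c] c(3) that(2) by simp
    qed
    obtain r' h' where r': "r' \<in> R" "h' \<in> S" "r' \<noteq> \<zero>" "h0 = r' \<otimes> h'"
        "\<forall>q. strong_prime R q \<longrightarrow> \<not> q divides h'"
      using strip[OF h0S h00] by blast
    have c': "r' \<in> carrier B" "h' \<in> carrier B" using r'(1,2) RE(1) SE(1) by auto
    have h'0: "h' \<noteq> \<zero>" using r'(4) h00 c' by auto
    have h'_reg: "regular h' q" if q: "strong_prime R q" for q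
      using strong_primeD(5)[OF ext[OF q] r'(2)] r'(5) q by blast
    \<comment> \<open>The factor \<open>r\<close> lost in pseudo-division is recovered:
      \<open>h'\<close> is regular modulo every old prime, so \<open>r\<close> can be
      cancelled.\<close>
    have h'_div: "h' divides y" if y: "h0 divides (r \<otimes> y)" "y \<in> carrier B" for y
    proof -
      have "h' divides h0" unfolding factor_def using r'(4) c' m_comm by blast
      then have "h' divides (r \<otimes> y)" using y(1) divides_trans c'(2) by blast
      then obtain z where z: "z \<in> carrier B" "r \<otimes> y = h' \<otimes> z" unfolding factor_def by blast
      have "r divides (h' \<otimes> z)" unfolding factor_def using y(2) z(2) by metis
      then have "r divides z" using good_cancel_right[OF R h(4,6) c'(2) h'_reg z(1)] by blast
      then obtain w where w: "w \<in> carrier B" "z = r \<otimes> w" unfolding factor_def by blast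
      have "r \<otimes> y = r \<otimes> (h' \<otimes> w)" using z w c c' by (simp add: m_lcomm)
      then have "y = h' \<otimes> w" using m_lcancel[OF h(6) c(3) y(2)] w c' by simp
      then show ?thesis unfolding factor_def using w by blast
    qed
    have "h' divides p" using h'_div[OF h0p[OF h(8) pc] pc] .
    then obtain k where k: "k \<in> S" "p = h' \<otimes> k"
      using frac_closed_divides[OF Sf r'(2) h'0 pS(1)] by blast
    have kc: "k \<in> carrier B" using k SE(1) by blast
    have "h' divides s" using h'_div[OF h0p[OF h(9) sc] sc] .
    consider "h' \<notin> M" | "k \<notin> M" using p k r'(2) unfolding atom_def by blast
    then show ?thesis
    proof cases
      case 2
      then have kU: "k \<in> Units B" using Units_iff kc by blast
      have "h' = p \<otimes> inv k" using k(2) kU kc c'(2) by (simp add: m_assoc)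
      then have "p divides h'" unfolding factor_def using kU by blast
      then show ?thesis using \<open>h' divides s\<close> divides_trans pc by blast
    next
      case 1
      then have h'U: "h' \<in> Units B" using Units_iff c' by blast
      have "regular s p"
        unfolding regular_def
      proof (intro ballI impI)
        fix y assume y: "y \<in> carrier B" "p divides (s \<otimes> y)"
        have "p divides (p \<otimes> (u \<otimes> y))" unfolding factor_def using y(1) c(1) by blast
        \<comment> \<open>The sum is \<open>h0 y\<close> with \<open>h0 = u p + v s\<close>, and
          \<open>h0\<close> is \<open>r'\<close> times the unit \<open>h'\<close>. Since
          \<open>p\<close> is regular modulo every old prime, \<open>r'\<close> cancels.\<close>
        then have "p divides (p \<otimes> (u \<otimes> y) \<oplus> v \<otimes> (s \<otimes> y))"
          by (rule divides_sum[OF _ divides_mult_left[OF y(2) pc c(2)] pc])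
        moreover have "p \<otimes> (u \<otimes> y) \<oplus> v \<otimes> (s \<otimes> y) = h0 \<otimes> y"
          unfolding h0_def using y(1) c pc sc by algebra
        moreover have "h0 \<otimes> y = r' \<otimes> (h' \<otimes> y)" unfolding r'(4) using c' y(1) by (simp add: m_assoc)
        ultimately have "p divides (r' \<otimes> (h' \<otimes> y))" by simp
        then have "p divides (h' \<otimes> y)"
          by (rule good_cancel_left[OF R r'(1,3) pc p_reg, rotated 2]) (use c' y in auto)
        then show "p divides y" using regularD[OF regular_unit[OF h'U pc] y(1)] by blast
      qed
      then show ?thesis by blast
    qed
  qed
  have "good S"
    unfolding good_def
  proof (intro conjI allI impI Sf)
    fix p assume p: "atom S p"
    then show "strong_prime S p" using prime[OF p] unfolding strong_prime_def atom_def by blast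
  qed
  then show "good (fractions T T)" unfolding S_def .
  show "extends R (fractions T T)" unfolding extends_def using RS ext S_def by blast
qed

section \<open>Polynomial values and pseudo-division\<close>

lemma simple_extension_eval:
  assumes "subring R B" "x \<in> carrier B" "y \<in> simple_extension R x"
  obtains p where "set p \<subseteq> R" "y = eval p x"
proof -
  obtain p where "p \<in> carrier (R[X])" "y = eval p x"
    using assms simple_extension_as_eval_img[OF subringE(1)[OF assms(1)]] by blast
  then show ?thesis using that polynomial_incl univ_poly_carrier by blast
qed

text \<open>Values of polynomials of degree less than \<open>n\<close>, highest coefficient first.
  Leading zeros are allowed and one element may have several representing lists, so \<open>n\<close>
  is only a bound and no normal form of polynomials is involved.\<close>

definition poly_vals :: "'b set \<Rightarrow> 'b \<Rightarrow> nat \<Rightarrow> 'b set" where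
  "poly_vals R x n = {eval p x | p. set p \<subseteq> R \<and> length p = n}"

lemma poly_vals_Suc:
  "y \<in> poly_vals R x (Suc n) \<longleftrightarrow> (\<exists>a\<in>R. \<exists>t\<in>poly_vals R x n. y = a \<otimes> x [^] n \<oplus> t)"
proof
  assume "y \<in> poly_vals R x (Suc n)"
  then obtain p where p: "set p \<subseteq> R" "length p = Suc n" "y = eval p x" unfolding poly_vals_def by blast
  then obtain a q where "p = a # q" by (cases p) auto
  then show "\<exists>a\<in>R. \<exists>t\<in>poly_vals R x n. y = a \<otimes> x [^] n \<oplus> t" using p unfolding poly_vals_def by auto
next
  assume "\<exists>a\<in>R. \<exists>t\<in>poly_vals R x n. y = a \<otimes> x [^] n \<oplus> t"
  then obtain a q where "a \<in> R" "set q \<subseteq> R" "length q = n" "y = a \<otimes> x [^] n \<oplus> eval q x"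
    unfolding poly_vals_def by blast
  then show "y \<in> poly_vals R x (Suc n)" unfolding poly_vals_def
    by (intro CollectI exI[of _ "a # q"]) auto
qed

lemma poly_vals_0: "poly_vals R x 0 = {\<zero>}"
  unfolding poly_vals_def by auto

lemma poly_vals_closed:
  assumes R: "subring R B" and x: "x \<in> carrier B"
  shows "poly_vals R x n \<subseteq> carrier B"
    and "a \<in> poly_vals R x n \<Longrightarrow> b \<in> poly_vals R x n \<Longrightarrow> a \<ominus> b \<in> poly_vals R x n"
    and "r \<in> R \<Longrightarrow> a \<in> poly_vals R x n \<Longrightarrow> r \<otimes> a \<in> poly_vals R x n"
    and "a \<in> poly_vals R x n \<Longrightarrow> a \<otimes> x [^] k \<in> poly_vals R x (n + k)"
proof -
  note RE = subringE[OF R]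
  show car: "poly_vals R x n \<subseteq> carrier B" for n
    unfolding poly_vals_def using eval_in_carrier RE(1) x by blast
  show "a \<in> poly_vals R x n \<Longrightarrow> b \<in> poly_vals R x n \<Longrightarrow> a \<ominus> b \<in> poly_vals R x n"
  proof (induction n arbitrary: a b)
    case 0 then show ?case by (simp add: poly_vals_0)
  next
    case (Suc n)
    obtain r s where r: "r \<in> R" "s \<in> poly_vals R x n" "a = r \<otimes> x [^] n \<oplus> s"
      using Suc(2) poly_vals_Suc by blast
    obtain r' s' where r': "r' \<in> R" "s' \<in> poly_vals R x n" "b = r' \<otimes> x [^] n \<oplus> s'"
      using Suc(3) poly_vals_Suc by blast
    have c: "r \<in> carrier B" "r' \<in> carrier B" "s \<in> carrier B" "s' \<in> carrier B" "x [^] n \<in> carrier B"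
      using r r' RE(1) car x by auto
    have "a \<ominus> b = (r \<ominus> r') \<otimes> x [^] n \<oplus> (s \<ominus> s')"
      unfolding r(3) r'(3) using c by algebra
    moreover have "r \<ominus> r' \<in> R" using r(1) r'(1) RE(5,7) by (simp add: a_minus_def)
    ultimately show ?case using poly_vals_Suc Suc(1)[OF r(2) r'(2)] by blast
  qed
  show "r \<in> R \<Longrightarrow> a \<in> poly_vals R x n \<Longrightarrow> r \<otimes> a \<in> poly_vals R x n"
  proof (induction n arbitrary: a)
    case 0 then show ?case using RE(1) by (auto simp add: poly_vals_0)
  next
    case (Suc n)
    obtain a' s where s: "a' \<in> R" "s \<in> poly_vals R x n" "a = a' \<otimes> x [^] n \<oplus> s"
      using Suc(3) poly_vals_Suc by blast
    have c: "a' \<in> carrier B" "s \<in> carrier B" "r \<in> carrier B" "x [^] n \<in> carrier B"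
      using s Suc(2) RE(1) car x by auto
    have "r \<otimes> a = (r \<otimes> a') \<otimes> x [^] n \<oplus> r \<otimes> s" unfolding s(3) using c by algebra
    then show ?case using poly_vals_Suc Suc(1)[OF Suc(2) s(2)] RE(6)[OF Suc(2) s(1)] by blast
  qed
  show "a \<in> poly_vals R x n \<Longrightarrow> a \<otimes> x [^] k \<in> poly_vals R x (n + k)"
  proof -
    assume "a \<in> poly_vals R x n"
    then obtain p where p: "set p \<subseteq> R" "length p = n" "a = eval p x" unfolding poly_vals_def by blast
    have pc: "set p \<subseteq> carrier B" using p RE(1) by blast
    have "set (replicate k \<zero>) \<subseteq> carrier B" by auto
    from eval_append[OF pc this x]
    have "eval (p @ replicate k \<zero>) x = eval p x \<otimes> x [^] k \<oplus> eval (replicate k \<zero>) x"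
      by simp
    moreover have "eval (replicate k \<zero>) x = \<zero>"
      using eval_replicate[of "[]" x k] x by simp
    moreover have "eval p x \<otimes> x [^] k \<in> carrier B" using eval_in_carrier pc x by simp
    ultimately have "a \<otimes> x [^] k = eval (p @ replicate k \<zero>) x" using p(3) by simp
    moreover have "set (p @ replicate k \<zero>) \<subseteq> R" using p(1) RE(2) by (auto dest: in_set_replicate[THEN iffD1])
    ultimately show ?thesis unfolding poly_vals_def using p(2)
      by (intro CollectI exI[of _ "p @ replicate k \<zero>"]) auto
  qed
qed

text \<open>
  Pseudo-division: an element of least length in the ideal generated by \<open>f\<close> and \<open>g\<close> divides
  all its elements up to a factor from \<open>R\<close>.  No transcendence of \<open>x\<close> is needed, since only the
  lengths of representing polynomials are compared.
\<close>
lemma simple_extension_bezout: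
  assumes R: "subring R B" and x: "x \<in> carrier B"
    and f: "f \<in> simple_extension R x" "f \<noteq> \<zero>" and g: "g \<in> simple_extension R x"
  shows "\<exists>h\<in>simple_extension R x. \<exists>u\<in>simple_extension R x. \<exists>v\<in>simple_extension R x. \<exists>r\<in>R.
    h \<noteq> \<zero> \<and> r \<noteq> \<zero> \<and> h = u \<otimes> f \<oplus> v \<otimes> g \<and> h divides (r \<otimes> f) \<and> h divides (r \<otimes> g)"
proof -
  let ?T = "simple_extension R x"
  have T: "subring ?T B" by (rule simple_extension_is_subring[OF R x])
  note RE = subringE[OF R] and TE = subringE[OF T]
  define I where "I = {u \<otimes> f \<oplus> v \<otimes> g | u v. u \<in> ?T \<and> v \<in> ?T}"
  have RT: "R \<subseteq> ?T" using simple_extension_incl[OF RE(1) x] .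
  have xT: "x \<in> ?T" using simple_extension_mem[OF R x] .
  have fc: "f \<in> carrier B" and gc: "g \<in> carrier B" using f(1) g TE(1) by auto
  have ex: "\<exists>n. y \<in> poly_vals R x n" if y: "y \<in> ?T" for y
  proof -
    obtain p where "set p \<subseteq> R" "y = eval p x" by (rule simple_extension_eval[OF R x y])
    then show ?thesis unfolding poly_vals_def by (intro exI[of _ "length p"] CollectI exI[of _ p] conjI refl)
  qed
  have fI: "f \<in> I"
  proof -
    have "f = \<one> \<otimes> f \<oplus> \<zero> \<otimes> g" using fc gc by simp
    then show ?thesis unfolding I_def using TE(2,3) by blast
  qed
  have gI: "g \<in> I"
  proof -
    have "g = \<zero> \<otimes> f \<oplus> \<one> \<otimes> g" using fc gc by simp
    then show ?thesis unfolding I_def using TE(2,3) by blast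
  qed
  have I_diff: "a \<ominus> b \<in> I" if ab: "a \<in> I" "b \<in> I" for a b
  proof -
    obtain u v u' v' where a: "a = u \<otimes> f \<oplus> v \<otimes> g" "b = u' \<otimes> f \<oplus> v' \<otimes> g"
        "u \<in> ?T" "v \<in> ?T" "u' \<in> ?T" "v' \<in> ?T" using ab unfolding I_def by blast
    have "u \<in> carrier B" "v \<in> carrier B" "u' \<in> carrier B" "v' \<in> carrier B" using a TE(1) by auto
    then have "a \<ominus> b = (u \<ominus> u') \<otimes> f \<oplus> (v \<ominus> v') \<otimes> g" unfolding a using fc gc by algebra
    moreover have "u \<ominus> u' \<in> ?T" "v \<ominus> v' \<in> ?T" using a TE(5,7) by (simp_all add: a_minus_def)
    ultimately show ?thesis unfolding I_def by blast
  qed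
  have I_mult: "t \<otimes> a \<in> I" if at: "a \<in> I" "t \<in> ?T" for a t
  proof -
    obtain u v where a: "a = u \<otimes> f \<oplus> v \<otimes> g" "u \<in> ?T" "v \<in> ?T" using at unfolding I_def by blast
    have "u \<in> carrier B" "v \<in> carrier B" "t \<in> carrier B" using a at TE(1) by auto
    then have "t \<otimes> a = (t \<otimes> u) \<otimes> f \<oplus> (t \<otimes> v) \<otimes> g" unfolding a using fc gc by algebra
    then show ?thesis unfolding I_def using TE(6)[OF at(2) a(2)] TE(6)[OF at(2) a(3)] by blast
  qed
  define n where "n = (LEAST n. \<exists>h\<in>I. h \<noteq> \<zero> \<and> h \<in> poly_vals R x n)"
  have "\<exists>n. \<exists>h\<in>I. h \<noteq> \<zero> \<and> h \<in> poly_vals R x n" using fI f ex by blast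
  then have "\<exists>h\<in>I. h \<noteq> \<zero> \<and> h \<in> poly_vals R x n" unfolding n_def by (rule LeastI_ex)
  then obtain h where h: "h \<in> I" "h \<noteq> \<zero>" "h \<in> poly_vals R x n" by blast
  have least: "y = \<zero>" if "y \<in> I" "y \<in> poly_vals R x m" "m < n" for y m
    using not_less_Least[of m "\<lambda>n. \<exists>h\<in>I. h \<noteq> \<zero> \<and> h \<in> poly_vals R x n"] that unfolding n_def by blast
  have "n \<noteq> 0"
  proof
    assume "n = 0"
    then have "h \<in> {\<zero>}" using h(3) poly_vals_0 by simp
    then show False using h(2) by simp
  qed
  then obtain k where k: "n = Suc k" by (cases n) auto
  obtain a s where as: "a \<in> R" "s \<in> poly_vals R x k" "h = a \<otimes> x [^] k \<oplus> s"
    using h(3) poly_vals_Suc unfolding k by blast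
  have c: "a \<in> carrier B" "s \<in> carrier B" "x [^] k \<in> carrier B"
    using as RE(1) poly_vals_closed(1)[OF R x] x by auto
  have a0: "a \<noteq> \<zero>"
  proof
    assume "a = \<zero>"
    then have "h = s" using as(3) c by simp
    then show False using least[OF h(1) _ , of k] as(2) h(2) k by simp
  qed
  have hc: "h \<in> carrier B" using h(3) poly_vals_closed(1)[OF R x] by blast
  have pow: "x [^] (j::nat) \<in> ?T" for j
    by (induction j) (use TE(3,6) xT in auto)
  have div: "\<exists>r\<in>R. r \<noteq> \<zero> \<and> h divides (r \<otimes> y)" if "y \<in> I" "y \<in> poly_vals R x m" for y m
    using that
  proof (induction m arbitrary: y)
    case 0
    then have "y = \<zero>" using poly_vals_0 by simp
    then show ?case using RE(3) one_not_zero divides_zero[OF hc] by (intro bexI[of _ \<one>]) auto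
  next
    case (Suc m)
    show ?case
    proof (cases "Suc m < n")
      case True
      then have "y = \<zero>" using least Suc by blast
      then show ?thesis using RE(3) one_not_zero divides_zero[OF hc] by (intro bexI[of _ \<one>]) auto
    next
      case False
      then have km: "k \<le> m" using k by simp
      obtain b t where bt: "b \<in> R" "t \<in> poly_vals R x m" "y = b \<otimes> x [^] m \<oplus> t"
        using Suc(3) poly_vals_Suc by blast
      have d: "b \<in> carrier B" "t \<in> carrier B" "x [^] m \<in> carrier B" "x [^] (m - k) \<in> carrier B"
        using bt RE(1) poly_vals_closed(1)[OF R x] x by auto
      have yc: "y \<in> carrier B" using bt d by simp
      have xm: "x [^] m = x [^] k \<otimes> x [^] (m - k)" using x km by (simp add: nat_pow_mult)
      \<comment> \<open>Here \<open>a\<close> and \<open>b\<close> are the leading coefficients of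
        \<open>h\<close> and \<open>y\<close>, so the terms in \<open>x [^] m\<close> cancel.
        Multiplying \<open>y\<close> by \<open>a\<close> instead of dividing by it is the origin of
        the factor from \<open>R\<close> in the claim.\<close>
      define y' where "y' = a \<otimes> y \<ominus> (b \<otimes> x [^] (m - k)) \<otimes> h"
      have "y' \<in> I" unfolding y'_def
        by (rule I_diff[OF I_mult[OF Suc(2) subsetD[OF RT as(1)]]
              I_mult[OF h(1) TE(6)[OF subsetD[OF RT bt(1)] pow]]])
      moreover have "y' = a \<otimes> t \<ominus> b \<otimes> (s \<otimes> x [^] (m - k))"
        unfolding y'_def bt(3) as(3) xm using c d by algebra
      moreover have "s \<otimes> x [^] (m - k) \<in> poly_vals R x m"
        using poly_vals_closed(4)[OF R x as(2), of "m - k"] km by simp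
      ultimately have "y' \<in> I" "y' \<in> poly_vals R x m"
        using poly_vals_closed(2,3)[OF R x] as(1) bt(1,2) by auto
      then obtain r where r: "r \<in> R" "r \<noteq> \<zero>" "h divides (r \<otimes> y')" using Suc(1) by blast
      have rc: "r \<in> carrier B" using r RE(1) by blast
      have "h divides (h \<otimes> (r \<otimes> (b \<otimes> x [^] (m - k))))" using rc d by (auto simp: factor_def)
      then have "h divides (r \<otimes> y' \<oplus> h \<otimes> (r \<otimes> (b \<otimes> x [^] (m - k))))"
        using divides_sum[OF r(3) _ hc] by blast
      moreover have "r \<otimes> y' \<oplus> h \<otimes> (r \<otimes> (b \<otimes> x [^] (m - k))) = (r \<otimes> a) \<otimes> y"
        unfolding y'_def using rc c(1) yc d(1,4) hc by algebra
      moreover have "r \<otimes> a \<in> R" "r \<otimes> a \<noteq> \<zero>" using r as(1) a0 RE(6) rc c integral_iff by auto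
      ultimately show ?thesis by (intro bexI[of _ "r \<otimes> a"]) auto
    qed
  qed
  obtain r where r: "r \<in> R" "r \<noteq> \<zero>" "h divides (r \<otimes> f)" using div[OF fI] ex[OF f(1)] by blast
  obtain r' where r': "r' \<in> R" "r' \<noteq> \<zero>" "h divides (r' \<otimes> g)" using div[OF gI] ex[OF g] by blast
  have rc: "r \<in> carrier B" "r' \<in> carrier B" using r r' RE(1) by auto
  have "h divides (r' \<otimes> (r \<otimes> f))" "h divides (r \<otimes> (r' \<otimes> g))"
    using divides_mult_left[OF r(3) hc rc(2)] divides_mult_left[OF r'(3) hc rc(1)] by auto
  then have "h divides ((r \<otimes> r') \<otimes> f)" "h divides ((r \<otimes> r') \<otimes> g)"
    using rc fc gc by (simp_all add: m_assoc m_lcomm)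
  moreover have "r \<otimes> r' \<in> R" "r \<otimes> r' \<noteq> \<zero>" using r r' RE(6) rc integral_iff by auto
  moreover obtain u v where "h = u \<otimes> f \<oplus> v \<otimes> g" "u \<in> ?T" "v \<in> ?T" using h(1) unfolding I_def by blast
  moreover have "h \<in> ?T" using calculation(5-7) TE(6,7) f g by simp
  ultimately show ?thesis using h(2) by blast
qed

corollary good_simple_extension:
  assumes R: "good R" and x: "x \<in> carrier B"
    and reg: "\<And>q a. strong_prime R q \<Longrightarrow> a \<in> fractions R (simple_extension R x) \<Longrightarrow> q divides a \<or> regular a q"
  shows "good (fractions (simple_extension R x) (simple_extension R x))"
    and "extends R (fractions (simple_extension R x) (simple_extension R x))"
proof -
  have Rs: "subring R B" by (rule goodD[OF R])
  note * = good_extension[OF R simple_extension_is_subring[OF Rs x]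
      simple_extension_incl[OF goodD(3)[OF R] x] reg simple_extension_bezout[OF Rs x]]
  show "good (fractions (simple_extension R x) (simple_extension R x))" by (rule *(1)) auto
  show "extends R (fractions (simple_extension R x) (simple_extension R x))" by (rule *(2)) auto
qed


subsection \<open>Adjoining generic elements\<close>

text \<open>For a prime \<open>q\<close> this says that the residue of \<open>x\<close> in
  \<open>B/q\<close> is transcendental over the image of \<open>R\<close>; asking that all
  coefficients lie in \<open>q\<close> avoids passing to the quotient.\<close>

definition transcendental_mod :: "'b set \<Rightarrow> 'b \<Rightarrow> 'b set \<Rightarrow> bool" where
  "transcendental_mod R x q \<longleftrightarrow> (\<forall>p. set p \<subseteq> R \<longrightarrow> eval p x \<in> q \<longrightarrow> set p \<subseteq> q)"

lemma transcendental_mod_notin: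
  assumes "transcendental_mod R x q" "primeideal q B" "subring R B" "x \<in> carrier B"
  shows "x \<notin> q"
proof
  assume "x \<in> q"
  moreover have "eval [\<one>, \<zero>] x = x" using assms(4) by simp
  moreover have "set [\<one>, \<zero>] \<subseteq> R" using subringE(2,3)[OF assms(3)] by simp
  ultimately have "\<one> \<in> q" using assms(1) unfolding transcendental_mod_def by fastforce
  then show False
    using ideal.one_imp_carrier[OF primeideal.axioms(1)[OF assms(2)]] primeideal.I_notcarr[OF assms(2)] by blast
qed

text \<open>Torsion freeness seen on associated primes: each of them meets \<open>R\<close> exactly
  in the multiples of \<open>q\<close>, so transcendence modulo any of them refers to the same image
  of \<open>R\<close>.\<close>

lemma Ass_inter_strong_prime:
  assumes q: "strong_prime R q" and Q: "Q \<in> Ass_quot B q" and r: "r \<in> R" "r \<in> Q"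
  shows "q divides r"
  using strong_primeD(5)[OF q r(1)] Ass_quotD(3)[OF Q strong_primeD(4)[OF q] r(2)] by blast

text \<open>A form of Gauss's lemma. A value that is a zero divisor modulo \<open>q\<close> lies in
  an associated prime \<open>Q\<close>; transcendence modulo \<open>Q\<close> then forces all
  coefficients into \<open>Q\<close>, where they are multiples of \<open>q\<close>.\<close>

lemma regular_eval:
  assumes q: "strong_prime R q" and R: "R \<subseteq> carrier B" and z: "z \<in> carrier B" "\<forall>Q\<in>Ass_quot B q. transcendental_mod R z Q"
    and p: "set p \<subseteq> R"
  shows "regular (eval p z) q \<or> (\<forall>a\<in>set p. q divides a)"
proof (cases "regular (eval p z) q")
  case False
  have "eval p z \<in> carrier B" using eval_in_carrier p R z(1) by blast
  then obtain Q where Q: "Q \<in> Ass_quot B q" "eval p z \<in> Q"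
    using Ass_of_not_regular[OF strong_primeD(4)[OF q]] False by blast
  then have "set p \<subseteq> Q" using z(2) p unfolding transcendental_mod_def by blast
  then show ?thesis using Ass_inter_strong_prime[OF q Q(1)] p by blast
qed simp

lemma eval_map_mult:
  assumes "set p \<subseteq> carrier B" "c \<in> carrier B" "z \<in> carrier B"
  shows "eval (map ((\<otimes>) c) p) z = c \<otimes> eval p z"
  using assms(1)
proof (induction p)
  case (Cons a p)
  have "a \<in> carrier B" "eval p z \<in> carrier B" using Cons(2) eval_in_carrier assms(3) by auto
  then show ?case using Cons assms(2,3) by (simp add: r_distr m_assoc)
qed (use assms in simp)

lemma divided_polynomial:
  assumes R: "frac_closed R" and q: "q \<in> R" "q \<noteq> \<zero>" and p: "set p \<subseteq> R" "\<forall>a\<in>set p. q divides a"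
  shows "\<exists>p'. set p' \<subseteq> R \<and> p = map ((\<otimes>) q) p'"
  using p
proof (induction p)
  case (Cons a p)
  then obtain p' where p': "set p' \<subseteq> R" "p = map ((\<otimes>) q) p'" by auto
  obtain b where "b \<in> R" "a = q \<otimes> b"
    using frac_closed_divides[OF R q, of a] Cons(2,3) by auto
  then show ?case using p' by (intro exI[of _ "b # p'"]) auto
qed simp

text \<open>Write \<open>d a = eval p z\<close>. If the value is regular modulo \<open>q\<close>, so
  is \<open>a\<close>. Otherwise \<open>q\<close> divides all coefficients: either it also divides
  \<open>d\<close> and cancels, which drives the induction on \<open>d\<close>, or \<open>d\<close>
  is regular modulo \<open>q\<close> and \<open>q\<close> divides \<open>a\<close>.\<close>

lemma regular_fractions_of_transcendental:
  assumes R: "good R" and q: "strong_prime R q"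
    and z: "z \<in> carrier B" "\<forall>Q\<in>Ass_quot B q. transcendental_mod R z Q"
    and a: "a \<in> fractions R (simple_extension R z)"
  shows "q divides a \<or> regular a q"
proof -
  note qD = strong_primeD[OF q] and RD = goodD[OF R]
  have main: "\<forall>p. set p \<subseteq> R \<longrightarrow> d \<in> R \<longrightarrow> d \<otimes> a = eval p z \<longrightarrow> q divides a \<or> regular a q"
    if ac: "a \<in> carrier B" and d: "d \<in> carrier B" "d \<noteq> \<zero>" for d a
    using d
  proof (induction rule: divisor_induct)
    case (step d)
    show ?case
    proof (intro allI impI)
      fix p assume p: "set p \<subseteq> R" "d \<in> R" "d \<otimes> a = eval p z"
      have pc: "set p \<subseteq> carrier B" using p RD(3) by blast
      consider "regular (eval p z) q" | "\<forall>a\<in>set p. q divides a"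
        using regular_eval[OF q RD(3) z p(1)] by blast
      then show "q divides a \<or> regular a q"
      proof cases
        case 1
        then have "regular (d \<otimes> a) q" using p(3) by simp
        then show ?thesis using regular_multD step(1) ac qD(4) by blast
      next
        case 2
        obtain p' where p': "set p' \<subseteq> R" "p = map ((\<otimes>) q) p'"
          using divided_polynomial[OF RD(1) qD(1,3) p(1) 2] by blast
        have p'c: "set p' \<subseteq> carrier B" using p' RD(3) by blast
        have ev: "d \<otimes> a = q \<otimes> eval p' z" using p(3) eval_map_mult[OF p'c qD(4) z(1)] p'(2) by simp
        have evc: "eval p' z \<in> carrier B" by (rule eval_in_carrier[OF p'c z(1)])
        show ?thesis
        proof (cases "q divides d")
          case True
          obtain d' where d': "d' \<in> R" "d = q \<otimes> d'"
            using frac_closed_divides[OF RD(1) qD(1,3) p(2) True] .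
          have d'c: "d' \<in> carrier B" using d' RD(3) by blast
          have "q \<otimes> (d' \<otimes> a) = q \<otimes> eval p' z" using ev d' d'c qD(4) ac by (simp add: m_assoc)
          then have "d' \<otimes> a = eval p' z" using m_lcancel[OF qD(3,4)] evc d'c ac by simp
          then show ?thesis using step(3)[OF d'c qD(2) d'(2)] p'(1) d'(1) by blast
        next
          case False
          then have "regular d q" using qD(5)[OF p(2)] by blast
          moreover have "q divides (d \<otimes> a)" unfolding factor_def using ev evc by blast
          ultimately show ?thesis using regularD ac by blast
        qed
      qed
    qed
  qed
  obtain d where d: "a \<in> carrier B" "d \<in> R" "d \<noteq> \<zero>" "d \<otimes> a \<in> simple_extension R z"
    using a by (rule fractionsE)
  obtain p where "set p \<subseteq> R" "d \<otimes> a = eval p z"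
    by (rule simple_extension_eval[OF RD(2) z(1) d(4)])
  then show ?thesis using main[OF d(1) _ d(3)] d(2) RD(3) by blast
qed

definition adjoin :: "'b set \<Rightarrow> 'b \<Rightarrow> 'b set" where
  "adjoin R x = fractions (simple_extension R x) (simple_extension R x)"

lemma adjoin_subset:
  assumes "subring R B" "x \<in> carrier B"
  shows "simple_extension R x \<subseteq> adjoin R x" "R \<subseteq> adjoin R x" "x \<in> adjoin R x"
proof -
  show *: "simple_extension R x \<subseteq> adjoin R x"
    unfolding adjoin_def using subset_fractions simple_extension_is_subring[OF assms] by blast
  show "R \<subseteq> adjoin R x" using * simple_extension_incl[OF subringE(1)[OF assms(1)] assms(2)] by blast
  show "x \<in> adjoin R x" using * simple_extension_mem[OF assms] by blast
qed

lemma good_adjoin: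
  assumes R: "good R" and x: "x \<in> carrier B"
    and tr: "\<And>q Q. strong_prime R q \<Longrightarrow> Q \<in> Ass_quot B q \<Longrightarrow> transcendental_mod R x Q"
  shows "good (adjoin R x)" "extends R (adjoin R x)"
  using good_simple_extension[OF R x] regular_fractions_of_transcendental[OF R _ x] tr
  unfolding adjoin_def by blast+

text \<open>
  Adjoining a solution of \<open>c = y1 x1 + y2 x2\<close>: modulo the associated primes of a prime \<open>q\<close> of \<open>R\<close>
  dividing \<open>y2\<close> the residue of \<open>x1\<close> is forced, but then \<open>y1\<close> is invertible there and \<open>x2\<close>, which
  generates the same field extension, can be taken transcendental.
\<close>
lemma good_adjoin_pair:
  assumes R: "good R" and y: "y1 \<in> R" "y1 \<noteq> \<zero>" "y2 \<in> R" "y2 \<noteq> \<zero>" and c: "c \<in> R"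
    and x: "x1 \<in> carrier B" "x2 \<in> carrier B" "c = y1 \<otimes> x1 \<oplus> y2 \<otimes> x2"
    and tr: "\<And>q. strong_prime R q \<Longrightarrow> (\<forall>Q\<in>Ass_quot B q. transcendental_mod R x1 Q) \<or>
       (\<forall>Q\<in>Ass_quot B q. transcendental_mod R x2 Q)"
  shows "good (adjoin R x1)" "extends R (adjoin R x1)" "x2 \<in> adjoin R x1"
proof -
  note RD = goodD[OF R]
  note RE = subringE[OF RD(2)]
  let ?T1 = "simple_extension R x1" and ?T2 = "simple_extension R x2"
  have T1: "subring ?T1 B" and T2: "subring ?T2 B"
    using simple_extension_is_subring[OF RD(2)] x by blast+
  note TE1 = subringE[OF T1] and TE2 = subringE[OF T2]
  have RT1: "R \<subseteq> ?T1" and RT2: "R \<subseteq> ?T2"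
    using simple_extension_incl[OF RD(3)] x by blast+
  have x1: "x1 \<in> ?T1" and x2: "x2 \<in> ?T2" using simple_extension_mem[OF RD(2)] x by blast+
  have car: "y1 \<in> carrier B" "y2 \<in> carrier B" "c \<in> carrier B" using y c RD(3) by blast+
  \<comment> \<open>Since \<open>y1 x1 = c - y2 x2\<close>, multiplying by \<open>y1\<close> once
    for each degree in \<open>x1\<close> turns a polynomial in \<open>x1\<close> into one in
    \<open>x2\<close>.\<close>
  have change: "\<exists>e\<in>R. e \<noteq> \<zero> \<and> e \<otimes> t \<in> ?T2" if "t \<in> ?T1" for t
    using that
  proof (induction rule: simple_extension.induct)
    case zero
    show ?case using RE(3) one_not_zero TE2(2) by (intro bexI[of _ \<one>]) auto
  next
    case (lin k1 k2)
    then obtain e where e: "e \<in> R" "e \<noteq> \<zero>" "e \<otimes> k1 \<in> ?T2" by blast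
    have cc: "e \<in> carrier B" "k1 \<in> carrier B" "k2 \<in> carrier B"
      using e(1) lin(1,2) RD(3) TE1(1) by auto
    have eq: "(y1 \<otimes> e) \<otimes> (k1 \<otimes> x1 \<oplus> k2) = (e \<otimes> k1) \<otimes> (c \<oplus> \<ominus> (y2 \<otimes> x2)) \<oplus> (y1 \<otimes> e) \<otimes> k2"
      unfolding x(3) using cc car x(1,2) by algebra
    have "y2 \<otimes> x2 \<in> ?T2" using TE2(6)[OF subsetD[OF RT2 y(3)] x2] .
    then have "c \<oplus> \<ominus> (y2 \<otimes> x2) \<in> ?T2" using TE2(7)[OF subsetD[OF RT2 c] TE2(5)] by blast
    then have "(e \<otimes> k1) \<otimes> (c \<oplus> \<ominus> (y2 \<otimes> x2)) \<in> ?T2" by (rule TE2(6)[OF e(3)])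
    moreover have ye: "y1 \<otimes> e \<in> R" using RE(6)[OF y(1) e(1)] .
    then have "(y1 \<otimes> e) \<otimes> k2 \<in> ?T2" using RE(6)[OF ye lin(2)] RT2 by blast
    ultimately have "(y1 \<otimes> e) \<otimes> (k1 \<otimes> x1 \<oplus> k2) \<in> ?T2" unfolding eq by (rule TE2(7))
    moreover have "y1 \<otimes> e \<noteq> \<zero>" using e(2) y(2) cc(1) car(1) integral_iff by blast
    ultimately show ?case using ye by blast
  qed
  have chart: "fractions R ?T1 \<subseteq> fractions R ?T2"
  proof
    fix b assume "b \<in> fractions R ?T1"
    then obtain d where d: "b \<in> carrier B" "d \<in> R" "d \<noteq> \<zero>" "d \<otimes> b \<in> ?T1" by (rule fractionsE)
    obtain e where e: "e \<in> R" "e \<noteq> \<zero>" "e \<otimes> (d \<otimes> b) \<in> ?T2" using change[OF d(4)] by blast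
    have cc: "d \<in> carrier B" "e \<in> carrier B" using d(2) e(1) RD(3) by auto
    have "(e \<otimes> d) \<otimes> b \<in> ?T2" using e(3) cc d(1) by (simp add: m_assoc)
    moreover have "e \<otimes> d \<noteq> \<zero>" using d(3) e(2) cc integral_iff by blast
    ultimately show "b \<in> fractions R ?T2" using d(1) RE(6)[OF e(1) d(2)] by (intro fractionsI)
  qed
  have reg: "q divides a \<or> regular a q" if q: "strong_prime R q" and a: "a \<in> fractions R ?T1" for q a
    using tr[OF q]
  proof
    assume "\<forall>Q\<in>Ass_quot B q. transcendental_mod R x1 Q"
    then show ?thesis using regular_fractions_of_transcendental[OF R q x(1)] a by blast
  next
    assume "\<forall>Q\<in>Ass_quot B q. transcendental_mod R x2 Q"
    then show ?thesis using regular_fractions_of_transcendental[OF R q x(2)] a chart by blast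
  qed
  show "good (adjoin R x1)" "extends R (adjoin R x1)"
    unfolding adjoin_def using good_simple_extension[OF R x(1) reg] by blast+
  have "y2 \<otimes> x2 = c \<oplus> \<ominus> (y1 \<otimes> x1)" unfolding x(3) using car x(1,2) by algebra
  also have "\<dots> \<in> ?T1"
    using TE1(7)[OF subsetD[OF RT1 c] TE1(5)[OF TE1(6)[OF subsetD[OF RT1 y(1)] x1]]] .
  finally show "x2 \<in> adjoin R x1"
    unfolding adjoin_def using x(2) y(4) RT1 y(3) by (intro fractionsI[of x2 y2]) auto
qed

text \<open>A numerator lying in \<open>q\<close> is a polynomial value whose coefficients lie in
  \<open>R \<inter> q\<close>, hence vanish. This protects the height one primes that still await
  their generator.\<close>

lemma adjoin_inter_prime:
  assumes R: "subring R B" and x: "x \<in> carrier B" and q: "primeideal q B"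
    and tr: "transcendental_mod R x q" and Rq: "R \<inter> q \<subseteq> {\<zero>}"
  shows "adjoin R x \<inter> q \<subseteq> {\<zero>}"
proof
  interpret q: primeideal q B by fact
  fix b assume b: "b \<in> adjoin R x \<inter> q"
  then obtain d where d: "b \<in> carrier B" "d \<in> simple_extension R x" "d \<noteq> \<zero>" "d \<otimes> b \<in> simple_extension R x"
    unfolding adjoin_def by (auto elim: fractionsE)
  obtain p where p: "set p \<subseteq> R" "d \<otimes> b = eval p x" by (rule simple_extension_eval[OF R x d(4)])
  have dc: "d \<in> carrier B"
    using d(2) simple_extension_in_carrier[OF subringE(1)[OF R] x] by blast
  have "d \<otimes> b \<in> q" using q.I_l_closed b dc by blast
  then have "set p \<subseteq> {\<zero>}" using tr p Rq unfolding transcendental_mod_def by fastforce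
  then have "eval p x = \<zero>"
  proof (induction p)
    case (Cons a p)
    then show ?case using x by simp
  qed simp
  then show "b \<in> {\<zero>}" using p(2) d(1,3) dc integral_iff by auto
qed

text \<open>Every value is \<open>x t + r\<close> with \<open>r\<close> in \<open>R\<close>, and a
  nonzero \<open>r\<close> is regular modulo \<open>x\<close> because \<open>x\<close> is regular
  modulo each prime factor of \<open>r\<close>. So \<open>R[x]\<close> is torsion free modulo
  \<open>x\<close> with residues from \<open>R\<close>, and the same decomposition shows that
  quotients by \<open>x\<close> stay in \<open>R[x]\<close>.\<close>

lemma strong_prime_adjoin:
  assumes R: "good R" and x: "x \<in> M" "x \<noteq> \<zero>"
    and reg: "\<And>q. strong_prime R q \<Longrightarrow> regular x q"
  shows "strong_prime (adjoin R x) x"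
proof -
  note RD = goodD[OF R]
  have xc: "x \<in> carrier B" using x M.Icarr by blast
  let ?T = "simple_extension R x"
  have T: "subring ?T B" by (rule simple_extension_is_subring[OF RD(2) xc])
  note TE = subringE[OF T]
  have RT: "R \<subseteq> ?T" using simple_extension_incl[OF RD(3) xc] .
  have decomp: "\<exists>t\<in>?T. \<exists>r\<in>R. y = x \<otimes> t \<oplus> r" if "y \<in> ?T" for y
    using that
  proof cases
    case zero
    have "\<zero> = x \<otimes> \<zero> \<oplus> \<zero>" using xc by simp
    then show ?thesis using zero TE(2) subringE(2)[OF RD(2)] by blast
  next
    case (lin k1 k2)
    then have "y = x \<otimes> k1 \<oplus> k2" using TE(1) xc m_comm by auto
    then show ?thesis using lin by blast
  qed
  have r_reg: "regular r x" if "r \<in> R" "r \<noteq> \<zero>" for r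
    unfolding regular_def
  proof (intro ballI impI)
    fix c assume c: "c \<in> carrier B" "x divides (r \<otimes> c)"
    show "x divides c" by (rule good_cancel_left[OF R that xc reg c])
  qed
  have T_div: "x divides y \<or> regular y x" if y: "y \<in> ?T" for y
  proof -
    obtain t r where tr: "t \<in> ?T" "r \<in> R" "y = x \<otimes> t \<oplus> r" using decomp[OF y] by blast
    have c: "t \<in> carrier B" "r \<in> carrier B" using tr TE(1) RD(3) by auto
    show ?thesis
    proof (cases "r = \<zero>")
      case True
      then have "y = x \<otimes> t" using tr(3) c xc by simp
      then show ?thesis using c(1) unfolding factor_def by blast
    next
      case False
      have "regular y x"
        unfolding regular_def
      proof (intro ballI impI)
        fix w assume w: "w \<in> carrier B" "x divides (y \<otimes> w)"
        have "x divides (x \<otimes> (t \<otimes> w))" unfolding factor_def using c w by blast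
        with w(2) have "x divides (y \<otimes> w \<ominus> x \<otimes> (t \<otimes> w))" by (rule divides_minus[OF _ _ xc])
        moreover have "y \<otimes> w \<ominus> x \<otimes> (t \<otimes> w) = r \<otimes> w" unfolding tr(3) using c xc w(1) by algebra
        ultimately show "x divides w" using regularD[OF r_reg[OF tr(2) False] w(1)] by simp
      qed
      then show ?thesis by blast
    qed
  qed
  have "strong_prime ?T x"
    unfolding strong_prime_def using x T_div simple_extension_mem[OF RD(2) xc] by blast
  moreover have "b \<in> ?T" if b: "b \<in> carrier B" "x \<otimes> b \<in> ?T" for b
  proof -
    obtain t r where tr: "t \<in> ?T" "r \<in> R" "x \<otimes> b = x \<otimes> t \<oplus> r" using decomp[OF b(2)] by blast
    have c: "t \<in> carrier B" "r \<in> carrier B" using tr TE(1) RD(3) by auto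
    have r: "r = x \<otimes> (b \<ominus> t)"
    proof -
      have "x \<otimes> (b \<ominus> t) = x \<otimes> b \<ominus> x \<otimes> t" using c xc b(1) by algebra
      also have "\<dots> = r" unfolding tr(3) using c xc by algebra
      finally show ?thesis by simp
    qed
    have "r = \<zero>"
    proof (rule ccontr)
      assume "r \<noteq> \<zero>"
      moreover have "x divides r" unfolding factor_def using r b(1) c by blast
      ultimately show False using regular_not_divides[OF r_reg[OF tr(2)] c(2) x(1)] by blast
    qed
    then have "x \<otimes> b = x \<otimes> t" using tr(3) c xc by simp
    then have "b = t" using m_lcancel[OF x(2) xc b(1) c(1)] by simp
    then show ?thesis using tr(1) by simp
  qed
  ultimately show ?thesis unfolding adjoin_def by (rule strong_prime_fractions[OF T])
qed

end

subsection \<open>Existence of generic elements\<close>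

lemma card_of_lists_infinite_le:
  assumes "infinite A"
  shows "|lists A| \<le>o |A|"
proof -
  let ?L = "\<lambda>n. {xs. set xs \<subseteq> A \<and> length xs = n}"
  have "|?L n| \<le>o |A|" for n
  proof (induction n)
    case 0
    have "finite (?L 0)" by simp
    then show ?case by (intro ordLess_imp_ordLeq finite_ordLess_infinite2 assms)
  next
    case (Suc n)
    have "|A \<times> ?L n| \<le>o |A|"
      by (rule card_of_Sigma_ordLeq_infinite[OF assms]) (use Suc in auto)
    moreover have "?L (Suc n) = (\<lambda>(a, xs). a # xs) ` (A \<times> ?L n)"
      by (auto simp: length_Suc_conv image_iff)
    ultimately show ?case by (simp only: ordLeq_transitive[OF card_of_image])
  qed
  then have "|\<Union>n. ?L n| \<le>o |A|"
    using assms infinite_iff_card_of_nat by (intro card_of_UNION_ordLeq_infinite) auto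
  moreover have "lists A = (\<Union>n. ?L n)" by auto
  ultimately show ?thesis by simp
qed

text \<open>Only the images of the roots are counted, so \<open>h\<close> may have a kernel: they
  are roots of the image polynomial, which is nonzero over a domain.\<close>

lemma (in ring_hom_ring) finite_root_images:
  assumes S: "domain S" and p: "set p \<subseteq> carrier R" "\<exists>a\<in>set p. h a \<noteq> \<zero>\<^bsub>S\<^esub>"
  shows "finite {h b | b. b \<in> carrier R \<and> h (R.eval p b) = \<zero>\<^bsub>S\<^esub>}"
proof -
  let ?p = "map h p"
  have pc: "set ?p \<subseteq> carrier S" using p(1) by auto
  have ne: "S.normalize ?p \<noteq> []"
  proof
    assume "S.normalize ?p = []"
    then have "?p = replicate (length ?p) \<zero>\<^bsub>S\<^esub>"
      using S.normalize_def'(1)[of ?p] by simp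
    then have "\<forall>a\<in>set ?p. a = \<zero>\<^bsub>S\<^esub>" by (metis in_set_replicate)
    then show False using p(2) by auto
  qed
  have "S.normalize ?p \<in> carrier (poly_ring S)"
    using S.normalize_gives_polynomial[OF pc] univ_poly_carrier by blast
  then have "finite {x. S.is_root (S.normalize ?p) x}" by (rule domain.finite_number_of_roots[OF S])
  moreover have "{h b | b. b \<in> carrier R \<and> h (R.eval p b) = \<zero>\<^bsub>S\<^esub>} \<subseteq> {x. S.is_root (S.normalize ?p) x}"
  proof
    fix x assume "x \<in> {h b | b. b \<in> carrier R \<and> h (R.eval p b) = \<zero>\<^bsub>S\<^esub>}"
    then obtain b where b: "x = h b" "b \<in> carrier R" "h (R.eval p b) = \<zero>\<^bsub>S\<^esub>" by blast
    have xc: "x \<in> carrier S" using b by simp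
    have "S.eval ?p x = \<zero>\<^bsub>S\<^esub>" using eval_hom'[OF b(2) p(1)] b(1,3) by simp
    then show "x \<in> {x. S.is_root (S.normalize ?p) x}"
      unfolding S.is_root_def using xc ne S.eval_normalize[OF pc xc] by simp
  qed
  ultimately show ?thesis using finite_subset by blast
qed

context local_noetherian_domain
begin

lemma infinite_subring:
  assumes "contains_rationals B" "subring R B"
  shows "infinite R"
proof -
  note RE = subringE[OF assms(2)]
  have nR: "[n] \<cdot> \<one> \<in> R" for n :: nat
    by (induction n) (use RE in auto)
  have "inj (\<lambda>n::nat. [n] \<cdot> \<one>)"
  proof (rule linorder_injI)
    fix m n :: nat assume mn: "m < n"
    have "[n] \<cdot> \<one> = [m] \<cdot> \<one> \<oplus> [(n - m)] \<cdot> \<one>"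
      using add.nat_pow_mult[of \<one> m "n - m"] mn by simp
    moreover have "[(n - m)] \<cdot> \<one> \<in> Units B"
      using assms(1) mn unfolding contains_rationals_def by simp
    then have "[(n - m)] \<cdot> \<one> \<noteq> \<zero>" using Units_iff M.zero_closed by auto
    ultimately show "[m] \<cdot> \<one> \<noteq> [n] \<cdot> \<one>"
      using add.r_cancel_one' by simp
  qed
  then have "infinite (range (\<lambda>n::nat. [n] \<cdot> \<one>))" using finite_imageD by blast
  moreover have "range (\<lambda>n::nat. [n] \<cdot> \<one>) \<subseteq> R" using nR by auto
  ultimately show ?thesis using finite_subset by blast
qed

text \<open>Polynomial values are indexed by lists over \<open>R\<close>, and an element
  \<open>b\<close> of the closure is determined by one denominator \<open>d\<close> together with
  \<open>d b\<close>, by cancellation in the domain \<open>B\<close>.\<close>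

lemma adjoin_card:
  assumes R: "subring R B" and x: "x \<in> carrier B" and inf: "infinite R"
  shows "|adjoin R x| \<le>o |R|"
proof -
  let ?T = "simple_extension R x"
  have "?T \<subseteq> (\<lambda>p. eval p x) ` lists R"
    using simple_extension_eval[OF R x] by (metis image_eqI in_listsI subsetI subset_code(1))
  then have "|?T| \<le>o |lists R|"
    by (rule ordLeq_transitive[OF card_of_mono1 card_of_image])
  then have T: "|?T| \<le>o |R|" by (rule ordLeq_transitive[OF _ card_of_lists_infinite_le[OF inf]])
  have T2: "|?T \<times> ?T| \<le>o |R|"
    by (rule card_of_Sigma_ordLeq_infinite[OF inf T]) (use T in auto)
  define g where "g b = (SOME d. d \<in> ?T \<and> d \<noteq> \<zero> \<and> d \<otimes> b \<in> ?T)" for b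
  have g: "g b \<in> ?T \<and> g b \<noteq> \<zero> \<and> g b \<otimes> b \<in> ?T" if "b \<in> adjoin R x" for b
    unfolding g_def by (rule someI_ex) (use that in \<open>auto simp: adjoin_def elim: fractionsE\<close>)
  have Tc: "?T \<subseteq> carrier B" by (rule simple_extension_in_carrier[OF subringE(1)[OF R] x])
  have "inj_on (\<lambda>b. (g b, g b \<otimes> b)) (adjoin R x)"
  proof (rule inj_onI)
    fix a b assume a: "a \<in> adjoin R x" and b: "b \<in> adjoin R x"
      and eq: "(g a, g a \<otimes> a) = (g b, g b \<otimes> b)"
    have "a \<in> carrier B" "b \<in> carrier B" using a b unfolding adjoin_def fractions_def by auto
    then show "a = b" using eq g[OF a] Tc m_lcancel[of "g a" a b] by auto
  qed
  moreover have "(\<lambda>b. (g b, g b \<otimes> b)) ` adjoin R x \<subseteq> ?T \<times> ?T" using g by auto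
  ultimately have "|adjoin R x| \<le>o |?T \<times> ?T|" using card_of_ordLeq by blast
  then show ?thesis by (rule ordLeq_transitive[OF _ T2])
qed

lemma finite_root_cosets:
  assumes q: "primeideal q B" and p: "set p \<subseteq> carrier B" "\<not> set p \<subseteq> q"
  shows "finite {q +> b | b. b \<in> carrier B \<and> eval p b \<in> q}"
proof -
  have qi: "ideal q B" by (rule primeideal.axioms(1)[OF q])
  have zero: "q +> b = \<zero>\<^bsub>B Quot q\<^esub> \<longleftrightarrow> b \<in> q" if "b \<in> carrier B" for b
  proof -
    have "\<zero>\<^bsub>B Quot q\<^esub> = q" by (simp add: FactRing_def)
    then show ?thesis
      using ideal.rcos_const_imp_mem[OF qi that] a_rcos_zero[OF qi, of b] by metis
  qed
  have "finite {q +> b | b. b \<in> carrier B \<and> q +> eval p b = \<zero>\<^bsub>B Quot q\<^esub>}"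
    by (rule ring_hom_ring.finite_root_images[OF ideal.rcos_ring_hom_ring[OF qi]
          primeideal.quotient_is_domain[OF q] p(1)]) (use p zero in blast)
  moreover have "q +> eval p b = \<zero>\<^bsub>B Quot q\<^esub> \<longleftrightarrow> eval p b \<in> q" if "b \<in> carrier B" for b
    by (rule zero[OF eval_in_carrier[OF p(1) that]])
  ultimately show ?thesis by (simp cong: conj_cong)
qed

text \<open>The algebraic residues modulo \<open>q\<close> are the roots of polynomials that do not
  vanish modulo \<open>q\<close>; there are at most \<open>|R|\<close> of these, each with finitely
  many roots. One representative per residue class is collected.\<close>

lemma algebraic_representatives:
  assumes q: "primeideal q B" and R: "R \<subseteq> carrier B" and inf: "infinite R"
  shows "\<exists>E\<subseteq>carrier B. |E| \<le>o |R| \<and>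
    (\<forall>b\<in>carrier B. \<not> transcendental_mod R b q \<longrightarrow> (\<exists>e\<in>E. b \<ominus> e \<in> q))"
proof -
  interpret q: primeideal q B by fact
  let ?K = "\<lambda>p. {q +> b | b. b \<in> carrier B \<and> eval p b \<in> q}"
  let ?P = "{p \<in> lists R. \<not> set p \<subseteq> q}"
  define U where "U = (\<Union>p\<in>?P. ?K p)"
  have "|?P| \<le>o |R|"
    by (rule ordLeq_transitive[OF card_of_mono1 card_of_lists_infinite_le[OF inf]]) auto
  moreover have "\<forall>p\<in>?P. |?K p| \<le>o |R|"
    using finite_root_cosets[OF q] R by (intro ballI ordLess_imp_ordLeq finite_ordLess_infinite2 inf) auto
  ultimately have U: "|U| \<le>o |R|" unfolding U_def by (rule card_of_UNION_ordLeq_infinite[OF inf])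
  define e where "e C = (SOME b. b \<in> carrier B \<and> C = q +> b)" for C
  have e: "e C \<in> carrier B \<and> C = q +> e C" if "C \<in> U" for C
    unfolding e_def by (rule someI_ex) (use that U_def in blast)
  have "|e ` U| \<le>o |R|" by (rule ordLeq_transitive[OF card_of_image U])
  moreover have "e ` U \<subseteq> carrier B" using e by blast
  moreover have "\<exists>x\<in>e ` U. b \<ominus> x \<in> q" if b: "b \<in> carrier B" "\<not> transcendental_mod R b q" for b
  proof -
    obtain p where p: "set p \<subseteq> R" "eval p b \<in> q" "\<not> set p \<subseteq> q"
      using b(2) unfolding transcendental_mod_def by blast
    have "p \<in> ?P" using p by auto
    then have C: "q +> b \<in> U" unfolding U_def using p(2) b(1) by blast
    have "b \<ominus> e (q +> b) \<in> q"
      using e[OF C] quotient_eq_iff_same_a_r_cos[OF q.is_ideal b(1)] by blast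
    then show ?thesis using C by blast
  qed
  ultimately show ?thesis by blast
qed

text \<open>
  Each triple \<open>(q, z, e)\<close> excludes at most one residue class of \<open>t\<close> modulo \<open>M\<close>, because two
  excluded elements differ by an element of \<open>q \<subseteq> M\<close>.
\<close>
lemma avoid_cosets_multiple:
  assumes D: "|D| <o |carrier (B Quot M)|"
    and Dq: "\<And>q z e. (q, z, e) \<in> D \<Longrightarrow> primeideal q B \<and> z \<in> carrier B \<and> e \<in> carrier B \<and> z \<notin> q"
  shows "\<exists>t\<in>carrier B. \<forall>(q, z, e)\<in>D. z \<otimes> t \<ominus> e \<notin> q"
proof -
  \<comment> \<open>If a triple excludes no \<open>t\<close> at all, the choice is arbitrary and
    merely rules out one further class modulo \<open>M\<close>.\<close>
  define s where "s = (\<lambda>(q, z, e). SOME t. t \<in> carrier B \<and> z \<otimes> t \<ominus> e \<in> q)"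
  define g where "g d = M +> s d" for d
  have "|g ` D| <o |carrier (B Quot M)|" by (rule ordLeq_ordLess_trans[OF card_of_image D])
  then have "\<not> carrier (B Quot M) \<subseteq> g ` D"
    using card_of_mono1 not_ordLess_ordLeq by blast
  then obtain t where t: "t \<in> carrier B" "M +> t \<notin> g ` D"
    unfolding FactRing_def A_RCOSETS_def' by auto
  have "z \<otimes> t \<ominus> e \<notin> q" if d: "(q, z, e) \<in> D" for q z e
  proof
    assume bad: "z \<otimes> t \<ominus> e \<in> q"
    interpret q: primeideal q B using Dq[OF d] by blast
    have c: "z \<in> carrier B" "e \<in> carrier B" "z \<notin> q" using Dq[OF d] by auto
    let ?s = "s (q, z, e)"
    have "?s \<in> carrier B \<and> z \<otimes> ?s \<ominus> e \<in> q"
      unfolding s_def prod.case by (rule someI[of _ t]) (use t bad in blast)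
    then have sc: "?s \<in> carrier B" "z \<otimes> ?s \<ominus> e \<in> q" by auto
    have "(z \<otimes> t \<ominus> e) \<oplus> \<ominus> (z \<otimes> ?s \<ominus> e) = z \<otimes> (t \<ominus> ?s)" using sc(1) t(1) c(1,2) by algebra
    moreover have "(z \<otimes> t \<ominus> e) \<oplus> \<ominus> (z \<otimes> ?s \<ominus> e) \<in> q" using q.a_closed[OF bad q.a_inv_closed[OF sc(2)]] .
    ultimately have "t \<ominus> ?s \<in> q" using q.I_prime[of z "t \<ominus> ?s"] c sc t by auto
    then have "t \<ominus> ?s \<in> M" using prime_subset_M q.primeideal by blast
    then have "M +> t = g (q, z, e)"
      unfolding g_def using quotient_eq_iff_same_a_r_cos[OF M.is_ideal t(1) sc(1)] by blast
    then show False using t(2) d by blast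
  qed
  then show ?thesis using t(1) by blast
qed

text \<open>Prime avoidance for cosets, one generator at a time. Primes containing \<open>zs\<close>
  see only the multiple \<open>z u\<close>, so \<open>u\<close> is fixed for them first; for the
  other primes the induction hypothesis applies with \<open>e\<close> shifted by
  \<open>z u\<close>.\<close>

lemma avoid_cosets_list:
  assumes D: "|D| <o |carrier (B Quot M)|" and zs: "set zs \<subseteq> carrier B"
    and Dq: "\<And>q e. (q, e) \<in> D \<Longrightarrow> primeideal q B \<and> e \<in> carrier B \<and> \<not> set zs \<subseteq> q"
  shows "\<exists>t\<in>Idl (set zs). \<forall>(q, e)\<in>D. t \<ominus> e \<notin> q"
  using assms
proof (induction zs arbitrary: D)
  case Nil
  then have "D = {}" by auto
  then show ?case using additive_subgroup.zero_closed[OF ideal.axioms(1)[OF genideal_ideal[of "{}"]]] by auto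
next
  case (Cons z zs)
  have zc: "z \<in> carrier B" "set zs \<subseteq> carrier B" using Cons(3) by auto
  define D2 where "D2 = {(q, z, e) | q e. (q, e) \<in> D \<and> set zs \<subseteq> q}"
  have "D2 \<subseteq> (\<lambda>(q, e). (q, z, e)) ` D" unfolding D2_def by force
  then have "|D2| \<le>o |D|" by (rule ordLeq_transitive[OF card_of_mono1 card_of_image])
  then have "|D2| <o |carrier (B Quot M)|" by (rule ordLeq_ordLess_trans[OF _ Cons(2)])
  moreover have "primeideal q B \<and> w \<in> carrier B \<and> e \<in> carrier B \<and> w \<notin> q" if "(q, w, e) \<in> D2" for q w e
    using that Cons(4)[of q e] zc(1) unfolding D2_def by auto
  ultimately obtain u where u: "u \<in> carrier B" "\<forall>(q, w, e)\<in>D2. w \<otimes> u \<ominus> e \<notin> q"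
    using avoid_cosets_multiple[of D2] by blast
  define D1 where "D1 = {(q, e \<ominus> z \<otimes> u) | q e. (q, e) \<in> D \<and> \<not> set zs \<subseteq> q}"
  have "D1 \<subseteq> (\<lambda>(q, e). (q, e \<ominus> z \<otimes> u)) ` D" unfolding D1_def by force
  then have "|D1| \<le>o |D|" by (rule ordLeq_transitive[OF card_of_mono1 card_of_image])
  then have D1c: "|D1| <o |carrier (B Quot M)|" by (rule ordLeq_ordLess_trans[OF _ Cons(2)])
  have D1q: "primeideal q B \<and> e \<in> carrier B \<and> \<not> set zs \<subseteq> q" if "(q, e) \<in> D1" for q e
    using that Cons(4) zc(1) u(1) unfolding D1_def by auto
  obtain t where t: "t \<in> Idl (set zs)" "\<forall>(q, e)\<in>D1. t \<ominus> e \<notin> q"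
    using Cons(1)[OF D1c zc(2) D1q] by blast
  have sub: "Idl (set zs) \<subseteq> Idl (set (z # zs))"
    using subset_Idl_subset[OF Cons(3), of "set zs"] by auto
  interpret J: ideal "Idl (set (z # zs))" B by (rule genideal_ideal[OF Cons(3)])
  have "z \<in> Idl (set (z # zs))" using genideal_self[OF Cons(3)] by auto
  then have zu: "z \<otimes> u \<in> Idl (set (z # zs))" using J.I_r_closed u(1) by blast
  have tc: "t \<in> carrier B" using t(1) sub J.Icarr by blast
  have "t \<oplus> z \<otimes> u \<ominus> e \<notin> q" if d: "(q, e) \<in> D" for q e
  proof (cases "set zs \<subseteq> q")
    case False
    have ec: "e \<in> carrier B" using Cons(4)[OF d] by blast
    have "(q, e \<ominus> z \<otimes> u) \<in> D1" unfolding D1_def using d False by blast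
    then have "t \<ominus> (e \<ominus> z \<otimes> u) \<notin> q" using t(2) by blast
    moreover have "t \<ominus> (e \<ominus> z \<otimes> u) = t \<oplus> z \<otimes> u \<ominus> e" using tc ec zc(1) u(1) by algebra
    ultimately show ?thesis by simp
  next
    case True
    interpret q: primeideal q B using Cons(4)[OF d] by blast
    have ec: "e \<in> carrier B" using Cons(4)[OF d] by blast
    have tq: "t \<in> q" using genideal_minimal[OF q.is_ideal True] t(1) by blast
    have "(q, z, e) \<in> D2" unfolding D2_def using d True by blast
    then have n: "z \<otimes> u \<ominus> e \<notin> q" using u(2) by blast
    show ?thesis
    proof
      assume "t \<oplus> z \<otimes> u \<ominus> e \<in> q"
      then have "\<ominus> t \<oplus> (t \<oplus> z \<otimes> u \<ominus> e) \<in> q" using q.a_closed[OF q.a_inv_closed[OF tq]] by blast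
      moreover have "\<ominus> t \<oplus> (t \<oplus> z \<otimes> u \<ominus> e) = z \<otimes> u \<ominus> e" using tc ec zc(1) u(1) by algebra
      ultimately show False using n by simp
    qed
  qed
  moreover have "t \<oplus> z \<otimes> u \<in> Idl (set (z # zs))" using J.a_closed zu sub t(1) by blast
  ultimately show ?case by blast
qed

lemma avoid_cosets:
  assumes D: "|D| <o |carrier (B Quot M)|" and J: "ideal J B"
    and Dq: "\<And>q e. (q, e) \<in> D \<Longrightarrow> primeideal q B \<and> e \<in> carrier B \<and> \<not> J \<subseteq> q"
  shows "\<exists>t\<in>J. \<forall>(q, e)\<in>D. t \<ominus> e \<notin> q"
proof -
  obtain A where A: "A \<subseteq> carrier B" "finite A" "J = Idl A" using finetely_gen[OF J] by blast
  obtain zs where zs: "set zs = A" using finite_list[OF A(2)] by blast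
  have "primeideal q B \<and> e \<in> carrier B \<and> \<not> set zs \<subseteq> q" if d: "(q, e) \<in> D" for q e
  proof -
    have "primeideal q B" using Dq[OF d] by blast
    then have "set zs \<subseteq> q \<Longrightarrow> J \<subseteq> q"
      using genideal_minimal[OF primeideal.axioms(1)] A(3) zs by blast
    then show ?thesis using Dq[OF d] by blast
  qed
  then show ?thesis using avoid_cosets_list[OF D, of zs] A zs by blast
qed

text \<open>Being algebraic modulo \<open>q\<close> means lying in one of at most \<open>|R|\<close>
  cosets of \<open>q\<close>, so genericity is an avoidance problem with at most \<open>|R|\<close>
  conditions, fewer than the residue classes modulo \<open>M\<close>.\<close>

lemma exists_transcendental:
  assumes R: "R \<subseteq> carrier B" "infinite R" "|R| <o |carrier (B Quot M)|"
    and Q: "|Q| \<le>o |R|" "\<And>q. q \<in> Q \<Longrightarrow> primeideal q B \<and> \<not> J \<subseteq> q"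
    and J: "ideal J B" and b: "b \<in> carrier B"
  shows "\<exists>t\<in>J. \<forall>q\<in>Q. transcendental_mod R (b \<oplus> t) q"
proof -
  interpret J: ideal J B by fact
  define E where "E q = (SOME E. E \<subseteq> carrier B \<and> |E| \<le>o |R| \<and>
    (\<forall>b\<in>carrier B. \<not> transcendental_mod R b q \<longrightarrow> (\<exists>e\<in>E. b \<ominus> e \<in> q)))" for q
  have E: "E q \<subseteq> carrier B \<and> |E q| \<le>o |R| \<and>
    (\<forall>b\<in>carrier B. \<not> transcendental_mod R b q \<longrightarrow> (\<exists>e\<in>E q. b \<ominus> e \<in> q))" if "q \<in> Q" for q
    unfolding E_def
    by (rule someI_ex) (use algebraic_representatives[OF _ R(1,2), of q] Q(2)[OF that] in blast)
  define D where "D = (\<lambda>(q, e). (q, e \<ominus> b)) ` (SIGMA q:Q. E q)"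
  have "|SIGMA q:Q. E q| \<le>o |R|"
    by (rule card_of_Sigma_ordLeq_infinite[OF R(2) Q(1)]) (use E in blast)
  then have "|D| \<le>o |R|" unfolding D_def by (rule ordLeq_transitive[OF card_of_image])
  then have "|D| <o |carrier (B Quot M)|" by (rule ordLeq_ordLess_trans[OF _ R(3)])
  moreover have "primeideal q B \<and> e \<in> carrier B \<and> \<not> J \<subseteq> q" if "(q, e) \<in> D" for q e
  proof -
    obtain e' where 1: "q \<in> Q" "e' \<in> E q" "e = e' \<ominus> b" using \<open>(q, e) \<in> D\<close> unfolding D_def by auto
    have "e' \<in> carrier B" using E[OF 1(1)] 1(2) by blast
    then show ?thesis using Q(2)[OF 1(1)] 1(3) b by simp
  qed
  ultimately obtain t where t: "t \<in> J" "\<forall>(q, e)\<in>D. t \<ominus> e \<notin> q"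
    using avoid_cosets[OF _ J] by blast
  have tc: "t \<in> carrier B" using t J.Icarr by blast
  have "transcendental_mod R (b \<oplus> t) q" if q: "q \<in> Q" for q
  proof (rule ccontr)
    assume "\<not> ?thesis"
    then obtain e where e: "e \<in> E q" "b \<oplus> t \<ominus> e \<in> q" using E[OF q] b tc by blast
    have ec: "e \<in> carrier B" using e E[OF q] by blast
    have "t \<ominus> (e \<ominus> b) = b \<oplus> t \<ominus> e" using ec b tc by algebra
    moreover have "(q, e \<ominus> b) \<in> D" unfolding D_def using q e(1) by force
    ultimately show False using t(2) e(2) by fastforce
  qed
  then show ?thesis using t(1) by blast
qed

text \<open>The same \<open>t\<close> serves all triples, with different \<open>b\<close> and
  \<open>z\<close>: this is needed when two unknowns are moved simultaneously along a
  syzygy.\<close>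

lemma exists_transcendental_multiple:
  assumes R: "R \<subseteq> carrier B" "infinite R" "|R| <o |carrier (B Quot M)|"
    and Q: "|Q| \<le>o |R|"
      "\<And>q b z. (q, b, z) \<in> Q \<Longrightarrow> primeideal q B \<and> b \<in> carrier B \<and> z \<in> carrier B \<and> z \<notin> q"
  shows "\<exists>t\<in>carrier B. \<forall>(q, b, z)\<in>Q. transcendental_mod R (b \<oplus> z \<otimes> t) q"
proof -
  define E where "E q = (SOME E. E \<subseteq> carrier B \<and> |E| \<le>o |R| \<and>
    (\<forall>b\<in>carrier B. \<not> transcendental_mod R b q \<longrightarrow> (\<exists>e\<in>E. b \<ominus> e \<in> q)))" for q
  have E: "E q \<subseteq> carrier B \<and> |E q| \<le>o |R| \<and>
    (\<forall>b\<in>carrier B. \<not> transcendental_mod R b q \<longrightarrow> (\<exists>e\<in>E q. b \<ominus> e \<in> q))" if "primeideal q B" for q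
    unfolding E_def by (rule someI_ex) (use algebraic_representatives[OF that R(1,2)] in blast)
  define D where "D = (\<lambda>((q, b, z), e). (q, z, e \<ominus> b)) ` (SIGMA d:Q. E (fst d))"
  have "|SIGMA d:Q. E (fst d)| \<le>o |R|"
    by (rule card_of_Sigma_ordLeq_infinite[OF R(2) Q(1)]) (use E Q(2) in auto)
  then have "|D| \<le>o |R|" unfolding D_def by (rule ordLeq_transitive[OF card_of_image])
  then have "|D| <o |carrier (B Quot M)|" by (rule ordLeq_ordLess_trans[OF _ R(3)])
  moreover have "primeideal q B \<and> z \<in> carrier B \<and> e \<in> carrier B \<and> z \<notin> q" if "(q, z, e) \<in> D" for q z e
  proof -
    obtain b e' where 1: "(q, b, z) \<in> Q" "e' \<in> E q" "e = e' \<ominus> b" using \<open>(q, z, e) \<in> D\<close> unfolding D_def by auto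
    have "e' \<in> carrier B" using E[of q] Q(2)[OF 1(1)] 1(2) by blast
    then show ?thesis using Q(2)[OF 1(1)] 1(3) by simp
  qed
  ultimately obtain t where t: "t \<in> carrier B" "\<forall>(q, z, e)\<in>D. z \<otimes> t \<ominus> e \<notin> q"
    using avoid_cosets_multiple by blast
  have "transcendental_mod R (b \<oplus> z \<otimes> t) q" if d: "(q, b, z) \<in> Q" for q b z
  proof (rule ccontr)
    assume n: "\<not> ?thesis"
    have c: "primeideal q B" "b \<in> carrier B" "z \<in> carrier B" using Q(2)[OF d] by auto
    obtain e where e: "e \<in> E q" "b \<oplus> z \<otimes> t \<ominus> e \<in> q" using n E[OF c(1)] c(2,3) t(1) by blast
    have ec: "e \<in> carrier B" using e E[OF c(1)] by blast
    have "z \<otimes> t \<ominus> (e \<ominus> b) = b \<oplus> z \<otimes> t \<ominus> e" using ec c(2,3) t(1) by algebra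
    moreover have "((q, b, z), e) \<in> (SIGMA d:Q. E (fst d))" using d e(1) by simp
    then have "(q, z, e \<ominus> b) \<in> D" unfolding D_def by (rule image_eqI[rotated]) simp
    ultimately show False using t(2) e(2) by fastforce
  qed
  then show ?thesis using t(1) by blast
qed

section \<open>Carrying out a single task\<close>

definition critical_primes :: "'b set \<Rightarrow> 'b set set" where
  "critical_primes R = (\<Union>p\<in>{p. strong_prime R p}. Ass_quot B p)"

lemma critical_primesD:
  assumes "Q \<in> critical_primes R"
  obtains p where "strong_prime R p" "Q \<in> Ass_quot B p" "primeideal Q B"
  using assms Ass_quotD(1) strong_primeD(4) unfolding critical_primes_def by blast

lemma card_critical_primes:
  assumes "infinite R"
  shows "|critical_primes R| \<le>o |R|"
  unfolding critical_primes_def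
proof (rule card_of_UNION_ordLeq_infinite[OF assms])
  show "|{p. strong_prime R p}| \<le>o |R|" by (rule card_of_mono1) (auto dest: strong_primeD(1))
  show "\<forall>p\<in>{p. strong_prime R p}. |Ass_quot B p| \<le>o |R|"
    by (intro ballI ordLess_imp_ordLeq finite_ordLess_infinite2 assms finite_Ass_quot[OF is_cring])
      (auto dest: strong_primeD(4))
qed

text \<open>In a Noetherian domain this is grade at least two, the unit ideal included; the case
  \<open>b = \<zero>\<close> excludes the zero ideal. It is the hypothesis of the theorem on primes
  above \<open>\<psi>(x)\<close>, and the condition under which every coset of \<open>J\<close>
  contains elements generic for all critical primes.\<close>

definition dense :: "'b set \<Rightarrow> bool" where
  "dense J \<longleftrightarrow> ideal J B \<and> (\<forall>b\<in>carrier B. \<forall>q\<in>Ass_quot B b. \<not> J \<subseteq> q)"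

lemma dense_step:
  assumes R: "good R" "infinite R" "|R| <o |carrier (B Quot M)|"
    and J: "dense J" and b: "b \<in> carrier B"
  shows "\<exists>S. good S \<and> extends R S \<and> |S| \<le>o |R| \<and> (\<exists>t\<in>J. b \<oplus> t \<in> S)"
proof -
  note RD = goodD[OF R(1)]
  have Q: "primeideal q B \<and> \<not> J \<subseteq> q" if q: "q \<in> critical_primes R" for q
  proof -
    obtain p where "strong_prime R p" "q \<in> Ass_quot B p" "primeideal q B" by (rule critical_primesD[OF q])
    then show ?thesis using J strong_primeD(4) unfolding dense_def by blast
  qed
  have Ji: "ideal J B" using J unfolding dense_def by blast
  obtain t where t: "t \<in> J" "\<forall>q\<in>critical_primes R. transcendental_mod R (b \<oplus> t) q"
    using exists_transcendental[OF RD(3) R(2,3) card_critical_primes[OF R(2)] Q Ji b] by blast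
  have x: "b \<oplus> t \<in> carrier B" using b ideal.Icarr[OF Ji t(1)] by simp
  have "good (adjoin R (b \<oplus> t))" "extends R (adjoin R (b \<oplus> t))"
    using good_adjoin[OF R(1) x] t(2) unfolding critical_primes_def by blast+
  then show ?thesis
    using adjoin_card[OF RD(2) x R(2)] adjoin_subset(3)[OF RD(2) x] t(1) by blast
qed

text \<open>All pairs \<open>(b1 + y2 t, b2 - y1 t)\<close> solve the equation. For a prime
  \<open>q\<close> not dividing \<open>y2\<close> a generic \<open>t\<close> makes the first entry
  transcendental; a prime dividing \<open>y2\<close> cannot divide \<open>y1\<close>, so there the
  second entry works.\<close>

lemma pair_step:
  assumes R: "good R" "infinite R" "|R| <o |carrier (B Quot M)|"
    and y: "y1 \<in> R" "y1 \<noteq> \<zero>" "y2 \<in> R" "y2 \<noteq> \<zero>" "regular y1 y2"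
    and c: "c \<in> R" "b1 \<in> carrier B" "b2 \<in> carrier B" "c = y1 \<otimes> b1 \<oplus> y2 \<otimes> b2"
  shows "\<exists>S. good S \<and> extends R S \<and> |S| \<le>o |R| \<and> (\<exists>x1\<in>S. \<exists>x2\<in>S. c = y1 \<otimes> x1 \<oplus> y2 \<otimes> x2)"
proof -
  note RD = goodD[OF R(1)]
  have yc: "y1 \<in> carrier B" "y2 \<in> carrier B" using y RD(3) by auto
  let ?C = "critical_primes R"
  \<comment> \<open>A common factor \<open>q\<close> would give \<open>y1 v = y2 u\<close> for
    \<open>y2 = q v\<close>; regularity yields \<open>v = y2 w = q v w\<close>, so \<open>q\<close>
    would be a unit.\<close>
  have notboth: "\<not> q divides y1" if q: "strong_prime R q" "q divides y2" for q
  proof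
    assume "q divides y1"
    then obtain u where u: "u \<in> carrier B" "y1 = q \<otimes> u" unfolding factor_def by blast
    obtain v where v: "v \<in> carrier B" "y2 = q \<otimes> v" using q(2) unfolding factor_def by blast
    note qD = strong_primeD[OF q(1)]
    have v0: "v \<noteq> \<zero>" using y(4) v(2) qD(4) by auto
    have "y1 \<otimes> v = y2 \<otimes> u" unfolding u(2) v(2) using u(1) v(1) qD(4) by algebra
    then have "y2 divides (y1 \<otimes> v)" unfolding factor_def using u(1) by blast
    then have "y2 divides v" using regularD[OF y(5) v(1)] by blast
    then obtain w where w: "w \<in> carrier B" "v = y2 \<otimes> w" unfolding factor_def by blast
    have "v \<otimes> \<one> = v \<otimes> (q \<otimes> w)"
    proof -
      have "v \<otimes> \<one> = v" using v(1) by simp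
      also have "v = (q \<otimes> v) \<otimes> w" using w(2) unfolding v(2) .
      also have "\<dots> = v \<otimes> (q \<otimes> w)" using v(1) w(1) qD(4) by algebra
      finally show ?thesis .
    qed
    then have "\<one> = q \<otimes> w" using m_lcancel[OF v0 v(1), of \<one> "q \<otimes> w"] w(1) qD(4) by simp
    then show False using M.I_r_closed[OF qD(2) w(1)] one_notin_M by simp
  qed
  define T where "T = (\<lambda>q. (q, b1, y2)) ` {q\<in>?C. y2 \<notin> q} \<union> (\<lambda>q. (q, b2, \<ominus> y1)) ` {q\<in>?C. y1 \<notin> q}"
  have C: "|?C| \<le>o |R|" by (rule card_critical_primes[OF R(2)])
  have im: "|f ` {q\<in>?C. P q}| \<le>o |R|" for f :: "'b set \<Rightarrow> 'b set \<times> 'b \<times> 'b" and P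
    by (rule ordLeq_transitive[OF card_of_image ordLeq_transitive[OF card_of_mono1 C]]) blast
  have T: "|T| \<le>o |R|" unfolding T_def
    using card_of_Un_ordLeq_infinite_Field[of "|R|"] im R(2) card_of_Card_order
    by (simp add: Field_card_of)
  have Tq: "primeideal q B \<and> b \<in> carrier B \<and> z \<in> carrier B \<and> z \<notin> q" if "(q, b, z) \<in> T" for q b z
  proof -
    have q: "q \<in> ?C" using that unfolding T_def by auto
    interpret q: primeideal q B using critical_primesD[OF q] by blast
    have "\<ominus> y1 \<in> q \<Longrightarrow> y1 \<in> q" using q.a_inv_closed[of "\<ominus> y1"] yc by simp
    then show ?thesis using that c yc q.primeideal unfolding T_def by auto
  qed
  obtain t where t: "t \<in> carrier B" "\<forall>(q, b, z)\<in>T. transcendental_mod R (b \<oplus> z \<otimes> t) q"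
    using exists_transcendental_multiple[OF RD(3) R(2,3) T Tq] by blast
  define x1 where "x1 = b1 \<oplus> y2 \<otimes> t"
  define x2 where "x2 = b2 \<oplus> \<ominus> y1 \<otimes> t"
  have xc: "x1 \<in> carrier B" "x2 \<in> carrier B" unfolding x1_def x2_def using c yc t(1) by auto
  have ceq: "c = y1 \<otimes> x1 \<oplus> y2 \<otimes> x2" unfolding c(4) x1_def x2_def using c(2,3) yc t(1) by algebra
  have tr: "(\<forall>Q\<in>Ass_quot B q. transcendental_mod R x1 Q) \<or> (\<forall>Q\<in>Ass_quot B q. transcendental_mod R x2 Q)"
    if q: "strong_prime R q" for q
  proof (cases "q divides y2")
    case False
    have "transcendental_mod R x1 Q" if Q: "Q \<in> Ass_quot B q" for Q
    proof -
      have "y2 \<notin> Q" using Ass_inter_strong_prime[OF q Q y(3)] False by blast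
      moreover have "Q \<in> ?C" using q Q unfolding critical_primes_def by blast
      ultimately have "(Q, b1, y2) \<in> T" unfolding T_def by blast
      then show ?thesis using t(2) unfolding x1_def by blast
    qed
    then show ?thesis by blast
  next
    case True
    have "transcendental_mod R x2 Q" if Q: "Q \<in> Ass_quot B q" for Q
    proof -
      have "y1 \<notin> Q" using Ass_inter_strong_prime[OF q Q y(1)] notboth[OF q True] by blast
      moreover have "Q \<in> ?C" using q Q unfolding critical_primes_def by blast
      ultimately have "(Q, b2, \<ominus> y1) \<in> T" unfolding T_def by blast
      then show ?thesis using t(2) unfolding x2_def by blast
    qed
    then show ?thesis by blast
  qed
  note * = good_adjoin_pair[OF R(1) y(1-4) c(1) xc ceq tr]
  show ?thesis
    using * adjoin_card[OF RD(2) xc(1) R(2)] adjoin_subset(3)[OF RD(2) xc(1)] ceq by blast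
qed

end

subsection \<open>The transfinite construction\<close>

text \<open>
  Every task is scheduled at cofinally many stages, so that data appearing at some stage are
  treated at a later one.
\<close>
lemma transfinite_closure:
  fixes G :: "'a set \<Rightarrow> bool" and E :: "'a set \<Rightarrow> 'a set \<Rightarrow> bool"
    and \<Phi> :: "'t \<Rightarrow> 'a set \<Rightarrow> 'a set \<Rightarrow> bool" and K :: "'k set"
  assumes E_refl: "\<And>R. E R R" and E_trans: "\<And>R S U. E R S \<Longrightarrow> E S U \<Longrightarrow> E R U"
    and E_sub: "\<And>R S. E R S \<Longrightarrow> R \<subseteq> S"
    and chain: "\<And>C. C \<noteq> {} \<Longrightarrow> (\<And>R. R \<in> C \<Longrightarrow> G R) \<Longrightarrow>
      (\<And>R S. R \<in> C \<Longrightarrow> S \<in> C \<Longrightarrow> E R S \<or> E S R) \<Longrightarrow> G (\<Union>C) \<and> (\<forall>R\<in>C. E R (\<Union>C))"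
    and step: "\<And>R t. G R \<Longrightarrow> E R0 R \<Longrightarrow> |R| <o |K| \<Longrightarrow> t \<in> T \<Longrightarrow>
      \<exists>S. G S \<and> E R S \<and> |S| \<le>o |R| \<and> \<Phi> t R S"
    and R0: "G R0" "infinite R0" "|R0| <o |K|"
    and T: "T \<noteq> {}" "|T| \<le>o |K|"
  shows "\<exists>A. G A \<and> E R0 A \<and>
    (\<forall>t\<in>T. \<forall>F. finite F \<longrightarrow> F \<subseteq> A \<longrightarrow> (\<exists>R S. F \<subseteq> R \<and> E R S \<and> E S A \<and> \<Phi> t R S))"
proof -
  have Kinf: "infinite K"
    using card_of_ordLeq_infinite[OF ordLess_imp_ordLeq[OF R0(3)] R0(2)] .
  \<comment> \<open>The cardinal order of \<open>K\<close> is used because each of its proper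
    initial segments is strictly smaller than \<open>K\<close>.\<close>
  define r where "r = |K|"
  have r: "Well_order r" "Field r = K" "Card_order r"
    unfolding r_def by (simp_all add: card_of_Well_order card_of_Card_order)
  have wf: "wf (r - Id)" using r(1) unfolding well_order_on_def by blast
  have under_lt: "|underS r i| <o |K|" if "i \<in> K" for i
    using card_of_underS[OF r(3)] that r(2) unfolding r_def by simp
  have tot: "i = j \<or> i \<in> underS r j \<or> j \<in> underS r i" if "i \<in> K" "j \<in> K" for i j
    using r(1,2) that unfolding well_order_on_def linear_order_on_def total_on_def underS_def by blast
  have under_trans: "underS r j \<subseteq> underS r i" if "j \<in> underS r i" for i j
    using r(1) that
    unfolding well_order_on_def linear_order_on_def partial_order_on_def preorder_on_def trans_def antisym_def underS_def
    by blast
  have under_K: "underS r i \<subseteq> K" for i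
    using r(2) unfolding underS_def Field_def by blast
  obtain k where k: "k ` K = T" using T(2) unfolding card_of_ordLeq2[OF T(1), symmetric] by blast
  \<comment> \<open>The first coordinate of \<open>g i\<close> names the task, the second only
    repeats it, so each task is assigned to \<open>|K|\<close> many stages.\<close>
  obtain g where g: "bij_betw g K (K \<times> K)"
    using ordIso_symmetric[OF card_of_Times_same_infinite[OF Kinf]] unfolding card_of_ordIso[symmetric] by blast
  define h where "h i = k (fst (g i))" for i
  have hT: "h i \<in> T" if "i \<in> K" for i
  proof -
    have "g i \<in> K \<times> K" using bij_betwE[OF g] that by blast
    then have "fst (g i) \<in> K" by (simp add: mem_Times_iff)
    then show ?thesis unfolding h_def using k by blast
  qed
  have cofinal: "\<exists>i\<in>K. h i = t \<and> j \<in> underS r i" if t: "t \<in> T" and j: "j \<in> K" for t j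
  proof (rule ccontr)
    assume n: "\<not> ?thesis"
    obtain a where a: "a \<in> K" "k a = t" using t k by blast
    \<comment> \<open>If task \<open>t\<close> were never scheduled after \<open>j\<close>, its
      \<open>|K|\<close> many stages would all fit into a set smaller than \<open>K\<close>.\<close>
    have "{a} \<times> K \<subseteq> g ` insert j (underS r j)"
    proof
      fix x assume x: "x \<in> {a} \<times> K"
      then have "x \<in> g ` K" using g a(1) unfolding bij_betw_def by auto
      then obtain i where i: "i \<in> K" "x = g i" by blast
      then have "h i = t" unfolding h_def using x a(2) by (metis SigmaE fst_conv singletonD)
      then have "j \<notin> underS r i" using n i(1) by blast
      then have "i = j \<or> i \<in> underS r j" using tot[OF i(1) j] by blast
      then show "x \<in> g ` insert j (underS r j)" using i(2) by blast
    qed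
    then have 1: "|{a} \<times> K| \<le>o |insert j (underS r j)|"
      by (rule ordLeq_transitive[OF card_of_mono1 card_of_image])
    have "|{j} \<union> underS r j| <o |K|"
      by (rule card_of_Un_ordLess_infinite[OF Kinf finite_ordLess_infinite2[OF _ Kinf] under_lt[OF j]]) simp
    then have "|{a} \<times> K| <o |K|" using ordLeq_ordLess_trans[OF 1] by simp
    moreover have "K = snd ` ({a} \<times> K)" by force
    then have "|K| \<le>o |{a} \<times> K|" using card_of_image[of snd "{a} \<times> K"] by (simp only:)
    ultimately show False using not_ordLess_ordLeq by blast
  qed
  define ch where "ch t U = (SOME S. G S \<and> E U S \<and> |S| \<le>o |U| \<and> \<Phi> t U S)" for t U
  define W where "W = wfrec (r - Id) (\<lambda>W i. ch (h i) (R0 \<union> \<Union> (W ` underS r i)))"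
  define U where "U i = R0 \<union> \<Union> (W ` underS r i)" for i
  have W_eq: "W i = ch (h i) (U i)" for i
  proof -
    have "cut W (r - Id) i ` underS r i = W ` underS r i"
      by (intro image_cong refl cut_apply) (auto simp: underS_def)
    moreover have "W i = ch (h i) (R0 \<union> \<Union> (cut W (r - Id) i ` underS r i))"
      unfolding W_def by (subst wfrec[OF wf]) simp
    ultimately show ?thesis unfolding U_def by simp
  qed
  \<comment> \<open>The bound by \<open>R0 <+> underS r i\<close> is chosen to survive limits: the
    union of the earlier rings, and one further step of no larger size, still obey it, and it stays
    below \<open>|K|\<close>.\<close>
  have inv: "i \<in> K \<longrightarrow> G (W i) \<and> E R0 (W i) \<and> (\<forall>j\<in>underS r i. E (W j) (W i)) \<and>
      |W i| \<le>o |R0 <+> underS r i| \<and> E (U i) (W i) \<and> \<Phi> (h i) (U i) (W i)" for i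
    using wf
  proof (induction i rule: wf_induct_rule)
    case (less i)
    show ?case
    proof
      assume i: "i \<in> K"
      have IH: "G (W j)" "E R0 (W j)" "\<And>l. l \<in> underS r j \<Longrightarrow> E (W l) (W j)" "|W j| \<le>o |R0 <+> underS r j|"
        if "j \<in> underS r i" for j
        using less[of j] that under_K unfolding underS_def by blast+
      let ?C = "insert R0 (W ` underS r i)"
      have "E R S \<or> E S R" if RS: "R \<in> ?C" "S \<in> ?C" for R S
      proof -
        consider "R = R0" | "S = R0" | j l where "R = W j" "S = W l" "j \<in> underS r i" "l \<in> underS r i"
          using RS by blast
        then show ?thesis
        proof cases
          case 3
          then show ?thesis using tot[of j l] under_K IH(3) E_refl by blast
        qed (use RS IH(2) E_refl in blast)+
      qed
      then have "G (\<Union>?C) \<and> (\<forall>R\<in>?C. E R (\<Union>?C))"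
        by (intro chain) (use R0(1) IH(1) in auto)
      moreover have "\<Union>?C = U i" unfolding U_def by auto
      ultimately have U: "G (U i)" "\<And>R. R \<in> ?C \<Longrightarrow> E R (U i)" by auto
      let ?B = "R0 <+> underS r i"
      have Binf: "infinite ?B" using R0(2) by simp
      have "|W j| \<le>o |?B|" if j: "j \<in> underS r i" for j
      proof -
        have "R0 <+> underS r j \<subseteq> ?B" using under_trans[OF j] by auto
        then show ?thesis using ordLeq_transitive[OF IH(4)[OF j] card_of_mono1] by blast
      qed
      then have "|\<Union>j\<in>underS r i. W j| \<le>o |?B|"
        by (intro card_of_UNION_ordLeq_infinite[OF Binf card_of_Plus2]) auto
      then have UB: "|U i| \<le>o |?B|"
        unfolding U_def
        by (intro card_of_Un_ordLeq_infinite_Field card_of_Plus1 card_of_Card_order)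
          (simp_all add: Field_card_of R0(2))
      also have "|?B| <o |K|"
        by (rule card_of_Plus_ordLess_infinite[OF Kinf R0(3) under_lt[OF i]])
      finally have "|U i| <o |K|" .
      then have "\<exists>S. G S \<and> E (U i) S \<and> |S| \<le>o |U i| \<and> \<Phi> (h i) (U i) S"
        using step[OF U(1) U(2) _ hT[OF i]] by blast
      then have W: "G (W i) \<and> E (U i) (W i) \<and> |W i| \<le>o |U i| \<and> \<Phi> (h i) (U i) (W i)"
        unfolding W_eq[of i] ch_def by (rule someI_ex)
      then have "|W i| \<le>o |?B|" using ordLeq_transitive[OF _ UB] by blast
      moreover have "\<forall>R\<in>?C. E R (W i)" using U(2) W E_trans by blast
      ultimately show "G (W i) \<and> E R0 (W i) \<and> (\<forall>j\<in>underS r i. E (W j) (W i)) \<and>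
          |W i| \<le>o |?B| \<and> E (U i) (W i) \<and> \<Phi> (h i) (U i) (W i)"
        using W by simp
    qed
  qed
  define C where "C = insert R0 (W ` K)"
  define A where "A = \<Union>C"
  have lin: "E R S \<or> E S R" if RS: "R \<in> C" "S \<in> C" for R S
  proof -
    consider "R = R0" | "S = R0" | j l where "R = W j" "S = W l" "j \<in> K" "l \<in> K"
      using RS unfolding C_def by blast
    then show ?thesis
    proof cases
      case 3
      then show ?thesis using tot[of j l] inv E_refl by blast
    next
      case 1
      then show ?thesis using RS(2) inv E_refl unfolding C_def by blast
    next
      case 2
      then show ?thesis using RS(1) inv E_refl unfolding C_def by blast
    qed
  qed
  have "G A \<and> (\<forall>R\<in>C. E R A)"
    unfolding A_def by (rule chain) (use lin inv R0(1) in \<open>auto simp: C_def\<close>)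
  then have A: "G A" "\<And>R. R \<in> C \<Longrightarrow> E R A" by auto
  have "\<exists>R S. F \<subseteq> R \<and> E R S \<and> E S A \<and> \<Phi> t R S" if t: "t \<in> T" and F: "finite F" "F \<subseteq> A" for t F
  proof -
    have "subset.chain UNIV C"
      unfolding subset.chain_def using lin E_sub by blast
    then obtain R where R: "R \<in> C" "F \<subseteq> R"
      using finite_subset_Union_chain[OF F(1)] F(2) unfolding A_def C_def by blast
    obtain i where i: "i \<in> K" "h i = t" "R \<subseteq> U i"
    proof (cases "R = R0")
      case True
      obtain j where "j \<in> K" using Kinf by (metis ex_in_conv finite.emptyI)
      then obtain i where "i \<in> K" "h i = t" using cofinal[OF t] by blast
      then show ?thesis using that[of i] True unfolding U_def by blast
    next
      case False
      then obtain j where j: "j \<in> K" "R = W j" using R(1) unfolding C_def by blast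
      obtain i where "i \<in> K" "h i = t" "j \<in> underS r i" using cofinal[OF t j(1)] by blast
      then show ?thesis using that[of i] j(2) unfolding U_def by blast
    qed
    have "E (U i) (W i)" "\<Phi> t (U i) (W i)" using inv[of i] i by auto
    moreover have "E (W i) A" using A(2) i(1) unfolding C_def by blast
    ultimately show ?thesis using R(2) i(3) by (intro exI[of _ "U i"] exI[of _ "W i"]) auto
  qed
  moreover have "E R0 A" using A(2) unfolding C_def by blast
  ultimately show ?thesis using A(1) by blast
qed

context local_noetherian_domain
begin

text \<open>An atom of the union is an atom of each member containing it, as fewer factorizations
  are available there; goodness makes it a strong prime of that member and \<open>extends\<close>
  carries this to all larger members.\<close>

lemma good_chain_Union:
  assumes ne: "C \<noteq> {}" and good: "\<And>R. R \<in> C \<Longrightarrow> good R"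
    and lin: "\<And>R S. R \<in> C \<Longrightarrow> S \<in> C \<Longrightarrow> extends R S \<or> extends S R"
  shows "good (\<Union>C) \<and> (\<forall>R\<in>C. extends R (\<Union>C))"
proof -
  have common: "\<exists>R\<in>C. a \<in> R \<and> b \<in> R" if ab: "a \<in> \<Union>C" "b \<in> \<Union>C" for a b
  proof -
    obtain R S where "R \<in> C" "a \<in> R" "S \<in> C" "b \<in> S" using ab by blast
    then show ?thesis using lin[of R S] unfolding extends_def by blast
  qed
  have RE: "subring R B" if "R \<in> C" for R using goodD(2)[OF good[OF that]] .
  have sub: "subring (\<Union>C) B"
  proof (rule subringI)
    show "\<Union>C \<subseteq> carrier B" using subringE(1)[OF RE] by blast
    show "\<one> \<in> \<Union>C" using ne subringE(3)[OF RE] by blast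
    show "\<ominus> a \<in> \<Union>C" if "a \<in> \<Union>C" for a using that subringE(5)[OF RE] by blast
    fix a b assume ab: "a \<in> \<Union>C" "b \<in> \<Union>C"
    obtain R where R: "R \<in> C" "a \<in> R" "b \<in> R" using common[OF ab] by blast
    show "a \<otimes> b \<in> \<Union>C" using subringE(6)[OF RE[OF R(1)] R(2,3)] R(1) by blast
    show "a \<oplus> b \<in> \<Union>C" using subringE(7)[OF RE[OF R(1)] R(2,3)] R(1) by blast
  qed
  have prime: "strong_prime (\<Union>C) p" if R: "R \<in> C" "strong_prime R p" for R p
  proof -
    have "p divides r \<or> regular r p" if S: "S \<in> C" "r \<in> S" for S r
    proof -
      consider "strong_prime S p" | "S \<subseteq> R" using lin[OF R(1) S(1)] R(2) unfolding extends_def by blast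
      then show ?thesis
        by cases (use strong_primeD(5) R(2) S(2) in blast)+
    qed
    then show ?thesis using strong_primeD(1-3)[OF R(2)] R(1) unfolding strong_prime_def by blast
  qed
  have "frac_closed (\<Union>C)"
    unfolding frac_closed_def
  proof (intro conjI ballI impI sub)
    fix g b assume g: "g \<in> \<Union>C" "b \<in> carrier B" "g \<noteq> \<zero>" "g \<otimes> b \<in> \<Union>C"
    obtain R where R: "R \<in> C" "g \<in> R" "g \<otimes> b \<in> R" using common[OF g(1,4)] by blast
    then have "b \<in> R" using frac_closedD(3)[OF goodD(1)[OF good[OF R(1)]] R(2) g(2,3)] by blast
    then show "b \<in> \<Union>C" using R(1) by blast
  qed
  moreover have "strong_prime (\<Union>C) p" if p: "atom (\<Union>C) p" for p
  proof -
    obtain R where R: "R \<in> C" "p \<in> R" using p unfolding atom_def by blast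
    then have "atom R p" using p unfolding atom_def by blast
    then show ?thesis using prime[OF R(1)] goodD(4)[OF good[OF R(1)]] by blast
  qed
  ultimately have "good (\<Union>C)" unfolding good_def by blast
  moreover have "\<forall>R\<in>C. extends R (\<Union>C)" unfolding extends_def using prime by blast
  ultimately show ?thesis by blast
qed

theorem exists_saturated_extension:
  assumes R0: "good R0" "infinite R0" "|R0| <o |carrier (B Quot M)|"
    and card: "|carrier B| \<le>o |carrier (B Quot M)|"
  shows "\<exists>A. good A \<and> extends R0 A \<and>
    (\<forall>J b. dense J \<longrightarrow> b \<in> carrier B \<longrightarrow> (\<exists>t\<in>J. b \<oplus> t \<in> A)) \<and>
    (\<forall>y1\<in>A. \<forall>y2\<in>A. \<forall>c\<in>A. y1 \<noteq> \<zero> \<longrightarrow> y2 \<noteq> \<zero> \<longrightarrow> regular y1 y2 \<longrightarrow>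
      (\<exists>b1\<in>carrier B. \<exists>b2\<in>carrier B. c = y1 \<otimes> b1 \<oplus> y2 \<otimes> b2) \<longrightarrow>
      (\<exists>x1\<in>A. \<exists>x2\<in>A. c = y1 \<otimes> x1 \<oplus> y2 \<otimes> x2))"
proof -
  \<comment> \<open>One coding for both kinds of tasks: \<open>ys\<close> serves as generators of an
    ideal, which reaches all ideals of the Noetherian ring \<open>B\<close>, and when it has length
    two also as the pair \<open>y1, y2\<close>. There are at most \<open>|B|\<close> such
    tasks.\<close>
  let ?T = "lists (carrier B) \<times> carrier B"
  let ?D = "\<lambda>(ys, c) S. dense (Idl (set ys)) \<longrightarrow> (\<exists>t\<in>Idl (set ys). c \<oplus> t \<in> S)"
  let ?P = "\<lambda>(ys, c) R S. \<forall>y1 y2. ys = [y1, y2] \<longrightarrow> y1 \<in> R \<longrightarrow> y2 \<in> R \<longrightarrow> c \<in> R \<longrightarrow> y1 \<noteq> \<zero> \<longrightarrow> y2 \<noteq> \<zero> \<longrightarrow>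
    regular y1 y2 \<longrightarrow> (\<exists>b1\<in>carrier B. \<exists>b2\<in>carrier B. c = y1 \<otimes> b1 \<oplus> y2 \<otimes> b2) \<longrightarrow>
      (\<exists>x1\<in>S. \<exists>x2\<in>S. c = y1 \<otimes> x1 \<oplus> y2 \<otimes> x2)"
  have Binf: "infinite (carrier B)"
    using R0(2) goodD(3)[OF R0(1)] finite_subset by blast
  have "|?T| \<le>o |carrier B|"
    by (rule card_of_Sigma_ordLeq_infinite[OF Binf card_of_lists_infinite_le[OF Binf]]) auto
  then have T: "|?T| \<le>o |carrier (B Quot M)|" by (rule ordLeq_transitive[OF _ card])
  have step: "\<exists>S. good S \<and> extends R S \<and> |S| \<le>o |R| \<and> (?D t S \<and> ?P t R S)"
    if R: "good R" "extends R0 R" "|R| <o |carrier (B Quot M)|" and t: "t \<in> ?T" for R t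
  proof -
    obtain ys c where t': "t = (ys, c)" "set ys \<subseteq> carrier B" "c \<in> carrier B" using t by auto
    have Rinf: "infinite R" using R0(2) R(2) infinite_super unfolding extends_def by blast
    have "\<exists>S. good S \<and> extends R S \<and> |S| \<le>o |R| \<and> ?D t S"
    proof (cases "dense (Idl (set ys))")
      case True
      then show ?thesis using dense_step[OF R(1) Rinf R(3) True t'(3)] t'(1) by auto
    next
      case False
      then show ?thesis using t'(1) R(1) extends_refl ordLeq_refl[OF card_of_Card_order] by auto
    qed
    then obtain S where S: "good S" "extends R S" "|S| \<le>o |R|" "?D t S" by blast
    have Sinf: "infinite S" using Rinf S(2) infinite_super unfolding extends_def by blast
    have SK: "|S| <o |carrier (B Quot M)|" by (rule ordLeq_ordLess_trans[OF S(3) R(3)])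
    have RS: "R \<subseteq> S" using S(2) unfolding extends_def by blast
    show ?thesis
    proof (cases "\<exists>y1 y2 b1 b2. ys = [y1, y2] \<and> y1 \<in> R \<and> y2 \<in> R \<and> c \<in> R \<and> y1 \<noteq> \<zero> \<and> y2 \<noteq> \<zero> \<and>
        regular y1 y2 \<and> b1 \<in> carrier B \<and> b2 \<in> carrier B \<and> c = y1 \<otimes> b1 \<oplus> y2 \<otimes> b2")
      case False
      then have "?P t R S" unfolding t'(1) prod.case by blast
      then show ?thesis using S by blast
    next
      case True
      then obtain y1 y2 b1 b2 where y: "ys = [y1, y2]" "y1 \<in> R" "y2 \<in> R" "c \<in> R" "y1 \<noteq> \<zero>" "y2 \<noteq> \<zero>"
        "regular y1 y2" "b1 \<in> carrier B" "b2 \<in> carrier B" "c = y1 \<otimes> b1 \<oplus> y2 \<otimes> b2" by blast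
      obtain S' where S': "good S'" "extends S S'" "|S'| \<le>o |S|" "\<exists>x1\<in>S'. \<exists>x2\<in>S'. c = y1 \<otimes> x1 \<oplus> y2 \<otimes> x2"
        using pair_step[OF S(1) Sinf SK subsetD[OF RS y(2)] y(5) subsetD[OF RS y(3)] y(6,7)
            subsetD[OF RS y(4)] y(8-10)] by blast
      have "?P t R S'" using t'(1) y(1) S'(4) by auto
      moreover have "?D t S'" using S(4) S'(2) t'(1) unfolding extends_def by auto
      ultimately show ?thesis
        using S' extends_trans[OF S(2) S'(2)] ordLeq_transitive[OF S'(3) S(3)] by blast
    qed
  qed
  have "\<exists>A. good A \<and> extends R0 A \<and>
    (\<forall>t\<in>?T. \<forall>F. finite F \<longrightarrow> F \<subseteq> A \<longrightarrow> (\<exists>R S. F \<subseteq> R \<and> extends R S \<and> extends S A \<and> (?D t S \<and> ?P t R S)))"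
    by (rule transfinite_closure[of extends good R0 "carrier (B Quot M)" ?T "\<lambda>t R S. ?D t S \<and> ?P t R S",
          OF extends_refl extends_trans _ good_chain_Union step R0 _ T])
      (auto simp: extends_def)
  then obtain A where A: "good A" "extends R0 A"
    and tasks: "\<forall>t\<in>?T. \<forall>F. finite F \<longrightarrow> F \<subseteq> A \<longrightarrow>
      (\<exists>R S. F \<subseteq> R \<and> extends R S \<and> extends S A \<and> (?D t S \<and> ?P t R S))"
    by (elim exE conjE)
  have "\<exists>t\<in>J. b \<oplus> t \<in> A" if J: "dense J" and b: "b \<in> carrier B" for J b
  proof -
    have "ideal J B" using J unfolding dense_def by blast
    then obtain F where F: "F \<subseteq> carrier B" "finite F" "J = Idl F" using finetely_gen by blast
    obtain ys where ys: "set ys = F" using finite_list[OF F(2)] by blast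
    have "(ys, b) \<in> ?T" using ys F(1) b by auto
    from tasks[rule_format, OF this, of "{}"] obtain S where "extends S A" "?D (ys, b) S" by auto
    then show ?thesis using J F(3) ys unfolding extends_def by auto
  qed
  moreover have "\<exists>x1\<in>A. \<exists>x2\<in>A. c = y1 \<otimes> x1 \<oplus> y2 \<otimes> x2"
    if y: "y1 \<in> A" "y2 \<in> A" "c \<in> A" "y1 \<noteq> \<zero>" "y2 \<noteq> \<zero>" "regular y1 y2"
      "\<exists>b1\<in>carrier B. \<exists>b2\<in>carrier B. c = y1 \<otimes> b1 \<oplus> y2 \<otimes> b2" for y1 y2 c
  proof -
    have "([y1, y2], c) \<in> ?T" using y(1-3) goodD(3)[OF A(1)] by auto
    from tasks[rule_format, OF this, of "{y1, y2, c}"] obtain R S where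
      RS: "{y1, y2, c} \<subseteq> R" "extends S A" "?P ([y1, y2], c) R S" using y(1-3) by auto
    have "\<exists>x1\<in>S. \<exists>x2\<in>S. c = y1 \<otimes> x1 \<oplus> y2 \<otimes> x2" using RS(1,3) y(4-7) by simp
    then show ?thesis using RS(2) unfolding extends_def by blast
  qed
  ultimately show ?thesis using A by blast
qed


subsection \<open>Contraction of ideals to saturated subrings\<close>

definition saturated :: "'b set \<Rightarrow> bool" where
  "saturated A \<longleftrightarrow> good A \<and>
    (\<forall>J b. dense J \<longrightarrow> b \<in> carrier B \<longrightarrow> (\<exists>t\<in>J. b \<oplus> t \<in> A)) \<and>
    (\<forall>y1\<in>A. \<forall>y2\<in>A. \<forall>c\<in>A. y1 \<noteq> \<zero> \<longrightarrow> y2 \<noteq> \<zero> \<longrightarrow> regular y1 y2 \<longrightarrow>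
      (\<exists>b1\<in>carrier B. \<exists>b2\<in>carrier B. c = y1 \<otimes> b1 \<oplus> y2 \<otimes> b2) \<longrightarrow>
      (\<exists>x1\<in>A. \<exists>x2\<in>A. c = y1 \<otimes> x1 \<oplus> y2 \<otimes> x2))"

lemma saturatedD:
  assumes "saturated A"
  shows "good A" "frac_closed A" "subring A B" "A \<subseteq> carrier B"
    and "dense J \<Longrightarrow> b \<in> carrier B \<Longrightarrow> \<exists>t\<in>J. b \<oplus> t \<in> A"
    and "y1 \<in> A \<Longrightarrow> y2 \<in> A \<Longrightarrow> c \<in> A \<Longrightarrow> y1 \<noteq> \<zero> \<Longrightarrow> y2 \<noteq> \<zero> \<Longrightarrow> regular y1 y2 \<Longrightarrow>
      b1 \<in> carrier B \<Longrightarrow> b2 \<in> carrier B \<Longrightarrow> c = y1 \<otimes> b1 \<oplus> y2 \<otimes> b2 \<Longrightarrow>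
      \<exists>x1\<in>A. \<exists>x2\<in>A. c = y1 \<otimes> x1 \<oplus> y2 \<otimes> x2"
proof -
  show g: "good A" using assms unfolding saturated_def by blast
  show "frac_closed A" "subring A B" "A \<subseteq> carrier B" using goodD[OF g] by blast+
qed (use assms[unfolded saturated_def] in blast)+

lemma pair_ideal:
  assumes z: "z1 \<in> carrier B" "z2 \<in> carrier B"
  shows "ideal {s \<otimes> z1 \<oplus> t \<otimes> z2 | s t. s \<in> carrier B \<and> t \<in> carrier B} B"
proof -
  note P = ideal_plus_PIdl(1,4)[OF cgenideal_ideal[OF z(1)] z(2)]
  have "x \<in> {s \<otimes> z1 \<oplus> t \<otimes> z2 | s t. s \<in> carrier B \<and> t \<in> carrier B} \<longleftrightarrow> x \<in> PIdl z1 <+>\<^bsub>B\<^esub> PIdl z2" for x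
    unfolding P(2) using mem_PIdl_iff[of _ z1] by (auto, metis)
  then have "{s \<otimes> z1 \<oplus> t \<otimes> z2 | s t. s \<in> carrier B \<and> t \<in> carrier B} = PIdl z1 <+>\<^bsub>B\<^esub> PIdl z2" by blast
  then show ?thesis using P(1) by simp
qed

text \<open>If \<open>z1 c = b e\<close> and \<open>z2 c = b f\<close>, then
  \<open>z1 f = z2 e\<close>, so regularity gives \<open>f = z2 g\<close> and finally
  \<open>c = b g\<close>. No nonzero class modulo \<open>b\<close> is therefore annihilated by both
  elements.\<close>

lemma dense_pair:
  assumes z: "z1 \<in> carrier B" "z2 \<in> carrier B" "z2 \<noteq> \<zero>" and reg: "regular z1 z2"
  shows "dense {s \<otimes> z1 \<oplus> t \<otimes> z2 | s t. s \<in> carrier B \<and> t \<in> carrier B}" (is "dense ?J")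
  unfolding dense_def
proof (intro conjI ballI notI)
  show "ideal ?J B" by (rule pair_ideal[OF z(1,2)])
  fix b q assume b: "b \<in> carrier B" and q: "q \<in> Ass_quot B b" and sub: "?J \<subseteq> q"
  have "z1 = \<one> \<otimes> z1 \<oplus> \<zero> \<otimes> z2" "z2 = \<zero> \<otimes> z1 \<oplus> \<one> \<otimes> z2" using z by simp_all
  then have zq: "z1 \<in> q" "z2 \<in> q" using sub by blast+
  obtain c where c: "primeideal q B" "c \<in> carrier B" "q = {x \<in> carrier B. x \<otimes> c \<in> PIdl b}"
    using q unfolding Ass_quot_def by blast
  have "z1 \<otimes> c \<in> PIdl b" "z2 \<otimes> c \<in> PIdl b" using zq unfolding c(3) by auto
  then have "b divides (z1 \<otimes> c)" "b divides (z2 \<otimes> c)" unfolding mem_PIdl_iff_divides[OF b] .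
  then obtain e f where e: "e \<in> carrier B" "z1 \<otimes> c = b \<otimes> e" "f \<in> carrier B" "z2 \<otimes> c = b \<otimes> f"
    unfolding factor_def by blast
  have "b divides c"
  proof (cases "b = \<zero>")
    case True
    then have "c = \<zero>" using e(3,4) z(2,3) c(2) integral_iff by simp
    then show ?thesis using b by (simp add: divides_zero)
  next
    case False
    have "b \<otimes> (z1 \<otimes> f) = z1 \<otimes> (z2 \<otimes> c)" unfolding e(4) using z(1) b e(3) by algebra
    also have "\<dots> = z2 \<otimes> (z1 \<otimes> c)" using z(1,2) c(2) by algebra
    also have "\<dots> = b \<otimes> (z2 \<otimes> e)" unfolding e(2) using z(2) b e(1) by algebra
    finally have "z1 \<otimes> f = z2 \<otimes> e" using m_lcancel[OF False b] z(1,2) e(1,3) by simp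
    then have "z2 divides (z1 \<otimes> f)" unfolding factor_def using e(1) by blast
    then have "z2 divides f" by (rule regularD[OF reg e(3)])
    then obtain g where g: "g \<in> carrier B" "f = z2 \<otimes> g" unfolding factor_def by blast
    have "z2 \<otimes> c = z2 \<otimes> (b \<otimes> g)" unfolding e(4) g(2) using z(2) b g(1) by algebra
    then have "c = b \<otimes> g" using m_lcancel[OF z(3,2)] c(2) b g(1) by simp
    then show ?thesis unfolding factor_def using g(1) by blast
  qed
  then have "\<one> \<otimes> c \<in> PIdl b" using mem_PIdl_iff_divides[OF b] c(2) by simp
  then have "\<one> \<in> q" unfolding c(3) by simp
  then show False
    using ideal.one_imp_carrier[OF primeideal.axioms(1)[OF c(1)]] primeideal.I_notcarr[OF c(1)] by simp
qed

section \<open>Coprime elements of good subrings\<close>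

lemma strong_prime_divides_iff:
  assumes A: "good A" and p: "strong_prime A p" and q: "strong_prime A q" and qp: "q divides p"
  shows "p divides q"
proof -
  note pD = strong_primeD[OF p] and qD = strong_primeD[OF q] and AD = goodD[OF A]
  obtain u where u: "u \<in> A" "p = q \<otimes> u"
    using frac_closed_divides[OF AD(1) qD(1,3) pD(1) qp] .
  have "u \<notin> M" using strong_prime_imp_atom[OF p AD(3)] qD(1,2) u unfolding atom_def by blast
  then have uU: "u \<in> Units B" using Units_iff u(1) AD(3) by blast
  then have "q = p \<otimes> inv u" using u(2) qD(4) Units_closed[OF uU] by (simp add: m_assoc)
  then show ?thesis unfolding factor_def using uU by blast
qed

text \<open>Coprimality inside \<open>A\<close> becomes visible in \<open>B\<close>: by torsion
  freeness \<open>w\<close> is regular modulo each prime factor of \<open>z\<close>, and regularity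
  modulo the factors accumulates along the factorization.\<close>

lemma regular_of_no_common_prime:
  assumes A: "good A" and z: "z \<in> A" "z \<noteq> \<zero>" and w: "w \<in> A"
    and cop: "\<And>p. strong_prime A p \<Longrightarrow> p divides z \<Longrightarrow> \<not> p divides w"
  shows "regular w z"
proof -
  have "(\<forall>p. strong_prime A p \<longrightarrow> p divides z \<longrightarrow> \<not> p divides w) \<longrightarrow> regular w z"
    using A z
  proof (induction rule: good_induct)
    case (unit u)
    then have u: "u \<in> Units B" "u \<in> carrier B" using Units_iff goodD(3)[OF A] by blast+
    have "u divides x" if "x \<in> carrier B" for x
    proof -
      have "x = u \<otimes> (inv u \<otimes> x)" using u that by (simp add: m_assoc[symmetric])
      then show ?thesis unfolding factor_def using u(1) that by blast
    qed
    then show ?case unfolding regular_def by blast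
  next
    case (mult p r)
    note pD = strong_primeD[OF mult(1)]
    have c: "r \<in> carrier B" "w \<in> carrier B" using mult(2) w goodD(3)[OF A] by auto
    show ?case
    proof
      assume cop: "\<forall>q. strong_prime A q \<longrightarrow> q divides (p \<otimes> r) \<longrightarrow> \<not> q divides w"
      have "p divides (p \<otimes> r)" unfolding factor_def using c by blast
      then have wp: "regular w p" using cop mult(1) pD(5)[OF w] by blast
      have "\<forall>q. strong_prime A q \<longrightarrow> q divides r \<longrightarrow> \<not> q divides w"
        using cop divides_mult_left[OF _ _ pD(4)] strong_primeD(4) by blast
      then have wr: "regular w r" using mult(4) by blast
      show "regular w (p \<otimes> r)"
        unfolding regular_def
      proof (intro ballI impI)
        fix x assume x: "x \<in> carrier B" "(p \<otimes> r) divides (w \<otimes> x)"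
        then obtain e where e: "e \<in> carrier B" "w \<otimes> x = (p \<otimes> r) \<otimes> e" unfolding factor_def by blast
        have e': "w \<otimes> x = p \<otimes> (r \<otimes> e)" using e pD(4) c(1) by (simp add: m_assoc)
        then have "p divides (w \<otimes> x)" unfolding factor_def using c(1) e(1) by blast
        then have "p divides x" by (rule regularD[OF wp x(1)])
        then obtain y where y: "y \<in> carrier B" "x = p \<otimes> y" unfolding factor_def by blast
        have "p \<otimes> (w \<otimes> y) = p \<otimes> (r \<otimes> e)" unfolding e'[symmetric] y(2) using c(2) pD(4) y(1) by algebra
        then have "w \<otimes> y = r \<otimes> e" using m_lcancel[OF pD(3,4)] c y(1) e(1) by simp
        then have "r divides (w \<otimes> y)" unfolding factor_def using e(1) by blast
        then have "r divides y" by (rule regularD[OF wr y(1)])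
        then show "(p \<otimes> r) divides x" unfolding y(2) using divides_cancel[OF pD(3,4) c(1) y(1)] by blast
      qed
    qed
  qed
  then show ?thesis using cop by blast
qed

lemma nat_scalar_in_subring: "subring A B \<Longrightarrow> [(n::nat)] \<cdot> \<one> \<in> A"
  by (induction n) (simp_all add: subringE(2,3,7)[of A B])

lemma nat_diff_unit:
  assumes "contains_rationals B" "m < (n::nat)"
  shows "[n] \<cdot> \<one> \<ominus> [m] \<cdot> \<one> \<in> Units B"
proof -
  have "[n] \<cdot> \<one> = [m] \<cdot> \<one> \<oplus> [(n - m)] \<cdot> \<one>"
    using add.nat_pow_mult[of \<one> m "n - m"] assms(2) by simp
  then have "[n] \<cdot> \<one> \<ominus> [m] \<cdot> \<one> = [(n - m)] \<cdot> \<one>"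
    using add.nat_pow_closed[of \<one> m] add.nat_pow_closed[of \<one> "n - m"] by algebra
  then show ?thesis using assms unfolding contains_rationals_def by simp
qed

text \<open>Distinct integers differ by a unit of \<open>B\<close>, so two memberships give
  \<open>z3\<close> in \<open>I\<close> by subtraction, and then \<open>z2\<close> in
  \<open>I\<close>. It is applied to the ideal of a prime and to the zero ideal.\<close>

lemma affine_multiple_unique:
  assumes rat: "contains_rationals B" and z: "z2 \<in> carrier B" "z3 \<in> carrier B"
    and I: "ideal I B" and notboth: "\<not> (z2 \<in> I \<and> z3 \<in> I)"
    and mn: "z2 \<oplus> [(m::nat)] \<cdot> \<one> \<otimes> z3 \<in> I" "z2 \<oplus> [(n::nat)] \<cdot> \<one> \<otimes> z3 \<in> I"
  shows "m = n"
proof (rule ccontr)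
  interpret I: ideal I B by fact
  assume "m \<noteq> n"
  have *: False if "m < n" "z2 \<oplus> [m] \<cdot> \<one> \<otimes> z3 \<in> I" "z2 \<oplus> [n] \<cdot> \<one> \<otimes> z3 \<in> I" for m n :: nat
  proof -
    define a where "a = [m] \<cdot> \<one>"
    define d where "d = [n] \<cdot> \<one>"
    have c: "a \<in> carrier B" "d \<in> carrier B" unfolding a_def d_def by simp_all
    have U: "d \<ominus> a \<in> Units B" unfolding a_def d_def using nat_diff_unit[OF rat that(1)] .
    have "(z2 \<oplus> d \<otimes> z3) \<oplus> \<ominus> (z2 \<oplus> a \<otimes> z3) \<in> I"
      using I.a_closed[OF that(3) I.a_inv_closed[OF that(2)]] unfolding a_def d_def .
    moreover have "(z2 \<oplus> d \<otimes> z3) \<oplus> \<ominus> (z2 \<oplus> a \<otimes> z3) = (d \<ominus> a) \<otimes> z3" using c z by algebra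
    ultimately have "(d \<ominus> a) \<otimes> z3 \<in> I" by simp
    then have "inv (d \<ominus> a) \<otimes> ((d \<ominus> a) \<otimes> z3) \<in> I" using I.I_l_closed U by simp
    moreover have "inv (d \<ominus> a) \<otimes> ((d \<ominus> a) \<otimes> z3) = (inv (d \<ominus> a) \<otimes> (d \<ominus> a)) \<otimes> z3"
      using U z(2) c by (simp only: m_assoc Units_closed Units_inv_closed)
    ultimately have z3: "z3 \<in> I" using U z(2) by simp
    have "(z2 \<oplus> a \<otimes> z3) \<oplus> \<ominus> (a \<otimes> z3) \<in> I"
      using I.a_closed[OF that(2)] I.a_inv_closed[OF I.I_l_closed[OF z3 c(1)]] unfolding a_def by blast
    moreover have "(z2 \<oplus> a \<otimes> z3) \<oplus> \<ominus> (a \<otimes> z3) = z2" using c z by algebra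
    ultimately show False using z3 notboth by simp
  qed
  show False using *[of m n] *[of n m] mn \<open>m \<noteq> n\<close> by (meson linorder_neqE_nat)
qed

text \<open>By \<open>affine_multiple_unique\<close> each prime factor of \<open>z1\<close> spoils
  at most one \<open>n\<close>, and \<open>z1\<close> has finitely many prime factors up to
  associates.\<close>

lemma finite_common_prime_multiples:
  assumes rat: "contains_rationals B" and A: "good A" and z: "z1 \<in> A" "z1 \<noteq> \<zero>" "z2 \<in> A" "z3 \<in> A"
    and cop: "\<And>p. strong_prime A p \<Longrightarrow> \<not> (p divides z1 \<and> p divides z2 \<and> p divides z3)"
  shows "finite {n::nat. \<exists>p. strong_prime A p \<and> p divides z1 \<and> p divides (z2 \<oplus> [n] \<cdot> \<one> \<otimes> z3)}"
proof -
  have c: "z2 \<in> carrier B" "z3 \<in> carrier B" using z goodD(3)[OF A] by auto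
  let ?N = "\<lambda>z1. {n::nat. \<exists>p. strong_prime A p \<and> p divides z1 \<and> p divides (z2 \<oplus> [n] \<cdot> \<one> \<otimes> z3)}"
  have "(\<forall>p. strong_prime A p \<longrightarrow> \<not> (p divides z1 \<and> p divides z2 \<and> p divides z3)) \<longrightarrow> finite (?N z1)"
    using A z(1,2)
  proof (induction rule: good_induct)
    case (unit u)
    have u: "u \<in> Units B" "u \<in> carrier B" using unit Units_iff goodD(3)[OF A] by blast+
    have "\<not> p divides u" if "strong_prime A p" for p
      using regular_not_divides[OF regular_unit[OF u(1)] u(2)] strong_primeD(2,4)[OF that] by blast
    then have "?N u = {}" by blast
    then show ?case by (simp only: finite.emptyI simp_thms)
  next
    case (mult p r)
    note pD = strong_primeD[OF mult(1)]
    have rc: "r \<in> carrier B" using mult(2) goodD(3)[OF A] by auto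
    show ?case
    proof
      assume cop: "\<forall>q. strong_prime A q \<longrightarrow> \<not> (q divides (p \<otimes> r) \<and> q divides z2 \<and> q divides z3)"
      have up: "q divides (p \<otimes> r)" if "q divides r" "strong_prime A q" for q
        using divides_mult_left[OF that(1) strong_primeD(4)[OF that(2)] pD(4)] .
      have fin: "finite (?N r)" using mult(4) cop up by blast
      have "p divides (p \<otimes> r)" unfolding factor_def using rc by blast
      then have np: "\<not> (p divides z2 \<and> p divides z3)" using cop mult(1) by blast
      let ?S = "{n::nat. p divides (z2 \<oplus> [n] \<cdot> \<one> \<otimes> z3)}"
      have "m = n" if "m \<in> ?S" "n \<in> ?S" for m n
        by (rule affine_multiple_unique[OF rat c cgenideal_ideal[OF pD(4)]])
          (use that np mem_PIdl_iff_divides[OF pD(4)] in auto)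
      then have "finite ?S" by (metis (no_types, lifting) finite.simps is_singletonI' is_singleton_the_elem)
      moreover have "?N (p \<otimes> r) \<subseteq> ?S \<union> ?N r"
      proof
        fix n assume "n \<in> ?N (p \<otimes> r)"
        then obtain q where q: "strong_prime A q" "q divides (p \<otimes> r)" "q divides (z2 \<oplus> [n] \<cdot> \<one> \<otimes> z3)" by blast
        note qD = strong_primeD[OF q(1)]
        consider "q divides p" | "q divides r"
          using qD(5)[OF pD(1)] regularD[OF _ rc q(2)] by blast
        then show "n \<in> ?S \<union> ?N r"
        proof cases
          case 1
          have "p divides q" by (rule strong_prime_divides_iff[OF A mult(1) q(1) 1])
          then show ?thesis using q(3) divides_trans[OF _ q(3) pD(4)] by blast
        next
          case 2 then show ?thesis using q by blast
        qed
      qed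
      ultimately show "finite (?N (p \<otimes> r))" using fin finite_subset by blast
    qed
  qed
  then show ?thesis using cop by blast
qed

lemma common_divisor_strip:
  assumes A: "good A" and y: "y1 \<in> A" "y1 \<noteq> \<zero>" "y2 \<in> A" "y3 \<in> A"
  shows "\<exists>g\<in>A. \<exists>z1\<in>A. \<exists>z2\<in>A. \<exists>z3\<in>A. g \<noteq> \<zero> \<and> y1 = g \<otimes> z1 \<and> y2 = g \<otimes> z2 \<and> y3 = g \<otimes> z3 \<and>
    (\<forall>p. strong_prime A p \<longrightarrow> \<not> (p divides z1 \<and> p divides z2 \<and> p divides z3))"
proof -
  note AD = goodD[OF A]
  note AE = subringE[OF AD(2)]
  let ?P = "\<lambda>y1 y2 y3. \<exists>g\<in>A. \<exists>z1\<in>A. \<exists>z2\<in>A. \<exists>z3\<in>A. g \<noteq> \<zero> \<and> y1 = g \<otimes> z1 \<and> y2 = g \<otimes> z2 \<and> y3 = g \<otimes> z3 \<and>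
    (\<forall>p. strong_prime A p \<longrightarrow> \<not> (p divides z1 \<and> p divides z2 \<and> p divides z3))"
  have "y1 \<in> carrier B" using y AD(3) by blast
  then have "\<forall>y2\<in>A. \<forall>y3\<in>A. y1 \<in> A \<longrightarrow> ?P y1 y2 y3"
    using y(2)
  proof (induction rule: divisor_induct)
    case (step y1)
    show ?case
    proof (intro ballI impI)
      fix y2 y3 assume y: "y2 \<in> A" "y3 \<in> A" "y1 \<in> A"
      have yc: "y2 \<in> carrier B" "y3 \<in> carrier B" using y AD(3) by auto
      show "?P y1 y2 y3"
      proof (cases "\<exists>p. strong_prime A p \<and> p divides y1 \<and> p divides y2 \<and> p divides y3")
        case False
        have "y1 = \<one> \<otimes> y1" "y2 = \<one> \<otimes> y2" "y3 = \<one> \<otimes> y3" using step(1) yc by simp_all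
        then show ?thesis using False y AE(3) one_not_zero by blast
      next
        case True
        then obtain p where p: "strong_prime A p" "p divides y1" "p divides y2" "p divides y3" by blast
        note pD = strong_primeD[OF p(1)]
        obtain w1 where w1: "w1 \<in> A" "y1 = p \<otimes> w1" using frac_closed_divides[OF AD(1) pD(1,3) y(3) p(2)] .
        obtain w2 where w2: "w2 \<in> A" "y2 = p \<otimes> w2" using frac_closed_divides[OF AD(1) pD(1,3) y(1) p(3)] .
        obtain w3 where w3: "w3 \<in> A" "y3 = p \<otimes> w3" using frac_closed_divides[OF AD(1) pD(1,3) y(2) p(4)] .
        have "w1 \<in> carrier B" using w1 AD(3) by blast
        from step(3)[OF this pD(2) w1(2)] have "?P w1 w2 w3" using w1(1) w2(1) w3(1) by blast
        then obtain g z1 z2 z3 where g: "g \<in> A" "z1 \<in> A" "z2 \<in> A" "z3 \<in> A" "g \<noteq> \<zero>" "w1 = g \<otimes> z1" "w2 = g \<otimes> z2"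
          "w3 = g \<otimes> z3" "\<forall>p. strong_prime A p \<longrightarrow> \<not> (p divides z1 \<and> p divides z2 \<and> p divides z3)" by blast
        have gc: "g \<in> carrier B" "z1 \<in> carrier B" "z2 \<in> carrier B" "z3 \<in> carrier B" using g(1-4) AD(3) by auto
        have "y1 = (p \<otimes> g) \<otimes> z1" "y2 = (p \<otimes> g) \<otimes> z2" "y3 = (p \<otimes> g) \<otimes> z3"
          unfolding w1(2) w2(2) w3(2) g(6-8) using pD(4) gc by (simp_all add: m_assoc)
        moreover have "p \<otimes> g \<in> A" using AE(6)[OF pD(1) g(1)] .
        moreover have "p \<otimes> g \<noteq> \<zero>" using pD(3,4) g(5) gc(1) integral_iff by blast
        ultimately show ?thesis using g(2-4,9) by blast
      qed
    qed
  qed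
  then show ?thesis using y by blast
qed

text \<open>General position over an infinite set of scalars: after the common factor
  \<open>g\<close> of all three is removed, only finitely many \<open>n\<close> leave
  \<open>z2 + n z3\<close> zero or with a prime in common with \<open>z1\<close>. Coprimality then
  gives regularity in \<open>B\<close>.\<close>

lemma coprime_combination:
  assumes rat: "contains_rationals B" and A: "good A"
    and y: "y1 \<in> A" "y1 \<noteq> \<zero>" "y2 \<in> A" "y3 \<in> A" "y2 \<noteq> \<zero> \<or> y3 \<noteq> \<zero>"
  shows "\<exists>(n::nat). \<exists>g\<in>A. \<exists>z1\<in>A. \<exists>z2\<in>A. \<exists>z3\<in>A. g \<noteq> \<zero> \<and> z1 \<noteq> \<zero> \<and> z2 \<noteq> \<zero> \<and>
    y1 = g \<otimes> z1 \<and> y2 \<oplus> [n] \<cdot> \<one> \<otimes> y3 = g \<otimes> z2 \<and> y3 = g \<otimes> z3 \<and> regular z1 z2"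
proof -
  note AD = goodD[OF A]
  note AE = subringE[OF AD(2)]
  obtain g z1 z2 z3 where g: "g \<in> A" "z1 \<in> A" "z2 \<in> A" "z3 \<in> A" "g \<noteq> \<zero>" "y1 = g \<otimes> z1" "y2 = g \<otimes> z2"
    "y3 = g \<otimes> z3" "\<forall>p. strong_prime A p \<longrightarrow> \<not> (p divides z1 \<and> p divides z2 \<and> p divides z3)"
    using common_divisor_strip[OF A y(1-4)] by blast
  have c: "g \<in> carrier B" "z1 \<in> carrier B" "z2 \<in> carrier B" "z3 \<in> carrier B" using g(1-4) AD(3) by auto
  have z10: "z1 \<noteq> \<zero>" using y(2) g(6) c(1) by auto
  have z230: "\<not> (z2 \<in> {\<zero>} \<and> z3 \<in> {\<zero>})" using y(5) g(7,8) c(1) by auto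
  let ?N = "{n::nat. \<exists>p. strong_prime A p \<and> p divides z1 \<and> p divides (z2 \<oplus> [n] \<cdot> \<one> \<otimes> z3)}"
  let ?Z = "{n::nat. z2 \<oplus> [n] \<cdot> \<one> \<otimes> z3 = \<zero>}"
  have "m = n" if "m \<in> ?Z" "n \<in> ?Z" for m n
    by (rule affine_multiple_unique[OF rat c(3,4) zeroideal z230]) (use that in auto)
  then have "finite ?Z" by (metis (no_types, lifting) finite.simps is_singletonI' is_singleton_the_elem)
  moreover have "finite ?N"
    by (rule finite_common_prime_multiples[OF rat A g(2) z10 g(3,4)]) (use g(9) in blast)
  ultimately have "finite (?Z \<union> ?N)" by blast
  then obtain n where n: "n \<notin> ?Z \<union> ?N" using ex_new_if_finite[OF infinite_UNIV_nat] by blast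
  define a where "a = [n] \<cdot> \<one>"
  define z2' where "z2' = z2 \<oplus> a \<otimes> z3"
  have a: "a \<in> A" unfolding a_def by (rule nat_scalar_in_subring[OF AD(2)])
  have ac: "a \<in> carrier B" using a AD(3) by blast
  have z2': "z2' \<in> A" unfolding z2'_def using AE(7)[OF g(3) AE(6)[OF a g(4)]] .
  have z2'c: "z2' \<in> carrier B" using z2' AD(3) by blast
  have z2'0: "z2' \<noteq> \<zero>" using n unfolding z2'_def a_def by blast
  have "regular z2' z1"
    by (rule regular_of_no_common_prime[OF A g(2) z10 z2']) (use n in \<open>auto simp: z2'_def a_def\<close>)
  then have "regular z1 z2'" using regular_swap[OF _ c(2) z10 z2'c] by blast
  moreover have "y2 \<oplus> a \<otimes> y3 = g \<otimes> z2'" unfolding g(7,8) z2'_def using c ac by algebra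
  ultimately show ?thesis
    using g(1,2,4-6,8) z2' z10 z2'0 unfolding a_def by blast
qed

text \<open>The coefficients range over a separate set \<open>S\<close>, while the operations are
  those of \<open>B\<close>. The contraction property compares \<open>S = carrier B\<close> with
  \<open>S = A\<close> for one list of generators.\<close>

primrec lin_combs :: "'b set \<Rightarrow> 'b list \<Rightarrow> 'b set" where
  "lin_combs S [] = {\<zero>}"
| "lin_combs S (y # ys) = {s \<otimes> y \<oplus> t | s t. s \<in> S \<and> t \<in> lin_combs S ys}"

lemma lin_combs_ConsI: "s \<in> S \<Longrightarrow> t \<in> lin_combs S ys \<Longrightarrow> s \<otimes> y \<oplus> t \<in> lin_combs S (y # ys)"
  by auto

lemma lin_combs_carrier:
  "S \<subseteq> carrier B \<Longrightarrow> set ys \<subseteq> carrier B \<Longrightarrow> lin_combs S ys \<subseteq> carrier B"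
  by (induction ys) auto

lemma lin_combs_filter:
  assumes S: "subring S B" and ys: "set ys \<subseteq> carrier B"
  shows "lin_combs S (filter (\<lambda>y. y \<noteq> \<zero>) ys) = lin_combs S ys"
  using ys
proof (induction ys)
  case (Cons y ys)
  note SE = subringE[OF S]
  have L: "lin_combs S ys \<subseteq> carrier B" using lin_combs_carrier[OF SE(1)] Cons(2) by simp
  show ?case
  proof (cases "y = \<zero>")
    case True
    have "s \<otimes> \<zero> \<oplus> t = t" if "s \<in> S" "t \<in> lin_combs S ys" for s t
    proof -
      have "s \<in> carrier B" "t \<in> carrier B" using that L SE(1) by blast+
      then show ?thesis by simp
    qed
    then have "lin_combs S (y # ys) = lin_combs S ys" using True SE(2) by (auto, metis)
    then show ?thesis using True Cons by simp
  qed (use Cons in simp)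
qed simp

lemma lin_combs_add:
  assumes S: "S \<subseteq> carrier B" and "set ys \<subseteq> carrier B" "set zs \<subseteq> carrier B"
    and "a \<in> lin_combs S ys" "b \<in> lin_combs S zs"
  shows "a \<oplus> b \<in> lin_combs S (ys @ zs)"
  using assms(2,4)
proof (induction ys arbitrary: a)
  case Nil
  have "b \<in> carrier B" using lin_combs_carrier[OF S assms(3)] assms(5) by blast
  then show ?case using Nil assms(5) by simp
next
  case (Cons y ys)
  then obtain s t where st: "a = s \<otimes> y \<oplus> t" "s \<in> S" "t \<in> lin_combs S ys" by auto
  have c: "s \<in> carrier B" "y \<in> carrier B" "t \<in> carrier B" "b \<in> carrier B"
    using st S Cons(2) lin_combs_carrier[OF S, of ys] lin_combs_carrier[OF S assms(3)] assms(5) by auto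
  have "a \<oplus> b = s \<otimes> y \<oplus> (t \<oplus> b)" unfolding st(1) using c by algebra
  moreover have "t \<oplus> b \<in> lin_combs S (ys @ zs)" using Cons(1)[OF _ st(3)] Cons(2) by simp
  ultimately show ?case using st(2) by auto
qed

lemma lin_combs_mult:
  assumes S: "subring S B" and r: "r \<in> S" and "set ys \<subseteq> carrier B" "a \<in> lin_combs S ys"
  shows "r \<otimes> a \<in> lin_combs S ys"
  using assms(3,4)
proof (induction ys arbitrary: a)
  case Nil
  then show ?case using r subringE(1)[OF S] by auto
next
  case (Cons y ys)
  note SE = subringE[OF S]
  obtain s t where st: "a = s \<otimes> y \<oplus> t" "s \<in> S" "t \<in> lin_combs S ys" using Cons(3) by auto
  have c: "s \<in> carrier B" "y \<in> carrier B" "t \<in> carrier B" "r \<in> carrier B"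
    using st(2,3) r SE(1) Cons(2) lin_combs_carrier[OF SE(1), of ys] by auto
  have "r \<otimes> a = (r \<otimes> s) \<otimes> y \<oplus> r \<otimes> t" unfolding st(1) using c by algebra
  moreover have "r \<otimes> t \<in> lin_combs S ys" using Cons(1)[OF _ st(3)] Cons(2) by simp
  ultimately show ?case using SE(6)[OF r st(2)] by auto
qed

lemma lin_combs_subset_ideal:
  assumes "ideal I R'" "\<And>a b. a \<otimes> b = a \<otimes>\<^bsub>R'\<^esub> b" "\<And>a b. a \<oplus> b = a \<oplus>\<^bsub>R'\<^esub> b" "\<zero> = \<zero>\<^bsub>R'\<^esub>"
    "set ys \<subseteq> I" "S \<subseteq> carrier R'"
  shows "lin_combs S ys \<subseteq> I"
  using assms(5)
proof (induction ys)
  case Nil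
  then show ?case using additive_subgroup.zero_closed[OF ideal.axioms(1)[OF assms(1)]] assms(4) by simp
next
  case (Cons y ys)
  have "s \<otimes> y \<oplus> t \<in> I" if "s \<in> S" "t \<in> I" for s t
    using additive_subgroup.a_closed[OF ideal.axioms(1)[OF assms(1)] ideal.I_l_closed[OF assms(1), of y s] that(2)]
      that(1) Cons(2) assms(2,3,6) by auto
  then show ?case using Cons by auto
qed

lemma genideal_lin_combs:
  assumes I: "I \<subseteq> carrier B" and x: "x \<in> Idl I"
  shows "\<exists>ys. set ys \<subseteq> I \<and> x \<in> lin_combs (carrier B) ys"
proof -
  let ?J = "{x. \<exists>ys. set ys \<subseteq> I \<and> x \<in> lin_combs (carrier B) ys}"
  have L: "lin_combs (carrier B) ys \<subseteq> carrier B" if "set ys \<subseteq> I" for ys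
    using lin_combs_carrier[of "carrier B" ys] that I by blast
  have mult: "r \<otimes> a \<in> ?J" if a: "a \<in> ?J" and r: "r \<in> carrier B" for a r
  proof -
    obtain ys where ys: "set ys \<subseteq> I" "a \<in> lin_combs (carrier B) ys" using a by blast
    have "r \<otimes> a \<in> lin_combs (carrier B) ys"
      by (rule lin_combs_mult[OF carrier_is_subring r _ ys(2)]) (use ys(1) I in blast)
    then show ?thesis using ys(1) by blast
  qed
  have "ideal ?J B"
  proof (rule idealI)
    show "ring B" by (rule ring_axioms)
    show "subgroup ?J (add_monoid B)"
    proof (rule add.subgroupI)
      show "?J \<subseteq> carrier B" using L by blast
      have "\<zero> \<in> lin_combs (carrier B) []" by simp
      then show "?J \<noteq> {}" by (metis (mono_tags, lifting) empty_iff empty_set empty_subsetI mem_Collect_eq)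
      fix a assume a: "a \<in> ?J"
      then have "a \<in> carrier B" using L by blast
      then have "\<ominus> a = (\<ominus> \<one>) \<otimes> a" by algebra
      then show "\<ominus> a \<in> ?J" using mult[OF a, of "\<ominus> \<one>"] by simp
      fix b assume b: "b \<in> ?J"
      obtain ys zs where yz: "set ys \<subseteq> I" "a \<in> lin_combs (carrier B) ys"
        "set zs \<subseteq> I" "b \<in> lin_combs (carrier B) zs" using a b by blast
      have "a \<oplus> b \<in> lin_combs (carrier B) (ys @ zs)"
        by (rule lin_combs_add) (use yz I in auto)
      moreover have "set (ys @ zs) \<subseteq> I" using yz by simp
      ultimately show "a \<oplus> b \<in> ?J" by blast
    qed
    fix a r assume a: "a \<in> ?J" and r: "r \<in> carrier B"
    show "r \<otimes> a \<in> ?J" by (rule mult[OF a r])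
    moreover have "a \<in> carrier B" using a L by blast
    ultimately show "a \<otimes> r \<in> ?J" using m_comm r by simp
  qed
  moreover have "I \<subseteq> ?J"
  proof
    fix y assume y: "y \<in> I"
    then have "y = \<one> \<otimes> y \<oplus> \<zero>" using I by auto
    then have "y \<in> lin_combs (carrier B) [y]" by auto
    then show "y \<in> ?J" using y by (intro CollectI exI[of _ "[y]"]) simp
  qed
  ultimately have "Idl I \<subseteq> ?J" by (rule genideal_minimal)
  then show ?thesis using x by blast
qed

text \<open>
  Lists of at least three generators are shortened: after replacing \<open>y2\<close> by \<open>y2 + n y3\<close> the
  first two generators are \<open>g z1, g z2\<close> with \<open>z1, z2\<close> regular, so that the ideal \<open>(z1, z2)\<close> is
  dense and the coefficient of \<open>y3\<close> can be corrected into \<open>A\<close>.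
\<close>
lemma lin_combs_contract_nonzero:
  assumes rat: "contains_rationals B" and sat: "saturated A"
    and ys: "set ys \<subseteq> A" "\<zero> \<notin> set ys" and c: "c \<in> A" "c \<in> lin_combs (carrier B) ys"
  shows "c \<in> lin_combs A ys"
proof -
  note AD = saturatedD(1-4)[OF sat]
  note AE = subringE[OF AD(3)]
  show ?thesis
    using ys c
  proof (induction "length ys" arbitrary: ys c rule: less_induct)
    case less
    consider "ys = []" | y where "ys = [y]" | y1 y2 where "ys = [y1, y2]"
      | y1 y2 y3 zs where "ys = y1 # y2 # y3 # zs"
      by (metis list.exhaust)
    then show ?case
    proof cases
      case 1
      then show ?thesis using less(5) by simp
    next
      case 2
      have y: "y \<in> A" "y \<noteq> \<zero>" using less(2,3) 2 by auto
      obtain b where b: "b \<in> carrier B" "c = b \<otimes> y \<oplus> \<zero>" using less(5) 2 by auto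
      have yc: "y \<in> carrier B" using y AD(4) by blast
      have "c = y \<otimes> b" using b yc m_comm by simp
      then have "b \<in> A" using frac_closedD(3)[OF AD(2) y(1) b(1) y(2)] less(4) by simp
      then show ?thesis using b(2) 2 by auto
    next
      case 3
      have y: "y1 \<in> A" "y2 \<in> A" "y1 \<noteq> \<zero>" "y2 \<noteq> \<zero>" using less(2,3) 3 by auto
      have yc: "y1 \<in> carrier B" "y2 \<in> carrier B" using y AD(4) by auto
      obtain b1 b2 where b: "b1 \<in> carrier B" "b2 \<in> carrier B" "c = b1 \<otimes> y1 \<oplus> (b2 \<otimes> y2 \<oplus> \<zero>)"
        using less(5) 3 by auto
      \<comment> \<open>The third generator is taken to be zero, so \<open>n\<close> has no effect
        and only the common factor \<open>g\<close> is split off.\<close>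
      obtain n :: nat and g z1 z2 z3 where g: "g \<in> A" "z1 \<in> A" "z2 \<in> A" "g \<noteq> \<zero>" "z1 \<noteq> \<zero>" "z2 \<noteq> \<zero>"
        "y1 = g \<otimes> z1" "y2 \<oplus> [n] \<cdot> \<one> \<otimes> \<zero> = g \<otimes> z2" "regular z1 z2"
        using coprime_combination[OF rat AD(1) y(1,3,2) AE(2)] y(4) by blast
      have y2: "y2 = g \<otimes> z2" using g(8) yc by simp
      have gc: "g \<in> carrier B" "z1 \<in> carrier B" "z2 \<in> carrier B" using g(1-3) AD(4) by auto
      have ceq: "c = g \<otimes> (z1 \<otimes> b1 \<oplus> z2 \<otimes> b2)"
        unfolding b(3) g(7) y2 using gc b(1,2) by algebra
      define c' where "c' = z1 \<otimes> b1 \<oplus> z2 \<otimes> b2"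
      have c'c: "c' \<in> carrier B" unfolding c'_def using gc b by simp
      have c': "c' \<in> A"
        using frac_closedD(3)[OF AD(2) g(1) c'c g(4)] ceq less(4) unfolding c'_def by simp
      obtain x1 x2 where x: "x1 \<in> A" "x2 \<in> A" "c' = z1 \<otimes> x1 \<oplus> z2 \<otimes> x2"
        using saturatedD(6)[OF sat g(2,3) c' g(5,6,9) b(1,2) c'_def] by blast
      have xc: "x1 \<in> carrier B" "x2 \<in> carrier B" using x AD(4) by auto
      have "c = g \<otimes> c'" unfolding ceq c'_def ..
      also have "\<dots> = x1 \<otimes> y1 \<oplus> (x2 \<otimes> y2 \<oplus> \<zero>)"
        unfolding x(3) g(7) y2 using gc xc by algebra
      finally show ?thesis using x(1,2) 3 by auto
    next
      case 4
      have y: "y1 \<in> A" "y2 \<in> A" "y3 \<in> A" "y1 \<noteq> \<zero>" "y2 \<noteq> \<zero>" "set zs \<subseteq> A" "\<zero> \<notin> set zs"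
        using less(2,3) 4 by auto
      have yc: "y1 \<in> carrier B" "y2 \<in> carrier B" "y3 \<in> carrier B" "set zs \<subseteq> carrier B" using y AD(4) by auto
      obtain b1 b2 b3 t where b: "b1 \<in> carrier B" "b2 \<in> carrier B" "b3 \<in> carrier B"
        "t \<in> lin_combs (carrier B) zs" "c = b1 \<otimes> y1 \<oplus> (b2 \<otimes> y2 \<oplus> (b3 \<otimes> y3 \<oplus> t))"
        using less(5) 4 by auto
      have tc: "t \<in> carrier B" using lin_combs_carrier[of "carrier B" zs] b(4) yc(4) by auto
      obtain n :: nat and g z1 z2 z3 where g: "g \<in> A" "z1 \<in> A" "z2 \<in> A" "z3 \<in> A" "g \<noteq> \<zero>" "z1 \<noteq> \<zero>" "z2 \<noteq> \<zero>"
        "y1 = g \<otimes> z1" "y2 \<oplus> [n] \<cdot> \<one> \<otimes> y3 = g \<otimes> z2" "y3 = g \<otimes> z3" "regular z1 z2"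
        using coprime_combination[OF rat AD(1) y(1,4,2,3)] y(5) by blast
      have gc: "g \<in> carrier B" "z1 \<in> carrier B" "z2 \<in> carrier B" "z3 \<in> carrier B" using g(1-4) AD(4) by auto
      define k where "k = [n] \<cdot> \<one>"
      have k: "k \<in> A" unfolding k_def by (rule nat_scalar_in_subring[OF AD(3)])
      have kc: "k \<in> carrier B" using k AD(4) by blast
      define w where "w = y2 \<oplus> k \<otimes> y3"
      have w: "w = g \<otimes> z2" "w \<in> A" "w \<noteq> \<zero>"
      proof -
        show *: "w = g \<otimes> z2" unfolding w_def k_def by (rule g(9))
        show "w \<in> A" unfolding * using AE(6)[OF g(1,3)] .
        show "w \<noteq> \<zero>" unfolding * using g(5,7) gc integral_iff by blast
      qed
      \<comment> \<open>In terms of \<open>y1, w, y3\<close> the element \<open>c\<close> has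
        \<open>b3 - k b2\<close> as its coefficient at \<open>y3\<close>.\<close>
      have b': "b3 \<ominus> k \<otimes> b2 \<in> carrier B" using b kc by simp
      obtain s1 s2 where s: "s1 \<in> carrier B" "s2 \<in> carrier B" "(b3 \<ominus> k \<otimes> b2) \<oplus> (s1 \<otimes> z1 \<oplus> s2 \<otimes> z2) \<in> A"
        using saturatedD(5)[OF sat dense_pair[OF gc(2,3) g(7,11)] b'] by blast
      define a where "a = (b3 \<ominus> k \<otimes> b2) \<oplus> (s1 \<otimes> z1 \<oplus> s2 \<otimes> z2)"
      have a: "a \<in> A" using s(3) unfolding a_def .
      have ac: "a \<in> carrier B" using a AD(4) by blast
      have eq: "c \<oplus> \<ominus> (y3 \<otimes> a) = (b1 \<ominus> z3 \<otimes> s1) \<otimes> y1 \<oplus> ((b2 \<ominus> z3 \<otimes> s2) \<otimes> w \<oplus> t)"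
      proof -
        \<comment> \<open>Because \<open>g\<close> divides all three generators, \<open>y3\<close>
          times an element of \<open>(z1, z2)\<close> is a combination of \<open>y1\<close> and
          \<open>w\<close>. The correction of the coefficient of \<open>y3\<close> is thus absorbed,
          and the list becomes shorter.\<close>
        have 1: "y3 \<otimes> (s1 \<otimes> z1 \<oplus> s2 \<otimes> z2) = (z3 \<otimes> s1) \<otimes> y1 \<oplus> (z3 \<otimes> s2) \<otimes> w"
          unfolding g(8) w(1) g(10) using gc s(1,2) by algebra
        have "c \<oplus> \<ominus> (y3 \<otimes> a) = c \<oplus> \<ominus> (y3 \<otimes> (b3 \<ominus> k \<otimes> b2)) \<oplus> \<ominus> (y3 \<otimes> (s1 \<otimes> z1 \<oplus> s2 \<otimes> z2))"
          unfolding a_def b(5) using yc(1-3) b(1-3) tc kc s(1,2) gc by algebra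
        also have "\<dots> = c \<oplus> \<ominus> (y3 \<otimes> (b3 \<ominus> k \<otimes> b2)) \<oplus> \<ominus> ((z3 \<otimes> s1) \<otimes> y1 \<oplus> (z3 \<otimes> s2) \<otimes> w)"
          unfolding 1 ..
        also have "\<dots> = (b1 \<ominus> z3 \<otimes> s1) \<otimes> y1 \<oplus> ((b2 \<ominus> z3 \<otimes> s2) \<otimes> w \<oplus> t)"
          unfolding b(5) w_def using yc(1-3) b(1-3) tc kc s(1,2) gc(4) by algebra
        finally show ?thesis .
      qed
      have "c \<oplus> \<ominus> (y3 \<otimes> a) \<in> A" using AE(7)[OF less(4) AE(5)[OF AE(6)[OF y(3) a]]] .
      moreover have "c \<oplus> \<ominus> (y3 \<otimes> a) \<in> lin_combs (carrier B) (y1 # w # zs)"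
      proof -
        have "b1 \<ominus> z3 \<otimes> s1 \<in> carrier B" "b2 \<ominus> z3 \<otimes> s2 \<in> carrier B" using b s gc by auto
        then show ?thesis unfolding eq using b(4) by auto
      qed
      ultimately have "c \<oplus> \<ominus> (y3 \<otimes> a) \<in> lin_combs A (y1 # w # zs)"
        using less(1)[of "y1 # w # zs"] 4 y w by auto
      then obtain a1 a2 t' where a': "a1 \<in> A" "a2 \<in> A" "t' \<in> lin_combs A zs"
        "c \<oplus> \<ominus> (y3 \<otimes> a) = a1 \<otimes> y1 \<oplus> (a2 \<otimes> w \<oplus> t')" by auto
      have a'c: "a1 \<in> carrier B" "a2 \<in> carrier B" "t' \<in> carrier B" "c \<in> carrier B"
        using a'(1-3) AD(4) lin_combs_carrier[OF AD(4) yc(4)] less(4) by auto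
      have "c = (c \<oplus> \<ominus> (y3 \<otimes> a)) \<oplus> y3 \<otimes> a" using a'c yc(3) ac by algebra
      also have "\<dots> = a1 \<otimes> y1 \<oplus> (a2 \<otimes> y2 \<oplus> ((a \<oplus> k \<otimes> a2) \<otimes> y3 \<oplus> t'))"
        unfolding a'(4) w_def using a'c yc(1-3) ac kc by algebra
      finally have "c = a1 \<otimes> y1 \<oplus> (a2 \<otimes> y2 \<oplus> ((a \<oplus> k \<otimes> a2) \<otimes> y3 \<oplus> t'))" .
      moreover have "a \<oplus> k \<otimes> a2 \<in> A" using AE(7)[OF a AE(6)[OF k a'(2)]] .
      ultimately show ?thesis using 4 a'(1-3) by (simp only: lin_combs_ConsI)
    qed
  qed
qed

theorem ideal_contraction:
  assumes rat: "contains_rationals B" and sat: "saturated A" and I: "ideal I (B\<lparr>carrier := A\<rparr>)"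
  shows "Idl I \<inter> A = I"
proof
  note AD = saturatedD(1-4)[OF sat]
  interpret I: ideal I "B\<lparr>carrier := A\<rparr>" by fact
  have IA: "I \<subseteq> A" using I.a_subset by simp
  have IB: "I \<subseteq> carrier B" using IA AD(4) by blast
  show "I \<subseteq> Idl I \<inter> A" using genideal_self[OF IB] IA by blast
  show "Idl I \<inter> A \<subseteq> I"
  proof
    fix c assume c: "c \<in> Idl I \<inter> A"
    then obtain ys where ys: "set ys \<subseteq> I" "c \<in> lin_combs (carrier B) ys" using genideal_lin_combs[OF IB] by blast
    let ?zs = "filter (\<lambda>y. y \<noteq> \<zero>) ys"
    have ysB: "set ys \<subseteq> carrier B" using ys IB by blast
    have "c \<in> lin_combs (carrier B) ?zs"
      using ys(2) lin_combs_filter[OF carrier_is_subring ysB] by simp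
    moreover have "set ?zs \<subseteq> A" "\<zero> \<notin> set ?zs" using ys IA by auto
    ultimately have "c \<in> lin_combs A ?zs" using lin_combs_contract_nonzero[OF rat sat] c by blast
    moreover have "lin_combs A ?zs \<subseteq> I"
      by (rule lin_combs_subset_ideal[OF I]) (use ys in auto)
    ultimately show "c \<in> I" by blast
  qed
qed

end

section \<open>Ring-theoretic properties of saturated subrings\<close>

lemma (in noetherian_domain) factorial_domain_if_irreducible_prime:
  assumes "\<And>p. p \<in> carrier R \<Longrightarrow> p \<noteq> \<zero> \<Longrightarrow> irreducible (mult_of R) p \<Longrightarrow> prime (mult_of R) p"
  shows "factorial_domain R"
proof -
  have cc: "comm_monoid_cancel (mult_of R)" by (rule mult_of.comm_monoid_cancel_axioms)
  have pc: "primeness_condition_monoid (mult_of R)"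
    unfolding primeness_condition_monoid_def primeness_condition_monoid_axioms_def
    using cc assms by auto
  have "factorial_monoid (mult_of R)"
  proof (rule comm_monoid_cancel.factorial_monoidI[OF cc])
    fix a assume "a \<in> carrier (mult_of R)" "a \<notin> Units (mult_of R)"
    then show "\<exists>fs. set fs \<subseteq> carrier (mult_of R) \<and> wfactors (mult_of R) fs a"
      using factorization_property[of a] by simp
  qed (rule primeness_condition_monoid.wfactors_unique[OF pc])
  then show ?thesis by (intro factorial_domain.intro domain_axioms)
qed

context local_noetherian_domain
begin

lemma contracted_ideal:
  assumes A: "subring A B" and I: "ideal I B"
  shows "ideal (A \<inter> I) (B\<lparr>carrier := A\<rparr>)"
proof -
  note AE = subringE[OF A]
  interpret I: ideal I B by fact
  interpret A: ring "B\<lparr>carrier := A\<rparr>" by (rule subring_is_ring[OF A])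
  show ?thesis
  proof (rule idealI[OF A.ring_axioms])
    have "\<ominus>\<^bsub>B\<lparr>carrier := A\<rparr>\<^esub> a = \<ominus> a" if "a \<in> A" for a
      by (rule A.minus_equality[of "\<ominus> a" a, simplified]) (use that AE(1,5) in \<open>auto simp: l_neg subset_iff\<close>)
    then show "subgroup (A \<inter> I) (add_monoid (B\<lparr>carrier := A\<rparr>))"
      using AE I.a_closed I.a_inv_closed
      by (intro A.add.subgroupI) (auto simp: a_inv_def[symmetric])
  qed (use AE(1,6) I.I_l_closed I.I_r_closed in auto)
qed

text \<open>The extension of \<open>I\<close> to \<open>B\<close> is generated by finitely many
  elements, each a combination of finitely many elements of \<open>I\<close>. The ideal of
  \<open>A\<close> generated by the latter has the same extension as \<open>I\<close>, so
  contraction identifies the two.\<close>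

lemma saturated_noetherian:
  assumes sat: "saturated A" and rat: "contains_rationals B"
  shows "noetherian_ring (B\<lparr>carrier := A\<rparr>)"
proof -
  note AD = saturatedD(1-4)[OF sat]
  let ?A = "B\<lparr>carrier := A\<rparr>"
  have rA: "ring ?A" by (rule subring_is_ring[OF AD(3)])
  show ?thesis
  proof (rule ring.noetherian_ringI[OF rA])
    fix I assume I: "ideal I ?A"
    have IA: "I \<subseteq> A" using additive_subgroup.a_subset[OF ideal.axioms(1)[OF I]] by simp
    have IB: "I \<subseteq> carrier B" using IA AD(4) by blast
    obtain F where F: "F \<subseteq> carrier B" "finite F" "Idl I = Idl F"
      using finetely_gen[OF genideal_ideal[OF IB]] by blast
    have "\<exists>ys. set ys \<subseteq> I \<and> f \<in> lin_combs (carrier B) ys" if "f \<in> F" for f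
      using genideal_lin_combs[OF IB, of f] genideal_self[OF F(1)] that F(3) by blast
    then obtain ys where ys: "\<And>f. f \<in> F \<Longrightarrow> set (ys f) \<subseteq> I \<and> f \<in> lin_combs (carrier B) (ys f)" by metis
    define G where "G = (\<Union>f\<in>F. set (ys f))"
    have G: "finite G" "G \<subseteq> I" "G \<subseteq> carrier B" "G \<subseteq> carrier ?A"
      unfolding G_def using F(2) ys IB IA by auto
    have GI: "ideal (Idl G) B" by (rule genideal_ideal[OF G(3)])
    have "F \<subseteq> Idl G"
    proof
      fix f assume f: "f \<in> F"
      have "set (ys f) \<subseteq> Idl G" using genideal_self[OF G(3)] f unfolding G_def by blast
      then have "lin_combs (carrier B) (ys f) \<subseteq> Idl G"
        by (intro lin_combs_subset_ideal[OF GI]) auto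
      then show "f \<in> Idl G" using ys[OF f] by blast
    qed
    then have FG: "Idl I \<subseteq> Idl G" unfolding F(3) by (rule genideal_minimal[OF GI])
    let ?J = "Idl\<^bsub>?A\<^esub> G"
    have J: "ideal ?J ?A" by (rule ring.genideal_ideal[OF rA G(4)])
    have JI: "?J \<subseteq> I" by (rule ring.genideal_minimal[OF rA I G(2)])
    have GJ: "G \<subseteq> ?J" by (rule ring.genideal_self[OF rA G(4)])
    have JB: "?J \<subseteq> carrier B" using JI IB by blast
    have "Idl G \<subseteq> Idl ?J"
      by (rule genideal_minimal[OF genideal_ideal[OF JB]]) (use GJ genideal_self[OF JB] in blast)
    then have "I \<subseteq> ?J"
      using ideal_contraction[OF rat sat J] FG genideal_self[OF IB] IA by blast
    then have "I = ?J" using JI by blast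
    then show "\<exists>G \<subseteq> carrier ?A. finite G \<and> I = Idl\<^bsub>?A\<^esub> G" using G by blast
  qed
qed

lemma saturated_Units:
  assumes sat: "saturated A"
  shows "Units (B\<lparr>carrier := A\<rparr>) = A - M"
proof
  note AD = saturatedD(1-4)[OF sat]
  show "Units (B\<lparr>carrier := A\<rparr>) \<subseteq> A - M"
  proof
    fix u assume "u \<in> Units (B\<lparr>carrier := A\<rparr>)"
    then obtain v where v: "u \<in> A" "v \<in> A" "u \<otimes> v = \<one>" unfolding Units_def by auto
    have "u \<notin> M"
    proof
      assume "u \<in> M"
      then have "u \<otimes> v \<in> M" using M.I_r_closed v(2) AD(4) by blast
      then show False using v(3) one_notin_M by simp
    qed
    then show "u \<in> A - M" using v by blast
  qed
  show "A - M \<subseteq> Units (B\<lparr>carrier := A\<rparr>)"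
  proof
    fix u assume u: "u \<in> A - M"
    then have uB: "u \<in> Units B" using Units_iff AD(4) by blast
    have u0: "u \<noteq> \<zero>" using u M.zero_closed by auto
    have "inv u \<in> A"
      by (rule frac_closedD(3)[OF AD(2), of u]) (use u uB u0 subringE(3)[OF AD(3)] in auto)
    then show "u \<in> Units (B\<lparr>carrier := A\<rparr>)" unfolding Units_def using u uB
      by (auto intro!: bexI[of _ "inv u"])
  qed
qed

lemma saturated_local_domain:
  assumes sat: "saturated A" and rat: "contains_rationals B"
  shows "local_domain (B\<lparr>carrier := A\<rparr>) (M \<inter> A)"
proof -
  note AD = saturatedD(1-4)[OF sat]
  let ?A = "B\<lparr>carrier := A\<rparr>"
  have dA: "domain ?A" by (rule subring_is_domain[OF AD(3)])
  then have cA: "cring ?A" and rA: "ring ?A" by (auto simp: domain_def cring_def)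
  have MA: "ideal (M \<inter> A) ?A" using contracted_ideal[OF AD(3) M.is_ideal] by (simp add: Int_commute)
  have proper: "J \<subseteq> M \<inter> A" if J: "ideal J ?A" "J \<noteq> A" for J
  proof
    fix x assume x: "x \<in> J"
    have JA: "J \<subseteq> A" using additive_subgroup.a_subset[OF ideal.axioms(1)[OF J(1)]] by simp
    have "x \<in> M"
    proof (rule ccontr)
      assume "x \<notin> M"
      then have "x \<in> Units ?A" using saturated_Units[OF sat] x JA by blast
      then obtain v where "v \<in> A" "x \<otimes> v = \<one>" unfolding Units_def by auto
      then have "\<one> \<in> J" using ideal.I_r_closed[OF J(1) x, of v] by simp
      then show False using ideal.one_imp_carrier[OF J(1)] J(2) by simp
    qed
    then show "x \<in> M \<inter> A" using x JA by blast
  qed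
  have ne: "M \<inter> A \<noteq> A" using one_notin_M subringE(3)[OF AD(3)] by blast
  have "maximalideal (M \<inter> A) ?A"
  proof (rule maximalidealI[OF MA])
    show "carrier ?A \<noteq> M \<inter> A" using ne by simp
    fix J assume "ideal J ?A" "M \<inter> A \<subseteq> J" "J \<subseteq> carrier ?A"
    then show "J = M \<inter> A \<or> J = carrier ?A" using proper by auto
  qed
  moreover have "N = M \<inter> A" if N: "maximalideal N ?A" for N
  proof -
    have Ni: "ideal N ?A" "N \<noteq> A" using maximalideal.axioms(1)[OF N] maximalideal.I_notcarr[OF N] by auto
    then show ?thesis
      using maximalideal.I_maximal[OF N MA] proper[OF Ni] ne by auto
  qed
  ultimately show ?thesis
    unfolding local_domain_def local_ring_def using dA cA saturated_noetherian[OF sat rat] by blast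
qed

lemma saturated_factorial:
  assumes sat: "saturated A" and rat: "contains_rationals B"
  shows "factorial_domain (B\<lparr>carrier := A\<rparr>)"
proof -
  note AD = saturatedD(1-4)[OF sat]
  let ?A = "B\<lparr>carrier := A\<rparr>"
  have dA: "domain ?A" by (rule subring_is_domain[OF AD(3)])
  have nA: "noetherian_domain ?A"
    by (intro noetherian_domain.intro saturated_noetherian[OF sat rat] dA)
  have Um: "Units (mult_of ?A) = A - M"
    using domain.Units_mult_eq_Units[OF dA] saturated_Units[OF sat] by simp
  show ?thesis
  proof (rule noetherian_domain.factorial_domain_if_irreducible_prime[OF nA])
    fix p assume p: "p \<in> carrier ?A" "p \<noteq> \<zero>\<^bsub>?A\<^esub>" "irreducible (mult_of ?A) p"
    have pA: "p \<in> A" "p \<noteq> \<zero>" using p by auto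
    have pM: "p \<in> M" using p(3) pA Um unfolding irreducible_def by blast
    have "atom A p"
      unfolding atom_def
    proof (intro conjI ballI impI)
      fix a b assume ab: "a \<in> A" "b \<in> A" "p = a \<otimes> b"
      have c: "a \<in> carrier B" "b \<in> carrier B" using ab AD(4) by auto
      have a0: "a \<noteq> \<zero>" using pA ab c by auto
      have b0: "b \<noteq> \<zero>" using pA ab c by auto
      show "a \<notin> M \<or> b \<notin> M"
      proof (rule ccontr)
        assume n: "\<not> ?thesis"
        have "a divides\<^bsub>mult_of ?A\<^esub> p" unfolding factor_def using ab b0 by auto
        moreover have "\<not> p divides\<^bsub>mult_of ?A\<^esub> a"
        proof
          assume "p divides\<^bsub>mult_of ?A\<^esub> a"
          then obtain d where d: "d \<in> A" "a = p \<otimes> d" unfolding factor_def by auto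
          have dc: "d \<in> carrier B" using d AD(4) by blast
          have "a \<otimes> \<one> = a \<otimes> (b \<otimes> d)"
          proof -
            have "a \<otimes> \<one> = p \<otimes> d" using d(2) c by simp
            also have "\<dots> = a \<otimes> (b \<otimes> d)" unfolding ab(3) using c dc by algebra
            finally show ?thesis .
          qed
          then have "\<one> = b \<otimes> d" using m_lcancel[OF a0 c(1), of \<one> "b \<otimes> d"] c(2) dc by simp
          then show False using M.I_r_closed[of b d] n dc one_notin_M by simp
        qed
        ultimately have "a \<in> Units (mult_of ?A)"
          using p(3) ab(1) a0 unfolding irreducible_def properfactor_def by simp
        then show False using n Um by blast
      qed
    qed (use pA pM in auto)
    then have sp: "strong_prime A p" using goodD(4)[OF AD(1)] by blast
    show "prime (mult_of ?A) p"
      unfolding prime_def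
    proof (intro conjI ballI impI)
      show "p \<notin> Units (mult_of ?A)" using Um pM by blast
      fix a b assume ab: "a \<in> carrier (mult_of ?A)" "b \<in> carrier (mult_of ?A)"
        and d: "p divides\<^bsub>mult_of ?A\<^esub> (a \<otimes>\<^bsub>mult_of ?A\<^esub> b)"
      have abA: "a \<in> A" "a \<noteq> \<zero>" "b \<in> A" "b \<noteq> \<zero>" using ab by auto
      have abB: "a \<in> carrier B" "b \<in> carrier B" using abA AD(4) by auto
      have "p divides (a \<otimes> b)" using d AD(4) unfolding factor_def by auto
      then have "p divides a \<or> p divides b"
        using strong_primeD(5)[OF sp abA(1)] regularD abB(2) by blast
      moreover have lift: "p divides\<^bsub>mult_of ?A\<^esub> x" if x: "x \<in> A" "x \<noteq> \<zero>" "p divides x" for x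
      proof -
        obtain y where y: "y \<in> A" "x = p \<otimes> y" by (rule frac_closed_divides[OF AD(2) pA x(1,3)])
        have "y \<noteq> \<zero>" using y x(2) pA AD(4) by auto
        then show ?thesis unfolding factor_def using y by auto
      qed
      ultimately show "p divides\<^bsub>mult_of ?A\<^esub> a \<or> p divides\<^bsub>mult_of ?A\<^esub> b" using abA by blast
    qed
  qed
qed

text \<open>Surjectivity is the case of contraction for a prime \<open>Q\<close>: its extension
  misses \<open>A - Q\<close>, and any prime of \<open>B\<close> that contains the extension and
  misses \<open>A - Q\<close> lies over \<open>Q\<close>.\<close>

lemma saturated_Spec:
  assumes sat: "saturated A" and rat: "contains_rationals B"
  shows "(\<lambda>P. A \<inter> P) ` Spec B = Spec (B\<lparr>carrier := A\<rparr>)"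
proof
  note AD = saturatedD(1-4)[OF sat]
  note AE = subringE[OF AD(3)]
  let ?A = "B\<lparr>carrier := A\<rparr>"
  have dA: "domain ?A" by (rule subring_is_domain[OF AD(3)])
  then have cA: "cring ?A" by (simp add: domain_def)
  show "(\<lambda>P. A \<inter> P) ` Spec B \<subseteq> Spec ?A"
  proof
    fix Q assume "Q \<in> (\<lambda>P. A \<inter> P) ` Spec B"
    then obtain P where P: "primeideal P B" "Q = A \<inter> P" unfolding Spec_def by blast
    have "primeideal (A \<inter> P) ?A"
    proof (rule primeidealI[OF contracted_ideal[OF AD(3) primeideal.axioms(1)[OF P(1)]] cA])
      have "\<one> \<notin> P"
        using ideal.one_imp_carrier[OF primeideal.axioms(1)[OF P(1)]] primeideal.I_notcarr[OF P(1)] by blast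
      then show "carrier ?A \<noteq> A \<inter> P" using AE(3) by auto
      fix a b assume "a \<in> carrier ?A" "b \<in> carrier ?A" "a \<otimes>\<^bsub>?A\<^esub> b \<in> A \<inter> P"
      then show "a \<in> A \<inter> P \<or> b \<in> A \<inter> P"
        using primeideal.I_prime[OF P(1), of a b] AD(4) by auto
    qed
    then show "Q \<in> Spec ?A" unfolding Spec_def P(2) by simp
  qed
  show "Spec ?A \<subseteq> (\<lambda>P. A \<inter> P) ` Spec B"
  proof
    fix Q assume "Q \<in> Spec ?A"
    then have Q: "primeideal Q ?A" unfolding Spec_def by simp
    have Qi: "ideal Q ?A" using primeideal.axioms(1)[OF Q] .
    have QA: "Q \<subseteq> A" using additive_subgroup.a_subset[OF ideal.axioms(1)[OF Qi]] by simp
    have QB: "Q \<subseteq> carrier B" using QA AD(4) by blast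
    have con: "Idl Q \<inter> A = Q" by (rule ideal_contraction[OF rat sat Qi])
    have "\<one> \<notin> Q" using ideal.one_imp_carrier[OF Qi] primeideal.I_notcarr[OF Q] by auto
    moreover have "a \<otimes> b \<in> A - Q" if "a \<in> A - Q" "b \<in> A - Q" for a b
      using that primeideal.I_prime[OF Q, of a b] AE(6) by auto
    ultimately obtain P where P: "primeideal P B" "Idl Q \<subseteq> P" "P \<inter> (A - Q) = {}"
      using exists_prime_disjoint[OF is_cring genideal_ideal[OF QB], of "A - Q"] AD(4) AE(3) con by blast
    have "Q = A \<inter> P" using P(2,3) genideal_self[OF QB] QA by blast
    then show "Q \<in> (\<lambda>P. A \<inter> P) ` Spec B" using P(1) unfolding Spec_def by blast
  qed
qed

text \<open>Choosing \<open>N'\<close> maximal below \<open>P\<close> makes \<open>P/N'\<close>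
  cyclic, generated by some \<open>p\<close>. The hypothesis then reads
  \<open>(1 + m) p \<in> N'\<close> with \<open>1 + m\<close> a unit, so neither generating sets of
  \<open>P\<close> nor determinants occur.\<close>

lemma nakayama:
  assumes N: "ideal N B" and P: "ideal P B" and NP: "N \<subseteq> P"
    and eq: "\<And>p. p \<in> P \<Longrightarrow> \<exists>t\<in>M \<cdot>\<^bsub>B\<^esub> P. p \<oplus> t \<in> N"
  shows "N = P"
proof (rule ccontr)
  assume "N \<noteq> P"
  then have "\<exists>N'. ideal N' B \<and> (N \<subseteq> N' \<and> N' \<subseteq> P \<and> N' \<noteq> P) \<and>
     (\<forall>K. ideal K B \<longrightarrow> (N \<subseteq> K \<and> K \<subseteq> P \<and> K \<noteq> P) \<longrightarrow> N' \<subseteq> K \<longrightarrow> K = N')"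
    using maximal_ideal_such_that[OF N, of "\<lambda>N'. N \<subseteq> N' \<and> N' \<subseteq> P \<and> N' \<noteq> P"] NP by simp
  then obtain N' where N': "ideal N' B" "N \<subseteq> N'" "N' \<subseteq> P" "N' \<noteq> P"
    and max: "\<forall>K. ideal K B \<longrightarrow> (N \<subseteq> K \<and> K \<subseteq> P \<and> K \<noteq> P) \<longrightarrow> N' \<subseteq> K \<longrightarrow> K = N'"
    by (elim exE conjE)
  interpret N': ideal N' B by fact
  interpret P: ideal P B by fact
  obtain p where p: "p \<in> P" "p \<notin> N'" using N'(3,4) by blast
  have pc: "p \<in> carrier B" using p P.Icarr by blast
  note J = ideal_plus_PIdl[OF N'(1) pc]
  let ?J = "N' <+>\<^bsub>B\<^esub> PIdl p"
  have JP: "?J \<subseteq> P"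
  proof
    fix x assume "x \<in> ?J"
    then obtain i c where i: "i \<in> N'" "c \<in> carrier B" "x = i \<oplus> c \<otimes> p" using J(4) by blast
    then show "x \<in> P" using P.a_closed[OF subsetD[OF N'(3) i(1)] P.I_l_closed[OF p(1) i(2)]] by simp
  qed
  have "?J = P"
  proof (rule ccontr)
    assume "?J \<noteq> P"
    then have "?J = N'" using max[rule_format, OF J(1)] J(2) JP N'(2) by blast
    then show False using J(3) p(2) by blast
  qed
  then have P_dec: "\<exists>i\<in>N'. \<exists>c\<in>carrier B. x = i \<oplus> c \<otimes> p" if "x \<in> P" for x
    using J(4) that by blast
  have MP: "\<exists>i\<in>N'. \<exists>m\<in>M. t = i \<oplus> m \<otimes> p" if "t \<in> M \<cdot>\<^bsub>B\<^esub> P" for t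
    using that
  proof (induction rule: ideal_prod.induct)
    case (prod m x)
    obtain i c where i: "i \<in> N'" "c \<in> carrier B" "x = i \<oplus> c \<otimes> p" using P_dec[OF prod(2)] by blast
    have mc: "m \<in> carrier B" "i \<in> carrier B" using prod(1) M.Icarr i(1) N'.Icarr by auto
    have "m \<otimes> x = m \<otimes> i \<oplus> (m \<otimes> c) \<otimes> p" unfolding i(3) using mc i(2) pc by algebra
    then show ?case using N'.I_l_closed[OF i(1) mc(1)] M.I_r_closed[OF prod(1) i(2)] by blast
  next
    case (sum a b)
    then obtain i m j l where ij: "i \<in> N'" "m \<in> M" "a = i \<oplus> m \<otimes> p" "j \<in> N'" "l \<in> M" "b = j \<oplus> l \<otimes> p" by blast
    have c: "i \<in> carrier B" "j \<in> carrier B" "m \<in> carrier B" "l \<in> carrier B"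
      using ij M.Icarr N'.Icarr by auto
    have "a \<oplus> b = (i \<oplus> j) \<oplus> (m \<oplus> l) \<otimes> p" unfolding ij(3,6) using c pc by algebra
    then show ?case using N'.a_closed[OF ij(1,4)] M.a_closed[OF ij(2,5)] by blast
  qed
  obtain t where t: "t \<in> M \<cdot>\<^bsub>B\<^esub> P" "p \<oplus> t \<in> N" using eq[OF p(1)] by blast
  obtain i m where im: "i \<in> N'" "m \<in> M" "t = i \<oplus> m \<otimes> p" using MP[OF t(1)] by blast
  have c: "i \<in> carrier B" "m \<in> carrier B" using im M.Icarr N'.Icarr by auto
  have "(p \<oplus> t) \<oplus> \<ominus> i \<in> N'" using N'.a_closed[OF subsetD[OF N'(2) t(2)] N'.a_inv_closed[OF im(1)]] .
  moreover have "(p \<oplus> t) \<oplus> \<ominus> i = (\<one> \<oplus> m) \<otimes> p" unfolding im(3) using c pc by algebra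
  ultimately have mem: "(\<one> \<oplus> m) \<otimes> p \<in> N'" by simp
  have "\<one> \<oplus> m \<notin> M"
  proof
    assume "\<one> \<oplus> m \<in> M"
    then have "(\<one> \<oplus> m) \<oplus> \<ominus> m \<in> M" using M.a_closed M.a_inv_closed im(2) by blast
    moreover have "(\<one> \<oplus> m) \<oplus> \<ominus> m = \<one>" using c by algebra
    ultimately show False using one_notin_M by simp
  qed
  then have U: "\<one> \<oplus> m \<in> Units B" using Units_iff c by simp
  have "inv (\<one> \<oplus> m) \<otimes> ((\<one> \<oplus> m) \<otimes> p) \<in> N'" using N'.I_l_closed[OF mem] U by simp
  moreover have "inv (\<one> \<oplus> m) \<otimes> ((\<one> \<oplus> m) \<otimes> p) = (inv (\<one> \<oplus> m) \<otimes> (\<one> \<oplus> m)) \<otimes> p"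
    using U pc by (simp only: m_assoc Units_closed Units_inv_closed)
  ultimately show False using p(2) U pc by simp
qed

lemma dense_mono: "dense I \<Longrightarrow> ideal J B \<Longrightarrow> I \<subseteq> J \<Longrightarrow> dense J"
  unfolding dense_def by blast

lemma dense_carrier: "dense (carrier B)"
  unfolding dense_def
proof (intro conjI ballI notI oneideal)
  fix b q assume "b \<in> carrier B" "q \<in> Ass_quot B b" "carrier B \<subseteq> q"
  then show False
    using Ass_quotD(1) primeideal.I_notcarr additive_subgroup.a_subset[OF ideal.axioms(1)[OF primeideal.axioms(1)]]
    by (metis subset_antisym)
qed

lemma dense_prod:
  assumes "dense I" "dense J"
  shows "dense (I \<cdot>\<^bsub>B\<^esub> J)"
  unfolding dense_def
proof (intro conjI ballI notI)
  have I: "ideal I B" "ideal J B" using assms unfolding dense_def by auto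
  show "ideal (I \<cdot>\<^bsub>B\<^esub> J) B" by (rule ideal_prod_is_ideal[OF I])
  fix b q assume b: "b \<in> carrier B" "q \<in> Ass_quot B b" "I \<cdot>\<^bsub>B\<^esub> J \<subseteq> q"
  then have "I \<subseteq> q \<or> J \<subseteq> q" using primeideal_divides_ideal_prod[OF Ass_quotD(1) I] by blast
  then show False using assms b unfolding dense_def by blast
qed

text \<open>Not only \<open>P\<close> but also the product \<open>M P\<close> is dense. So every
  coset \<open>p + MP\<close> with \<open>p\<close> in \<open>P\<close> contains an element of
  \<open>A\<close>, which lies in \<open>A \<inter> P\<close>, and this is the hypothesis of
  Nakayama's lemma.\<close>

lemma extension_contraction_dense:
  assumes sat: "saturated A" and P: "dense P" "P \<subseteq> M"
  shows "Idl (A \<inter> P) = P"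
proof -
  note AD = saturatedD(1-4)[OF sat]
  have Pi: "ideal P B" using P unfolding dense_def by blast
  interpret P: ideal P B by fact
  have AP: "A \<inter> P \<subseteq> carrier B" using P.a_subset by blast
  have "dense M" by (rule dense_mono[OF P(1) M.is_ideal P(2)])
  then have dMP: "dense (M \<cdot>\<^bsub>B\<^esub> P)" by (rule dense_prod[OF _ P(1)])
  show ?thesis
  proof (rule nakayama[OF genideal_ideal[OF AP] Pi])
    show "Idl (A \<inter> P) \<subseteq> P" by (rule genideal_minimal[OF Pi]) blast
    fix p assume p: "p \<in> P"
    obtain t where t: "t \<in> M \<cdot>\<^bsub>B\<^esub> P" "p \<oplus> t \<in> A"
      using saturatedD(5)[OF sat dMP P.Icarr[OF p]] by blast
    have "M \<cdot>\<^bsub>B\<^esub> P \<subseteq> P" using ideal_prod_inter[OF M.is_ideal Pi] by blast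
    then have "p \<oplus> t \<in> A \<inter> P" using t p P.a_closed by blast
    then show "\<exists>t\<in>M \<cdot>\<^bsub>B\<^esub> P. p \<oplus> t \<in> Idl (A \<inter> P)" using t(1) genideal_self[OF AP] by blast
  qed
qed


subsection \<open>The completion\<close>

lemma ideal_pow_ideal: "ideal (ideal_pow B M n) B"
  by (induction n) (simp_all add: oneideal ideal_prod_is_ideal[OF M.is_ideal])

lemma ideal_pow_antimono: "ideal_pow B M (Suc n) \<subseteq> ideal_pow B M n"
  using ideal_prod_inter[OF M.is_ideal ideal_pow_ideal[of n]] by auto

lemma dense_ideal_pow: "dense M \<Longrightarrow> dense (ideal_pow B M n)"
  by (induction n) (simp_all add: dense_carrier dense_prod)

lemma ideal_prod_subring: "ideal_prod (B\<lparr>carrier := A\<rparr>) I J = ideal_prod B I J"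
proof
  show "ideal_prod (B\<lparr>carrier := A\<rparr>) I J \<subseteq> ideal_prod B I J"
  proof
    fix x assume "x \<in> ideal_prod (B\<lparr>carrier := A\<rparr>) I J"
    then show "x \<in> ideal_prod B I J"
      by (induction rule: ideal_prod.induct) (auto intro: ideal_prod.intros)
  qed
  show "ideal_prod B I J \<subseteq> ideal_prod (B\<lparr>carrier := A\<rparr>) I J"
  proof
    fix x assume "x \<in> ideal_prod B I J"
    then show "x \<in> ideal_prod (B\<lparr>carrier := A\<rparr>) I J"
    proof (induction rule: ideal_prod.induct)
      case (prod i j)
      then show ?case using ideal_prod.prod[of i I j J "B\<lparr>carrier := A\<rparr>"] by simp
    next
      case (sum a b)
      then show ?case using ideal_prod.sum[of a "B\<lparr>carrier := A\<rparr>" I J b] by simp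
    qed
  qed
qed

text \<open>With one factor fixed, the elements whose product with it lies in the extended ideal
  form a colon ideal; it contains the generators and hence the ideal they generate. This is done for
  each factor in turn.\<close>

lemma genideal_prod:
  assumes I: "I \<subseteq> carrier B" and J: "J \<subseteq> carrier B"
  shows "Idl (ideal_prod B I J) = ideal_prod B (Idl I) (Idl J)"
proof
  have Ii: "ideal (Idl I) B" and Ji: "ideal (Idl J) B" using genideal_ideal I J by auto
  have sub: "ideal_prod B I J \<subseteq> ideal_prod B (Idl I) (Idl J)"
  proof
    fix x assume "x \<in> ideal_prod B I J"
    then show "x \<in> ideal_prod B (Idl I) (Idl J)"
      by (induction rule: ideal_prod.induct)
        (use genideal_self[OF I] genideal_self[OF J] in \<open>auto intro: ideal_prod.intros\<close>)
  qed
  then show "Idl (ideal_prod B I J) \<subseteq> ideal_prod B (Idl I) (Idl J)"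
    by (rule genideal_minimal[OF ideal_prod_is_ideal[OF Ii Ji]])
  have IJ: "ideal_prod B I J \<subseteq> carrier B" using sub ideal_prod_in_carrier[OF Ii Ji] by blast
  let ?K = "Idl (ideal_prod B I J)"
  have K: "ideal ?K B" by (rule genideal_ideal[OF IJ])
  have 1: "y \<otimes> a \<in> ?K" if a: "a \<in> I" and y: "y \<in> Idl J" for a y
  proof -
    have ac: "a \<in> carrier B" using a I by blast
    have "J \<subseteq> {y \<in> carrier B. y \<otimes> a \<in> ?K}"
    proof
      fix y assume y: "y \<in> J"
      then have yc: "y \<in> carrier B" using J by blast
      have "a \<otimes> y \<in> ?K" using ideal_prod.prod[OF a y] genideal_self[OF IJ] by blast
      then show "y \<in> {y \<in> carrier B. y \<otimes> a \<in> ?K}" using yc ac by (simp add: m_comm)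
    qed
    then have "Idl J \<subseteq> {y \<in> carrier B. y \<otimes> a \<in> ?K}" by (rule genideal_minimal[OF colon_ideal[OF K ac]])
    then show ?thesis using y by blast
  qed
  have 2: "x \<otimes> y \<in> ?K" if x: "x \<in> Idl I" and y: "y \<in> Idl J" for x y
  proof -
    have yc: "y \<in> carrier B" using ideal.Icarr[OF Ji y] .
    have "I \<subseteq> {x \<in> carrier B. x \<otimes> y \<in> ?K}"
    proof
      fix a assume a: "a \<in> I"
      then have ac: "a \<in> carrier B" using I by blast
      then show "a \<in> {x \<in> carrier B. x \<otimes> y \<in> ?K}" using 1[OF a y] yc by (simp add: m_comm)
    qed
    then have "Idl I \<subseteq> {x \<in> carrier B. x \<otimes> y \<in> ?K}" by (rule genideal_minimal[OF colon_ideal[OF K yc]])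
    then show ?thesis using x by blast
  qed
  show "ideal_prod B (Idl I) (Idl J) \<subseteq> ?K"
  proof
    fix x assume "x \<in> ideal_prod B (Idl I) (Idl J)"
    then show "x \<in> ?K"
    proof (induction rule: ideal_prod.induct)
      case (prod i j) then show ?case by (rule 2)
    next
      case (sum a b)
      show ?case by (rule additive_subgroup.a_closed[OF ideal.axioms(1)[OF K] sum.IH])
    qed
  qed
qed

text \<open>Since \<open>M\<close> is the extension of \<open>M \<inter> A\<close>, its powers are
  the extensions of the powers of \<open>M \<inter> A\<close>, and contraction recovers the
  latter.\<close>

lemma saturated_ideal_pow:
  assumes sat: "saturated A" and rat: "contains_rationals B" and dM: "dense M"
  shows "ideal (ideal_pow (B\<lparr>carrier := A\<rparr>) (M \<inter> A) n) (B\<lparr>carrier := A\<rparr>)"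
    and "ideal_pow (B\<lparr>carrier := A\<rparr>) (M \<inter> A) n = ideal_pow B M n \<inter> A"
proof -
  note AD = saturatedD(1-4)[OF sat]
  let ?A = "B\<lparr>carrier := A\<rparr>" and ?m = "M \<inter> A"
  have rA: "ring ?A" by (rule subring_is_ring[OF AD(3)])
  have mi: "ideal ?m ?A" using contracted_ideal[OF AD(3) M.is_ideal] by (simp add: Int_commute)
  show pi: "ideal (ideal_pow ?A ?m n) ?A" for n
    by (induction n) (simp_all add: ring.ideal_prod_is_ideal[OF rA mi] ring.oneideal[OF rA, simplified])
  have pA: "ideal_pow ?A ?m n \<subseteq> A" for n
    using additive_subgroup.a_subset[OF ideal.axioms(1)[OF pi[of n]]] by simp
  have pB: "ideal_pow ?A ?m n \<subseteq> carrier B" for n using pA AD(4) by blast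
  have mM: "Idl ?m = M" using extension_contraction_dense[OF sat dM] by (simp add: Int_commute)
  have "Idl (ideal_pow ?A ?m n) = ideal_pow B M n" for n
  proof (induction n)
    case 0
    have "\<one> \<in> Idl A" using genideal_self[OF AD(4)] subringE(3)[OF AD(3)] by blast
    then show ?case using ideal.one_imp_carrier[OF genideal_ideal[OF AD(4)]] by simp
  next
    case (Suc n)
    have "?m \<subseteq> carrier B" using AD(4) by blast
    then show ?case
      using genideal_prod[OF _ pB[of n], of ?m] mM Suc by (simp add: ideal_prod_subring)
  qed
  then show "ideal_pow ?A ?m n = ideal_pow B M n \<inter> A"
    using ideal_contraction[OF rat sat pi[of n]] by simp
qed

lemma coset_set_add:
  assumes I: "ideal I B" and J: "J \<subseteq> I" "\<zero> \<in> J" and a: "a \<in> carrier B"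
  shows "(J +> a) <+>\<^bsub>B\<^esub> I = I +> a"
proof -
  interpret I: ideal I B by fact
  show ?thesis
  proof
    show "(J +> a) <+>\<^bsub>B\<^esub> I \<subseteq> I +> a"
    proof
      fix x assume "x \<in> (J +> a) <+>\<^bsub>B\<^esub> I"
      then obtain j i where ij: "j \<in> J" "i \<in> I" "x = (j \<oplus> a) \<oplus> i"
        unfolding set_add_def' a_r_coset_def' by blast
      have c: "j \<in> carrier B" "i \<in> carrier B" using ij J(1) I.Icarr by auto
      have "x = (j \<oplus> i) \<oplus> a" unfolding ij(3) using c a by algebra
      moreover have "j \<oplus> i \<in> I" using I.a_closed ij J(1) by blast
      ultimately show "x \<in> I +> a" unfolding a_r_coset_def' by blast
    qed
    show "I +> a \<subseteq> (J +> a) <+>\<^bsub>B\<^esub> I"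
    proof
      fix x assume "x \<in> I +> a"
      then obtain i where i: "i \<in> I" "x = i \<oplus> a" unfolding a_r_coset_def' by blast
      have ic: "i \<in> carrier B" using i I.Icarr by blast
      have "x = (\<zero> \<oplus> a) \<oplus> i" unfolding i(2) using ic a by algebra
      then show "x \<in> (J +> a) <+>\<^bsub>B\<^esub> I" unfolding set_add_def' a_r_coset_def' using J(2) i(1) by blast
    qed
  qed
qed

lemma Quot_carrier: "carrier (S Quot I) = {I +>\<^bsub>S\<^esub> a | a. a \<in> carrier S}"
  unfolding FactRing_def A_RCOSETS_def' by auto

lemma a_r_coset_subring: "I +>\<^bsub>B\<lparr>carrier := A\<rparr>\<^esub> a = I +> a"
  unfolding a_r_coset_def' by simp

text \<open>The map is an isomorphism at every level: injective because the powers of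
  \<open>M \<inter> A\<close> are contracted from those of \<open>M\<close>, surjective because the
  powers of \<open>M\<close> are dense and so their cosets meet \<open>A\<close>.\<close>

theorem saturated_completion:
  assumes sat: "saturated A" and rat: "contains_rationals B" and dM: "dense M"
  shows "induced_completion_map B M \<in>
    ring_iso (completion (B\<lparr>carrier := A\<rparr>) (M \<inter> A)) (completion B M)"
proof -
  note AD = saturatedD(1-4)[OF sat]
  note AE = subringE[OF AD(3)]
  let ?A = "B\<lparr>carrier := A\<rparr>"
  define m where "m n = ideal_pow ?A (M \<inter> A) n" for n
  define N where "N n = ideal_pow B M n" for n
  have Ni: "ideal (N n) B" for n unfolding N_def by (rule ideal_pow_ideal)
  have mi: "ideal (m n) ?A" and mN: "m n = N n \<inter> A" for n
    unfolding m_def N_def by (rule saturated_ideal_pow[OF sat rat dM])+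
  have m0: "\<zero> \<in> m n" for n
    unfolding mN using AE(2) additive_subgroup.zero_closed[OF ideal.axioms(1)[OF Ni]] by blast
  have Nsub: "N (Suc n) \<subseteq> N n" for n unfolding N_def by (rule ideal_pow_antimono)
  have msub: "m (Suc n) \<subseteq> m n" for n unfolding mN using Nsub by blast
  let ?h = "induced_completion_map B M"
  have h: "?h f n = f n <+>\<^bsub>B\<^esub> N n" for f n unfolding induced_completion_map_def N_def ..
  have T: "(m n +> a) <+>\<^bsub>B\<^esub> N n = N n +> a" if "a \<in> A" for n a
    by (rule coset_set_add[OF Ni _ m0]) (use mN that AD(4) in auto)
  have QA: "carrier (?A Quot m n) = {m n +> a | a. a \<in> A}" for n
    unfolding Quot_carrier a_r_coset_subring by simp
  have QB: "carrier (B Quot N n) = {N n +> a | a. a \<in> carrier B}" for n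
    by (rule Quot_carrier)
  have hom: "(m n +> a) \<otimes>\<^bsub>?A Quot m n\<^esub> (m n +> b) = m n +> (a \<otimes> b)"
      "(m n +> a) \<oplus>\<^bsub>?A Quot m n\<^esub> (m n +> b) = m n +> (a \<oplus> b)" if "a \<in> A" "b \<in> A" for n a b
    using ring_hom_mult[OF ideal.rcos_ring_hom[OF mi[of n]], of a b]
      ring_hom_add[OF ideal.rcos_ring_hom[OF mi[of n]], of a b] that
    by (simp_all add: a_r_coset_subring)
  have homB: "(N n +> a) \<otimes>\<^bsub>B Quot N n\<^esub> (N n +> b) = N n +> (a \<otimes> b)"
      "(N n +> a) \<oplus>\<^bsub>B Quot N n\<^esub> (N n +> b) = N n +> (a \<oplus> b)" if "a \<in> carrier B" "b \<in> carrier B" for n a b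
    using ring_hom_mult[OF ideal.rcos_ring_hom[OF Ni[of n]], of a b]
      ring_hom_add[OF ideal.rcos_ring_hom[OF Ni[of n]], of a b] that by simp_all
  have inj: "m n +> a = m n +> b" if ab: "a \<in> A" "b \<in> A" and eq: "N n +> a = N n +> b" for n a b
  proof -
    have c: "a \<in> carrier B" "b \<in> carrier B" using ab AD(4) by auto
    have "a \<ominus> b \<in> N n" using quotient_eq_iff_same_a_r_cos[OF Ni c] eq by blast
    moreover have amb: "a \<ominus> b \<in> A" using AE(7)[OF ab(1) AE(5)[OF ab(2)]] by (simp add: a_minus_def)
    ultimately have d: "a \<ominus> b \<in> m n" unfolding mN by blast
    have sub: "m n +> x \<subseteq> m n +> y" if xy: "x \<in> carrier B" "y \<in> carrier B" "x \<ominus> y \<in> m n" for x y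
    proof
      fix z assume "z \<in> m n +> x"
      then obtain i where i: "i \<in> m n" "z = i \<oplus> x" unfolding a_r_coset_def' by blast
      have ic: "i \<in> carrier B" using i(1) AD(4) unfolding mN by blast
      have "z = (i \<oplus> (x \<ominus> y)) \<oplus> y" unfolding i(2) using ic xy(1,2) by algebra
      moreover have "i \<oplus> (x \<ominus> y) \<in> m n"
        using additive_subgroup.a_closed[OF ideal.axioms(1)[OF mi[of n]] i(1) xy(3)] by simp
      ultimately show "z \<in> m n +> y" unfolding a_r_coset_def' by blast
    qed
    have "b \<ominus> a \<in> m n"
    proof -
      have "b \<ominus> a = (\<ominus> \<one>) \<otimes> (a \<ominus> b)" using c by algebra
      also have "\<dots> \<in> m n" using ideal.I_l_closed[OF mi[of n] d, of "\<ominus> \<one>"] AE(3,5) by simp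
      finally show ?thesis .
    qed
    then show ?thesis using sub[OF c d] sub[OF c(2,1)] by blast
  qed
  have surj: "\<exists>a\<in>A. C = N n +> a" if C: "C \<in> carrier (B Quot N n)" for n C
  proof -
    obtain b where b: "b \<in> carrier B" "C = N n +> b" using C unfolding QB by blast
    have "dense (N n)" unfolding N_def by (rule dense_ideal_pow[OF dM])
    then obtain t where t: "t \<in> N n" "b \<oplus> t \<in> A" using saturatedD(5)[OF sat _ b(1)] by blast
    have tc: "t \<in> carrier B" using t(1) ideal.Icarr[OF Ni] by blast
    have "(b \<oplus> t) \<ominus> b = t" using b(1) tc by algebra
    then have "N n +> (b \<oplus> t) = N n +> b"
      using quotient_eq_iff_same_a_r_cos[OF Ni _ b(1), of "b \<oplus> t"] b(1) tc t(1) by simp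
    then show ?thesis using t(2) b(2) by (intro bexI[of _ "b \<oplus> t"]) auto
  qed
  have carA: "f \<in> carrier (completion ?A (M \<inter> A)) \<longleftrightarrow>
      (\<forall>n. f n \<in> carrier (?A Quot m n)) \<and> (\<forall>n. f (Suc n) \<subseteq> f n)" for f
    unfolding completion_def m_def by simp
  have carB: "f \<in> carrier (completion B M) \<longleftrightarrow>
      (\<forall>n. f n \<in> carrier (B Quot N n)) \<and> (\<forall>n. f (Suc n) \<subseteq> f n)" for f
    unfolding completion_def N_def by simp
  have rep: "\<exists>a\<in>A. f n = m n +> a" if "f \<in> carrier (completion ?A (M \<inter> A))" for f n
    using that unfolding carA QA by blast
  show ?thesis
  proof (rule ring_iso_memI)
    fix f assume f: "f \<in> carrier (completion ?A (M \<inter> A))"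
    have "?h f n \<in> carrier (B Quot N n)" for n
    proof -
      obtain a where "a \<in> A" "f n = m n +> a" using rep[OF f] by blast
      then show ?thesis using h T QB AD(4) by auto
    qed
    moreover have "?h f (Suc n) \<subseteq> ?h f n" for n
    proof -
      have "f (Suc n) \<subseteq> f n" using f carA by blast
      then show ?thesis unfolding h set_add_def' using Nsub[of n] by blast
    qed
    ultimately show "?h f \<in> carrier (completion B M)" unfolding carB by blast
    fix g assume g: "g \<in> carrier (completion ?A (M \<inter> A))"
    show "?h (f \<otimes>\<^bsub>completion ?A (M \<inter> A)\<^esub> g) = ?h f \<otimes>\<^bsub>completion B M\<^esub> ?h g"
    proof
      fix n
      obtain a where a: "a \<in> A" "f n = m n +> a" using rep[OF f] by blast
      obtain b where b: "b \<in> A" "g n = m n +> b" using rep[OF g] by blast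
      have "(f \<otimes>\<^bsub>completion ?A (M \<inter> A)\<^esub> g) n = m n +> (a \<otimes> b)"
        using hom(1)[OF a(1) b(1)] a(2) b(2) unfolding completion_def m_def by simp
      then have "?h (f \<otimes>\<^bsub>completion ?A (M \<inter> A)\<^esub> g) n = N n +> (a \<otimes> b)"
        using h T[OF AE(6)[OF a(1) b(1)]] by simp
      moreover have "(?h f \<otimes>\<^bsub>completion B M\<^esub> ?h g) n = ?h f n \<otimes>\<^bsub>B Quot N n\<^esub> ?h g n"
        unfolding completion_def N_def by simp
      moreover have "\<dots> = N n +> (a \<otimes> b)"
        using h a b T homB(1) AD(4) by (simp add: subset_iff)
      ultimately show "?h (f \<otimes>\<^bsub>completion ?A (M \<inter> A)\<^esub> g) n = (?h f \<otimes>\<^bsub>completion B M\<^esub> ?h g) n" by simp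
    qed
    show "?h (f \<oplus>\<^bsub>completion ?A (M \<inter> A)\<^esub> g) = ?h f \<oplus>\<^bsub>completion B M\<^esub> ?h g"
    proof
      fix n
      obtain a where a: "a \<in> A" "f n = m n +> a" using rep[OF f] by blast
      obtain b where b: "b \<in> A" "g n = m n +> b" using rep[OF g] by blast
      have "(f \<oplus>\<^bsub>completion ?A (M \<inter> A)\<^esub> g) n = m n +> (a \<oplus> b)"
        using hom(2)[OF a(1) b(1)] a(2) b(2) unfolding completion_def m_def by simp
      then have "?h (f \<oplus>\<^bsub>completion ?A (M \<inter> A)\<^esub> g) n = N n +> (a \<oplus> b)"
        using h T[OF AE(7)[OF a(1) b(1)]] by simp
      moreover have "(?h f \<oplus>\<^bsub>completion B M\<^esub> ?h g) n = ?h f n \<oplus>\<^bsub>B Quot N n\<^esub> ?h g n"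
        unfolding completion_def N_def by simp
      moreover have "\<dots> = N n +> (a \<oplus> b)"
        using h a b T homB(2) AD(4) by (simp add: subset_iff)
      ultimately show "?h (f \<oplus>\<^bsub>completion ?A (M \<inter> A)\<^esub> g) n = (?h f \<oplus>\<^bsub>completion B M\<^esub> ?h g) n" by simp
    qed
  next
    show "?h \<one>\<^bsub>completion ?A (M \<inter> A)\<^esub> = \<one>\<^bsub>completion B M\<^esub>"
    proof
      fix n
      have "\<one>\<^bsub>completion ?A (M \<inter> A)\<^esub> n = m n +> \<one>"
        unfolding completion_def m_def by (simp add: FactRing_def a_r_coset_subring)
      then have "?h \<one>\<^bsub>completion ?A (M \<inter> A)\<^esub> n = N n +> \<one>" using h T[OF AE(3)] by simp
      also have "\<dots> = \<one>\<^bsub>completion B M\<^esub> n"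
        unfolding completion_def N_def by (simp add: FactRing_def)
      finally show "?h \<one>\<^bsub>completion ?A (M \<inter> A)\<^esub> n = \<one>\<^bsub>completion B M\<^esub> n" .
    qed
  next
    show "bij_betw ?h (carrier (completion ?A (M \<inter> A))) (carrier (completion B M))"
      unfolding bij_betw_def
    proof (intro conjI)
      show "inj_on ?h (carrier (completion ?A (M \<inter> A)))"
      proof (rule inj_onI)
        fix f g assume f: "f \<in> carrier (completion ?A (M \<inter> A))" and g: "g \<in> carrier (completion ?A (M \<inter> A))"
          and eq: "?h f = ?h g"
        show "f = g"
        proof
          fix n
          obtain a where a: "a \<in> A" "f n = m n +> a" using rep[OF f] by blast
          obtain b where b: "b \<in> A" "g n = m n +> b" using rep[OF g] by blast
          have "?h f n = ?h g n" by (rule fun_cong[OF eq])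
          then have "N n +> a = N n +> b" unfolding h a(2) b(2) T[OF a(1)] T[OF b(1)] .
          then show "f n = g n" unfolding a(2) b(2) by (rule inj[OF a(1) b(1)])
        qed
      qed
      show "?h ` carrier (completion ?A (M \<inter> A)) = carrier (completion B M)"
      proof
        show "carrier (completion B M) \<subseteq> ?h ` carrier (completion ?A (M \<inter> A))"
        proof
          fix F assume F: "F \<in> carrier (completion B M)"
          have "\<forall>n. \<exists>a. a \<in> A \<and> F n = N n +> a" using F surj unfolding carB by blast
          then obtain a where a: "\<And>n. a n \<in> A" "\<And>n. F n = N n +> a n" by metis
          define f where "f n = m n +> a n" for n
          \<comment> \<open>The representatives \<open>a n\<close> were chosen independently for
            each \<open>n\<close>; their compatibility follows from that of \<open>F\<close> by
            injectivity at level \<open>n\<close>.\<close>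
          have "f (Suc n) \<subseteq> f n" for n
          proof -
            have c: "a n \<in> carrier B" "a (Suc n) \<in> carrier B" using a(1) AD(4) by auto
            have "a (Suc n) \<in> F (Suc n)" unfolding a(2)
              using abelian_subgroup.a_rcos_self[OF abelian_subgroupI3[OF ideal.axioms(1)[OF Ni] abelian_group_axioms] c(2)] .
            then have "a (Suc n) \<in> F n" using F carB by blast
            then obtain i where i: "i \<in> N n" "a (Suc n) = i \<oplus> a n" unfolding a(2) a_r_coset_def' by blast
            have ic: "i \<in> carrier B" using i(1) ideal.Icarr[OF Ni] by blast
            have "a (Suc n) \<ominus> a n = i" unfolding i(2) using ic c(1) by algebra
            then have "N n +> a (Suc n) = N n +> a n"
              using quotient_eq_iff_same_a_r_cos[OF Ni c(2,1)] i(1) by simp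
            then have "m n +> a (Suc n) = m n +> a n" by (rule inj[OF a(1) a(1)])
            moreover have "m (Suc n) +> a (Suc n) \<subseteq> m n +> a (Suc n)"
              unfolding a_r_coset_def' using msub[of n] by blast
            ultimately show ?thesis unfolding f_def by blast
          qed
          then have "f \<in> carrier (completion ?A (M \<inter> A))" unfolding carA QA f_def using a(1) by blast
          moreover have "?h f = F"
          proof
            fix n show "?h f n = F n" unfolding h f_def a(2) by (rule T[OF a(1)])
          qed
          ultimately show "F \<in> ?h ` carrier (completion ?A (M \<inter> A))" by blast
        qed
        show "?h ` carrier (completion ?A (M \<inter> A)) \<subseteq> carrier (completion B M)"
        proof
          fix F assume "F \<in> ?h ` carrier (completion ?A (M \<inter> A))"
          then obtain f where f: "f \<in> carrier (completion ?A (M \<inter> A))" "F = ?h f" by blast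
          have "?h f n \<in> carrier (B Quot N n)" for n
          proof -
            obtain a where "a \<in> A" "f n = m n +> a" using rep[OF f(1)] by blast
            then show ?thesis using h T QB AD(4) by auto
          qed
          moreover have "?h f (Suc n) \<subseteq> ?h f n" for n
          proof -
            have "f (Suc n) \<subseteq> f n" using f carA by blast
            then show ?thesis unfolding h set_add_def' using Nsub[of n] by blast
          qed
          ultimately show "F \<in> carrier (completion B M)" unfolding carB f(2) by blast
        qed
      qed
    qed
  qed
qed


subsection \<open>The initial ring\<close>

definition int_image :: "'b set" where
  "int_image = range (\<lambda>k::int. [k] \<cdot> \<one>)"

lemma int_image_subring: "subring int_image B"
proof (rule subringI)
  show "int_image \<subseteq> carrier B" unfolding int_image_def by auto
  show "\<one> \<in> int_image" unfolding int_image_def by (rule range_eqI[of _ _ 1]) simp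
  fix a assume "a \<in> int_image"
  then obtain k :: int where a: "a = [k] \<cdot> \<one>" unfolding int_image_def by blast
  have "\<ominus> a = [(- k)] \<cdot> \<one>" unfolding a by (simp add: add.int_pow_neg)
  then show "\<ominus> a \<in> int_image" unfolding int_image_def by blast
  fix b assume "b \<in> int_image"
  then obtain l :: int where b: "b = [l] \<cdot> \<one>" unfolding int_image_def by blast
  have "a \<oplus> b = [(k + l)] \<cdot> \<one>" unfolding a b by (simp add: add.int_pow_mult)
  then show "a \<oplus> b \<in> int_image" unfolding int_image_def by blast
  have "a \<otimes> b = [k] \<cdot> ([l] \<cdot> \<one>)" unfolding a b using add_pow_ldistr_int[of \<one> "[l] \<cdot> \<one>" k] by simp
  also have "\<dots> = [(l * k)] \<cdot> \<one>" by (simp add: add.int_pow_pow)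
  finally show "a \<otimes> b \<in> int_image" unfolding int_image_def by blast
qed

lemma int_image_unit:
  assumes rat: "contains_rationals B" and a: "a \<in> int_image" "a \<noteq> \<zero>"
  shows "a \<notin> M"
proof
  assume aM: "a \<in> M"
  obtain k :: int where k: "a = [k] \<cdot> \<one>" using a(1) unfolding int_image_def by blast
  have k0: "k \<noteq> 0" using k a(2) by (auto simp: add_pow_def)
  have u: "[n] \<cdot> \<one> \<notin> M" if "0 < n" for n :: nat
    using rat that Units_iff unfolding contains_rationals_def by blast
  show False
  proof (cases "k > 0")
    case True
    then have "a = [(nat k)] \<cdot> \<one>" using k by (metis add_pow_int_ge int_nat_eq less_imp_le nat_0_le)
    then show False using u[of "nat k"] True aM by simp
  next
    case False
    then have "\<ominus> a = [(nat (- k))] \<cdot> \<one>"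
      using k k0 by (simp add: add_pow_int_lt)
    moreover have "\<ominus> a \<in> M" using aM by simp
    ultimately show False using u[of "nat (- k)"] False k0 by simp
  qed
qed

text \<open>A copy of the rationals in \<open>B\<close>. Its nonzero elements are units of
  \<open>B\<close>, so it has no atoms and goodness is vacuous, and it meets each prime in zero
  only.\<close>

lemma rational_subring:
  assumes rat: "contains_rationals B" and unc: "uncountable (carrier (B Quot M))"
  shows "\<exists>R. good R \<and> infinite R \<and> |R| <o |carrier (B Quot M)| \<and>
    (\<forall>P. primeideal P B \<longrightarrow> R \<inter> P \<subseteq> {\<zero>})"
proof -
  let ?Z = int_image
  note ZE = subringE[OF int_image_subring]
  \<comment> \<open>Adjoining zero changes nothing; it only presents the ring as an
    \<open>adjoin\<close>, so that \<open>adjoin_card\<close> bounds its size.\<close>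
  have "simple_extension ?Z \<zero> \<subseteq> ?Z"
  proof
    fix y assume "y \<in> simple_extension ?Z \<zero>"
    then show "y \<in> ?Z"
      by (induction rule: simple_extension.induct) (use ZE in auto)
  qed
  then have T: "simple_extension ?Z \<zero> = ?Z"
    using simple_extension_incl[OF ZE(1) zero_closed] by blast
  define R where "R = adjoin ?Z \<zero>"
  have R: "R = fractions ?Z ?Z" unfolding R_def adjoin_def T ..
  have Rf: "frac_closed R" unfolding R by (rule frac_closed_fractions[OF int_image_subring])
  have noM: "b = \<zero>" if b: "b \<in> R" "b \<in> M" for b
  proof (rule ccontr)
    assume "b \<noteq> \<zero>"
    obtain d where d: "b \<in> carrier B" "d \<in> ?Z" "d \<noteq> \<zero>" "d \<otimes> b \<in> ?Z"
      using b(1) unfolding R by (rule fractionsE)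
    have dc: "d \<in> carrier B" using d ZE(1) by blast
    have "d \<otimes> b \<noteq> \<zero>" using d(1,3) dc \<open>b \<noteq> \<zero>\<close> integral_iff by blast
    then show False using int_image_unit[OF rat d(4)] M.I_l_closed[OF b(2) dc] by blast
  qed
  have "good R" unfolding good_def
  proof (intro conjI allI impI Rf)
    fix p assume "atom R p"
    then show "strong_prime R p" using noM[of p] unfolding atom_def by blast
  qed
  moreover have Rinf: "infinite R" by (rule infinite_subring[OF rat frac_closedD(1)[OF Rf]])
  moreover have "|R| <o |carrier (B Quot M)|"
  proof -
    have Zinf: "infinite ?Z" by (rule infinite_subring[OF rat int_image_subring])
    have RZ: "|R| \<le>o |?Z|" unfolding R_def by (rule adjoin_card[OF int_image_subring zero_closed Zinf])
    have "\<not> |carrier (B Quot M)| \<le>o |?Z|"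
    proof
      assume "|carrier (B Quot M)| \<le>o |?Z|"
      then obtain f where "inj_on f (carrier (B Quot M))" "f ` carrier (B Quot M) \<subseteq> ?Z"
        unfolding card_of_ordLeq[symmetric] by blast
      moreover have "countable ?Z" unfolding int_image_def by simp
      ultimately have "countable (carrier (B Quot M))"
        using countable_subset countable_image_inj_on by metis
      then show False using unc by simp
    qed
    then have "|?Z| <o |carrier (B Quot M)|"
      by (simp add: not_ordLeq_iff_ordLess card_of_Well_order)
    then show ?thesis by (rule ordLeq_ordLess_trans[OF RZ])
  qed
  moreover have "R \<inter> P \<subseteq> {\<zero>}" if "primeideal P B" for P
    using noM prime_subset_M[OF that] by blast
  ultimately show ?thesis by blast
qed

text \<open>
  Generic elements of the height one primes are adjoined one at a time; the primes not treated
  yet must keep meeting the ring in zero only.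
\<close>
lemma exists_initial_ring:
  assumes rat: "contains_rationals B" and unc: "uncountable (carrier (B Quot M))"
    and P: "finite P" "\<And>p. p \<in> P \<Longrightarrow> primeideal p B \<and> p \<noteq> {\<zero>}"
    and P_Ass: "\<And>p b q. p \<in> P \<Longrightarrow> b \<in> carrier B \<Longrightarrow> q \<in> Ass_quot B b \<Longrightarrow> p \<subseteq> q \<Longrightarrow> q = p"
    and P_anti: "\<And>p p'. p \<in> P \<Longrightarrow> p' \<in> P \<Longrightarrow> p \<subseteq> p' \<Longrightarrow> p' = p"
    and Y: "finite Y" "\<And>q. q \<in> Y \<Longrightarrow> primeideal q B"
  shows "\<exists>R x. good R \<and> infinite R \<and> |R| <o |carrier (B Quot M)| \<and>
    (\<forall>p\<in>P. strong_prime R (x p) \<and> x p \<in> p \<and> (\<forall>q\<in>Y. \<not> p \<subseteq> q \<longrightarrow> x p \<notin> q))"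
proof -
  have "\<exists>R x. good R \<and> infinite R \<and> |R| <o |carrier (B Quot M)| \<and>
    (\<forall>p\<in>F. strong_prime R (x p) \<and> x p \<in> p \<and> (\<forall>q\<in>Y. \<not> p \<subseteq> q \<longrightarrow> x p \<notin> q)) \<and>
    (\<forall>p\<in>P - F. R \<inter> p \<subseteq> {\<zero>})" if "finite F" "F \<subseteq> P" for F
    using that
  proof (induction rule: finite_induct)
    case empty
    then show ?case using rational_subring[OF rat unc] P(2) by blast
  next
    case (insert p F)
    then obtain R x where R: "good R" "infinite R" "|R| <o |carrier (B Quot M)|"
      and x: "\<forall>p\<in>F. strong_prime R (x p) \<and> x p \<in> p \<and> (\<forall>q\<in>Y. \<not> p \<subseteq> q \<longrightarrow> x p \<notin> q)"
      and RF: "\<forall>p\<in>P - F. R \<inter> p \<subseteq> {\<zero>}" by auto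
    note RD = goodD[OF R(1)]
    have pP: "p \<in> P" "p \<notin> F" using insert by auto
    have pr: "primeideal p B" "p \<noteq> {\<zero>}" using P(2)[OF pP(1)] by auto
    have pid: "ideal p B" by (rule primeideal.axioms(1)[OF pr(1)])
    \<comment> \<open>The zero ideal forces \<open>t \<noteq> \<zero>\<close>, the untreated primes
      keep their zero intersection with the ring, and the members of \<open>Y\<close> not above
      \<open>p\<close> will not contain \<open>t\<close>, which later reflects the order.\<close>
    define Q' where "Q' = insert {\<zero>} ((P - insert p F) \<union> {q \<in> Y. \<not> p \<subseteq> q})"
    define Q where "Q = critical_primes R \<union> Q'"
    have "finite Q'" unfolding Q'_def using P(1) Y(1) by simp
    then have "|Q'| \<le>o |R|"
      by (intro ordLess_imp_ordLeq finite_ordLess_infinite2 R(2))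
    then have Qc: "|Q| \<le>o |R|"
      unfolding Q_def using card_critical_primes[OF R(2)] R(2)
      by (intro card_of_Un_ordLeq_infinite_Field card_of_Card_order) (simp_all add: Field_card_of)
    have Qp: "primeideal q B \<and> \<not> p \<subseteq> q" if q: "q \<in> Q" for q
    proof -
      consider "q \<in> critical_primes R" | "q = {\<zero>}" | "q \<in> P - insert p F" | "q \<in> Y" "\<not> p \<subseteq> q"
        using q unfolding Q_def Q'_def by blast
      then show ?thesis
      proof cases
        case 1
        then obtain a where a: "strong_prime R a" "q \<in> Ass_quot B a" "primeideal q B"
          by (rule critical_primesD)
        note aD = strong_primeD[OF a(1)]
        \<comment> \<open>An associated prime of an old prime \<open>a\<close> that contains
          \<open>p\<close> equals \<open>p\<close>, which would put the nonzero \<open>a\<close>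
          into \<open>R \<inter> p\<close>; but \<open>p\<close> is still untreated.\<close>
        have "\<not> p \<subseteq> q"
        proof
          assume "p \<subseteq> q"
          then have "q = p" by (rule P_Ass[OF pP(1) aD(4) a(2)])
          then have "a \<in> R \<inter> p" using Ass_quotD(2)[OF a(2) aD(4)] aD(1) by blast
          then show False using RF pP aD(3) by blast
        qed
        then show ?thesis using a(3) by blast
      next
        case 2
        have "\<zero> \<in> p" using additive_subgroup.zero_closed[OF ideal.axioms(1)[OF pid]] .
        then show ?thesis using 2 pr(2) zeroprimeideal by blast
      next
        case 3
        then show ?thesis using P(2) P_anti[OF pP(1)] by blast
      next
        case 4
        then show ?thesis using Y(2) by blast
      qed
    qed
    obtain t where t: "t \<in> p" "\<forall>q\<in>Q. transcendental_mod R (\<zero> \<oplus> t) q"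
      using exists_transcendental[OF RD(3) R(2,3) Qc Qp pid zero_closed] by blast
    have tc: "t \<in> carrier B" using ideal.Icarr[OF pid t(1)] .
    have tr: "transcendental_mod R t q" if "q \<in> Q" for q using t(2) that tc by simp
    have notin: "t \<notin> q" if "q \<in> Q" for q
      using transcendental_mod_notin[OF tr[OF that] _ RD(2) tc] Qp[OF that] by blast
    have t0: "t \<noteq> \<zero>" using notin[of "{\<zero>}"] unfolding Q_def Q'_def by blast
    have tM: "t \<in> M" using t(1) prime_subset_M[OF pr(1)] by blast
    have crit: "q \<in> Q" if "strong_prime R a" "q \<in> Ass_quot B a" for a q
      using that unfolding Q_def critical_primes_def by blast
    have reg: "regular t a" if a: "strong_prime R a" for a
    proof (rule ccontr)
      assume "\<not> regular t a"
      then obtain q where "q \<in> Ass_quot B a" "t \<in> q"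
        using Ass_of_not_regular[OF strong_primeD(4)[OF a] tc] by blast
      then show False using notin crit[OF a] by blast
    qed
    define S where "S = adjoin R t"
    have S: "good S" "extends R S"
      unfolding S_def using good_adjoin[OF R(1) tc] tr crit by blast+
    have St: "strong_prime S t" unfolding S_def by (rule strong_prime_adjoin[OF R(1) tM t0 reg])
    have SR: "|S| \<le>o |R|" unfolding S_def by (rule adjoin_card[OF RD(2) tc R(2)])
    have Sc: "|S| <o |carrier (B Quot M)|" by (rule ordLeq_ordLess_trans[OF SR R(3)])
    have Sinf: "infinite S" using S(2) R(2) infinite_super unfolding extends_def by blast
    have SF: "S \<inter> p' \<subseteq> {\<zero>}" if p': "p' \<in> P - insert p F" for p'
    proof -
      have "p' \<in> Q" unfolding Q_def Q'_def using p' by blast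
      then show ?thesis unfolding S_def
        using adjoin_inter_prime[OF RD(2) tc _ tr, of p'] P(2) RF p' by blast
    qed
    have tY: "\<forall>q\<in>Y. \<not> p \<subseteq> q \<longrightarrow> t \<notin> q" using notin unfolding Q_def Q'_def by blast
    have "\<forall>p'\<in>insert p F. strong_prime S ((x(p := t)) p') \<and> (x(p := t)) p' \<in> p' \<and>
        (\<forall>q\<in>Y. \<not> p' \<subseteq> q \<longrightarrow> (x(p := t)) p' \<notin> q)"
    proof
      fix p' assume p': "p' \<in> insert p F"
      show "strong_prime S ((x(p := t)) p') \<and> (x(p := t)) p' \<in> p' \<and>
        (\<forall>q\<in>Y. \<not> p' \<subseteq> q \<longrightarrow> (x(p := t)) p' \<notin> q)"
      proof (cases "p' = p")
        case True
        then show ?thesis using St t(1) tY by simp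
      next
        case False
        then have "p' \<in> F" using p' by blast
        then show ?thesis using False x S(2) unfolding extends_def by simp
      qed
    qed
    then show ?case using S(1) Sinf Sc SF by blast
  qed
  from this[OF P(1) subset_refl] show ?thesis by blast
qed

text \<open>
  If \<open>b\<close> in \<open>P \<inter> A\<close> were not a multiple of \<open>x\<close>, then it would be a nonzerodivisor modulo \<open>x\<close>, so
  some prime over \<open>x\<close> would lie in \<open>P\<close> and avoid \<open>b\<close>.
\<close>
lemma height_one_contraction:
  assumes A: "frac_closed A" and x: "strong_prime A x" "x \<in> P" and P: "primeideal P B"
    and ht: "\<And>N. primeideal N B \<Longrightarrow> N \<subseteq> P \<Longrightarrow> N = {\<zero>} \<or> N = P"
  shows "P \<inter> A = PIdl\<^bsub>B\<lparr>carrier := A\<rparr>\<^esub> x"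
proof
  note xD = strong_primeD[OF x(1)]
  have Ac: "A \<subseteq> carrier B" using frac_closedD(2)[OF A] .
  interpret P: primeideal P B by fact
  show "PIdl\<^bsub>B\<lparr>carrier := A\<rparr>\<^esub> x \<subseteq> P \<inter> A"
    unfolding cgenideal_def
    using x(2) xD(1) Ac P.I_l_closed subringE(6)[OF frac_closedD(1)[OF A]] by auto
  show "P \<inter> A \<subseteq> PIdl\<^bsub>B\<lparr>carrier := A\<rparr>\<^esub> x"
  proof
    fix b assume b: "b \<in> P \<inter> A"
    have bc: "b \<in> carrier B" using b Ac by blast
    have "x divides b"
    proof (rule ccontr)
      assume "\<not> x divides b"
      then have reg: "regular b x" using xD(5)[of b] b by blast
      have reg_pow: "regular (b [^] (k::nat)) x" for k
      proof (induction k)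
        case 0
        show ?case using regular_unit[of \<one>, OF _ xD(4)] by simp
      next
        case (Suc k)
        then show ?case using regular_mult[OF Suc reg] bc by simp
      qed
      \<comment> \<open>\<open>W\<close> contains both the complement of \<open>P\<close> and
        \<open>b\<close>, so a prime missing \<open>W\<close> lies inside \<open>P\<close> and is
        different from it.\<close>
      define W where "W = {s \<otimes> b [^] (k::nat) | s k. s \<in> carrier B - P}"
      have P1: "\<one> \<in> carrier B - P" using P.one_imp_carrier P.I_notcarr by blast
      have W1: "s \<in> W" if "s \<in> carrier B - P" for s
      proof -
        have "s = s \<otimes> b [^] (0::nat)" using that by simp
        then show ?thesis unfolding W_def using that by blast
      qed
      have Wc: "W \<subseteq> carrier B" unfolding W_def using bc by auto
      have Wm: "v \<otimes> w \<in> W" if "v \<in> W" "w \<in> W" for v w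
      proof -
        obtain s k r l where v: "v = s \<otimes> b [^] (k::nat)" "s \<in> carrier B - P"
          and w: "w = r \<otimes> b [^] (l::nat)" "r \<in> carrier B - P"
          using \<open>v \<in> W\<close> \<open>w \<in> W\<close> unfolding W_def by blast
        have "v \<otimes> w = (s \<otimes> r) \<otimes> (b [^] k \<otimes> b [^] l)"
          unfolding v(1) w(1) using v(2) w(2) nat_pow_closed[OF bc] by (simp add: m_ac)
        also have "b [^] k \<otimes> b [^] l = b [^] (k + l)" by (rule nat_pow_mult[OF bc])
        finally have "v \<otimes> w = (s \<otimes> r) \<otimes> b [^] (k + l)" .
        moreover have "s \<otimes> r \<in> carrier B - P" using v(2) w(2) P.I_prime by auto
        ultimately show ?thesis unfolding W_def by blast
      qed
      have "PIdl x \<inter> W = {}"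
      proof (rule ccontr)
        assume "PIdl x \<inter> W \<noteq> {}"
        then obtain s k where s: "s \<in> carrier B - P" "s \<otimes> b [^] (k::nat) \<in> PIdl x"
          unfolding W_def by blast
        have sc: "s \<in> carrier B" using s(1) by simp
        have "x divides (b [^] k \<otimes> s)"
          using s(2) mem_PIdl_iff_divides[OF xD(4)] m_comm[OF sc nat_pow_closed[OF bc]] by simp
        then have "x divides s" by (rule regularD[OF reg_pow sc])
        then show False using s(1) P.I_r_closed[OF x(2)] unfolding factor_def by blast
      qed
      then obtain N where N: "primeideal N B" "PIdl x \<subseteq> N" "N \<inter> W = {}"
        using exists_prime_disjoint[OF is_cring cgenideal_ideal[OF xD(4)] Wc W1[OF P1] Wm] by blast
      have Nc: "N \<subseteq> carrier B"
        using additive_subgroup.a_subset[OF ideal.axioms(1)[OF primeideal.axioms(1)[OF N(1)]]] .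
      have "N \<subseteq> P" using W1 N(3) Nc by blast
      moreover have "b \<in> W"
      proof -
        have "b = \<one> \<otimes> b [^] (1::nat)" using bc by simp
        then show ?thesis unfolding W_def using P1 by blast
      qed
      then have "N \<noteq> P" using N(3) b by blast
      ultimately have "N = {\<zero>}" using ht[OF N(1)] by blast
      then show False using N(2) cgenideal_self[OF xD(4)] xD(3) by blast
    qed
    then obtain c where c: "c \<in> A" "b = x \<otimes> c"
      using frac_closed_divides[OF A xD(1,3), of b] b by blast
    then have "b = c \<otimes> x" using xD(4) Ac m_comm by auto
    then show "b \<in> PIdl\<^bsub>B\<lparr>carrier := A\<rparr>\<^esub> x" unfolding cgenideal_def using c(1) by auto
  qed
qed

text \<open>Density of the primes strictly above \<open>p\<close> means that an associated prime of
  a principal ideal containing \<open>p\<close> is \<open>p\<close> itself, which is what generic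
  choices inside \<open>p\<close> require. \<open>Y\<close> is a parameter for the image of the
  poset, against which the generators must separate.\<close>

theorem exists_saturated_with_primes:
  assumes rat: "contains_rationals B" and unc: "uncountable (carrier (B Quot M))"
    and card: "|carrier B| \<le>o |carrier (B Quot M)|"
    and P: "finite P" "\<And>p. p \<in> P \<Longrightarrow> primeideal p B \<and> p \<noteq> {\<zero>}"
    and ht: "\<And>p N. p \<in> P \<Longrightarrow> primeideal N B \<Longrightarrow> N \<subseteq> p \<Longrightarrow> N = {\<zero>} \<or> N = p"
    and above: "\<And>p Q. p \<in> P \<Longrightarrow> primeideal Q B \<Longrightarrow> p \<subset> Q \<Longrightarrow> dense Q"
    and Y: "finite Y" "\<And>q. q \<in> Y \<Longrightarrow> primeideal q B"
  shows "\<exists>A x. saturated A \<and> (\<forall>p\<in>P. x p \<in> A \<and> x p \<noteq> \<zero> \<and> x p \<in> p \<and>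
     p \<inter> A = PIdl\<^bsub>B\<lparr>carrier := A\<rparr>\<^esub> (x p) \<and> (\<forall>q\<in>Y. \<not> p \<subseteq> q \<longrightarrow> x p \<notin> q))"
proof -
  have P_Ass: "q = p" if "p \<in> P" "b \<in> carrier B" "q \<in> Ass_quot B b" "p \<subseteq> q" for p b q
  proof (rule ccontr)
    assume "q \<noteq> p"
    then have "dense q" using above[OF that(1) Ass_quotD(1)[OF that(3,2)]] that(4) by blast
    then show False using that(2,3) unfolding dense_def by blast
  qed
  have P_anti: "p' = p" if "p \<in> P" "p' \<in> P" "p \<subseteq> p'" for p p'
    using ht[OF that(2) _ that(3)] P(2)[OF that(1)] by blast
  have "\<exists>R x. good R \<and> infinite R \<and> |R| <o |carrier (B Quot M)| \<and>
    (\<forall>p\<in>P. strong_prime R (x p) \<and> x p \<in> p \<and> (\<forall>q\<in>Y. \<not> p \<subseteq> q \<longrightarrow> x p \<notin> q))"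
    by (rule exists_initial_ring[OF rat unc P _ _ Y]) (assumption | rule P_Ass P_anti)+
  then obtain R x where R: "good R" "infinite R" "|R| <o |carrier (B Quot M)|"
    and x: "\<forall>p\<in>P. strong_prime R (x p) \<and> x p \<in> p \<and> (\<forall>q\<in>Y. \<not> p \<subseteq> q \<longrightarrow> x p \<notin> q)"
    by blast
  obtain A where A: "saturated A" "extends R A"
    using exists_saturated_extension[OF R card] unfolding saturated_def by blast
  have "x p \<in> A \<and> x p \<noteq> \<zero> \<and> x p \<in> p \<and> p \<inter> A = PIdl\<^bsub>B\<lparr>carrier := A\<rparr>\<^esub> (x p) \<and>
      (\<forall>q\<in>Y. \<not> p \<subseteq> q \<longrightarrow> x p \<notin> q)" if p: "p \<in> P" for p
  proof -
    have sp: "strong_prime A (x p)" using x p A(2) unfolding extends_def by blast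
    have "p \<inter> A = PIdl\<^bsub>B\<lparr>carrier := A\<rparr>\<^esub> (x p)"
      by (rule height_one_contraction[OF saturatedD(2)[OF A(1)] sp _ _ ht[OF p]]) (use x p P(2) in blast)+
    then show ?thesis using strong_primeD(1,3)[OF sp] x p by blast
  qed
  then show ?thesis using A(1) by blast
qed

end

subsection \<open>Chains in the poset\<close>

text \<open>A finite supremum bounds the set, which is then finite and attains it, unless the set is
  empty: the supremum of the empty set is \<open>0\<close>, whence
  \<open>n \<noteq> 0\<close>.\<close>

lemma Sup_enat_mem:
  fixes D :: "enat set"
  assumes "Sup D = enat n" "n \<noteq> 0"
  shows "enat n \<in> D"
proof -
  have ne: "D \<noteq> {}" using assms by (auto simp: Sup_enat_def zero_enat_def split: if_splits)
  moreover have "finite D" using assms ne by (auto simp: Sup_enat_def split: if_splits)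
  ultimately have "Sup D = Max D" by (simp add: Sup_enat_def)
  then show ?thesis using Max_in[OF \<open>finite D\<close> ne] assms(1) by simp
qed

lemma chain_Cons:
  assumes l: "is_chain S lr l" and y: "y \<in> S" "\<And>z. z \<in> set l \<Longrightarrow> strictly lr y z"
  shows "is_chain S lr (y # l)"
  using assms unfolding is_chain_def by auto

lemma chain_length_le_dim:
  assumes "is_chain S lr l" "poset_dim S lr = enat n"
  shows "length l - 1 \<le> n"
proof -
  have "enat (length l - 1) \<le> poset_dim S lr"
    unfolding poset_dim_def by (rule Sup_upper) (use assms(1) in blast)
  then show ?thesis using assms(2) by simp
qed

lemma maximal_chain:
  assumes "poset_dim S lr = enat n" "n \<noteq> 0"
  obtains l where "is_chain S lr l" "length l = Suc n"
proof -
  have "enat n \<in> {enat (length l - 1) | l. is_chain S lr l}"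
    using assms unfolding poset_dim_def by (rule Sup_enat_mem)
  then obtain l where "is_chain S lr l" "length l - 1 = n" by auto
  then show ?thesis using that[of l] assms(2) by simp
qed

lemma maximal_chain_hd_minimal:
  fixes S :: "'x::order set"
  assumes dim: "poset_dim S (\<le>) = enat n" and l: "is_chain S (\<le>) l" "length l = Suc n"
  shows "hd l \<in> minimal_elems S (\<le>)"
proof (rule ccontr)
  assume n: "\<not> ?thesis"
  obtain a r where ar: "l = a # r" using l(2) by (cases l) auto
  then have "a \<in> S" using l(1) unfolding is_chain_def by auto
  then obtain y where y: "y \<in> S" "strictly (\<le>) y a" using n ar unfolding minimal_elems_def by auto
  have "strictly (\<le>) y z" if "z \<in> set l" for z
    using that y(2) l(1) ar unfolding is_chain_def strictly_def by auto
  then have "is_chain S (\<le>) (y # l)" by (rule chain_Cons[OF l(1) y(1)])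
  then show False using chain_length_le_dim[OF _ dim] l(2) by fastforce
qed

lemma saturated_embedding_strictly:
  fixes S :: "'x::order set"
  assumes emb: "saturated_embedding S (\<le>) T (\<subseteq>) \<psi>" and xy: "x \<in> S" "y \<in> S"
  shows "strictly (\<le>) x y \<longleftrightarrow> \<psi> x \<subset> \<psi> y"
proof -
  have "x \<le> y \<longleftrightarrow> \<psi> x \<subseteq> \<psi> y" "y \<le> x \<longleftrightarrow> \<psi> y \<subseteq> \<psi> x"
    using emb xy unfolding saturated_embedding_def by auto
  then show ?thesis unfolding strictly_def by auto
qed

lemma embedded_chain:
  fixes S :: "'x::order set"
  assumes emb: "saturated_embedding S (\<le>) T (\<subseteq>) \<psi>" and l: "is_chain S (\<le>) l"
  shows "is_chain T (\<subseteq>) (map \<psi> l)"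
proof -
  have S: "set l \<subseteq> S" using l unfolding is_chain_def by blast
  have "sorted_wrt (\<lambda>x y. strictly (\<subseteq>) (\<psi> x) (\<psi> y)) l"
  proof (rule sorted_wrt_mono_rel[of l "strictly (\<le>)"])
    fix x y assume "x \<in> set l" "y \<in> set l" "strictly (\<le>) x y"
    then show "strictly (\<subseteq>) (\<psi> x) (\<psi> y)"
      using saturated_embedding_strictly[OF emb, of x y] S unfolding strictly_def by blast
  qed (use l in \<open>simp add: is_chain_def\<close>)
  moreover have "\<psi> ` set l \<subseteq> T" using emb S unfolding saturated_embedding_def by auto
  ultimately show ?thesis using l unfolding is_chain_def by (auto simp: sorted_wrt_map)
qed

text \<open>Here preservation of dimension enters: the image of a longest chain already has the
  length \<open>dim B\<close>, so the zero ideal cannot be added below it.\<close>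

lemma embedded_bottom:
  fixes S :: "'x::order set"
  assumes emb: "saturated_embedding S (\<le>) (Spec B) (\<subseteq>) \<psi>" and B: "domain B"
    and dim: "poset_dim S (\<le>) = enat n" "poset_dim (Spec B) (\<subseteq>) = enat n"
    and l: "is_chain S (\<le>) l" "length l = Suc n"
  shows "\<psi> (hd l) = {\<zero>\<^bsub>B\<^esub>}"
proof (rule ccontr)
  assume ne: "\<psi> (hd l) \<noteq> {\<zero>\<^bsub>B\<^esub>}"
  obtain a r where ar: "l = a # r" using l(2) by (cases l) auto
  note ch = embedded_chain[OF emb l(1)]
  have zero: "\<zero>\<^bsub>B\<^esub> \<in> q" if "q \<in> Spec B" for q
    using that additive_subgroup.zero_closed[OF ideal.axioms(1)[OF primeideal.axioms(1)]]
    unfolding Spec_def by blast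
  have "strictly (\<subseteq>) {\<zero>\<^bsub>B\<^esub>} z" if z: "z \<in> set (map \<psi> l)" for z
  proof -
    have "z \<in> Spec B" using ch z unfolding is_chain_def by blast
    moreover have "\<psi> a \<subseteq> z" using z ch ar unfolding is_chain_def strictly_def by auto
    moreover have "\<psi> a \<in> Spec B" using ch ar unfolding is_chain_def by auto
    ultimately show ?thesis using ne zero ar unfolding strictly_def by fastforce
  qed
  moreover have "{\<zero>\<^bsub>B\<^esub>} \<in> Spec B" using domain.zeroprimeideal[OF B] unfolding Spec_def by simp
  ultimately have "is_chain (Spec B) (\<subseteq>) ({\<zero>\<^bsub>B\<^esub>} # map \<psi> l)" using chain_Cons[OF ch] by blast
  then show False using chain_length_le_dim[OF _ dim(2)] l(2) by fastforce
qed

lemma height_one_covers: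
  assumes "poset_ht S (\<le>) (x :: 'x::order) = 1"
  shows "\<exists>a\<in>minimal_elems S (\<le>). covers S (\<le>) a x"
proof -
  have "enat 1 \<in> {enat (length l - 1) | l. is_saturated_chain S (\<le>) l \<and>
      hd l \<in> minimal_elems S (\<le>) \<and> last l = x}"
    using assms unfolding poset_ht_def by (intro Sup_enat_mem) (simp_all add: one_enat_def)
  then obtain l where l: "is_saturated_chain S (\<le>) l" "hd l \<in> minimal_elems S (\<le>)" "last l = x"
    "length l - 1 = 1" by auto
  then have "length l = 2" by simp
  then obtain a b where "l = [a, b]" by (metis One_nat_def Suc_1 length_0_conv length_Suc_conv)
  then show ?thesis using l unfolding is_saturated_chain_def by force
qed

text \<open>A saturated chain from the only minimal element \<open>a\<close> to \<open>y\<close>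
  with more than two members would have its second member strictly between them, so
  \<open>[a, y]\<close> is the only one.\<close>

lemma height_one_if_covers:
  fixes S :: "'x::order set"
  assumes min: "minimal_elems S (\<le>) = {a}" and cov: "covers S (\<le>) a y"
  shows "poset_ht S (\<le>) y = 1"
proof -
  have ay: "a \<in> S" "y \<in> S" "strictly (\<le>) a y" "\<not> (\<exists>z\<in>S. strictly (\<le>) a z \<and> strictly (\<le>) z y)"
    using cov unfolding covers_def by auto
  have "length l - 1 = 1" if l: "is_saturated_chain S (\<le>) l" "hd l = a" "last l = y" for l
  proof -
    have ch: "set l \<subseteq> S" "sorted_wrt (strictly (\<le>)) l" "l \<noteq> []"
      using l(1) unfolding is_saturated_chain_def is_chain_def by auto
    obtain r where r: "l = a # r" using ch(3) l(2) by (cases l) auto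
    have "r \<noteq> []" using r l(3) ay(3) unfolding strictly_def by auto
    then obtain z s where z: "r = z # s" by (cases r) auto
    have "s = []"
    proof (rule ccontr)
      assume "s \<noteq> []"
      then have "y \<in> set s" using l(3) r z by auto
      then have "strictly (\<le>) z y" "strictly (\<le>) a z" "z \<in> S" using ch r z by auto
      then show False using ay(4) by blast
    qed
    then show ?thesis using r z by simp
  qed
  then have sub: "{enat (length l - 1) | l. is_saturated_chain S (\<le>) l \<and>
      hd l \<in> minimal_elems S (\<le>) \<and> last l = y} \<subseteq> {1}" (is "?E \<subseteq> _")
    using min by (auto simp: one_enat_def)
  have "is_saturated_chain S (\<le>) [a, y]"
    unfolding is_saturated_chain_def is_chain_def using ay cov by auto
  then have "1 \<in> ?E"
    using min by (intro CollectI exI[of _ "[a, y]"]) (auto simp: one_enat_def)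
  then have "?E = {1}" using sub by blast
  then show ?thesis unfolding poset_ht_def by simp
qed

theorem mainTheorem16:
  fixes P_X :: "'x::order set" and n :: nat
    and B :: "'b ring" and M :: "'b set" and \<psi> :: "'x \<Rightarrow> 'b set"
  assumes X_fin: "finite P_X"
    and X_dim: "poset_dim P_X (\<le>) = enat n" and n_ge: "n \<ge> 2"
    and X_min: "card (minimal_elems P_X (\<le>)) = 1"
    and X_max: "card (maximal_elems P_X (\<le>)) = 1"
    and B_local: "local_domain B M"
    and B_Q: "contains_rationals B"
    and B_unc: "uncountable (carrier (B Quot M))"
    and B_card: "carrier B \<approx> carrier (B Quot M)"
    and B_depth: "2 \<le> depth B M"
    and psi_emb: "saturated_embedding P_X (\<le>) (Spec B) (\<subseteq>) \<psi>"
    and psi_dim: "poset_dim P_X (\<le>) = poset_dim (Spec B) (\<subseteq>)"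
    and psi_cond: "\<forall>x\<in>P_X. poset_ht P_X (\<le>) x = 1 \<longrightarrow>
        (\<forall>Q\<in>Spec B. \<psi> x \<subset> Q \<longrightarrow>
          (\<forall>b\<in>carrier B. (\<forall>q\<in>Ass_quot B b. \<not> Q \<subseteq> q)) \<and>
          2 \<le> depth (localize_at B Q) (localized_max B Q))"
  shows "\<exists>A. A \<subseteq> carrier B \<and> subring A B \<and>
     local_domain (B\<lparr>carrier := A\<rparr>) (M \<inter> A) \<and> factorial_domain (B\<lparr>carrier := A\<rparr>) \<and>
     induced_completion_map B M \<in>
        ring_iso (completion (B\<lparr>carrier := A\<rparr>) (M \<inter> A)) (completion B M) \<and>
     (\<exists>xt :: 'x \<Rightarrow> 'b. inj_on xt {x \<in> P_X. poset_ht P_X (\<le>) x = 1} \<and>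
        (\<forall>x\<in>P_X. poset_ht P_X (\<le>) x = 1 \<longrightarrow>
           xt x \<in> A \<and> xt x \<noteq> \<zero>\<^bsub>B\<^esub> \<and> \<psi> x \<inter> A = PIdl\<^bsub>B\<lparr>carrier := A\<rparr>\<^esub> (xt x))) \<and>
     (\<forall>x\<in>P_X. \<forall>y\<in>P_X. poset_ht P_X (\<le>) x = 1 \<longrightarrow> (x \<le> y \<longleftrightarrow> \<psi> x \<inter> A \<subseteq> \<psi> y \<inter> A)) \<and>
     (\<lambda>P. A \<inter> P) ` Spec B = Spec (B\<lparr>carrier := A\<rparr>) \<and>
     (\<forall>P\<in>Spec B. (\<exists>x\<in>P_X. poset_ht P_X (\<le>) x = 1 \<and> \<psi> x \<subset> P) \<longrightarrow> Idl\<^bsub>B\<^esub> (A \<inter> P) = P) \<and>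
     (\<forall>P1\<in>Spec B. \<forall>P2\<in>Spec B.
        (\<exists>x\<in>P_X. poset_ht P_X (\<le>) x = 1 \<and> \<psi> x \<subset> P1) \<longrightarrow>
        (\<exists>x\<in>P_X. poset_ht P_X (\<le>) x = 1 \<and> \<psi> x \<subset> P2) \<longrightarrow>
        A \<inter> P1 = A \<inter> P2 \<longrightarrow> P1 = P2)"
proof -
  have dB: "domain B" and nB: "noetherian_ring B" and mB: "maximalideal M B"
    and uB: "\<And>N. maximalideal N B \<Longrightarrow> N = M"
    using B_local unfolding local_domain_def local_ring_def by auto
  interpret B: local_noetherian_domain B M
    by (intro local_noetherian_domain.intro noetherian_domain.intro
        local_noetherian_domain_axioms.intro nB dB mB uB)
  let ?H = "{x \<in> P_X. poset_ht P_X (\<le>) x = 1}"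
  have embD: "\<psi> x \<in> Spec B" "x \<le> y \<longleftrightarrow> \<psi> x \<subseteq> \<psi> y" if "x \<in> P_X" "y \<in> P_X" for x y
    using psi_emb that unfolding saturated_embedding_def by auto
  have prime: "primeideal (\<psi> x) B" if "x \<in> P_X" for x
    using embD(1)[OF that that] unfolding Spec_def by simp
  have n0: "n \<noteq> 0" using n_ge by simp
  obtain l where l: "is_chain P_X (\<le>) l" "length l = Suc n" by (rule maximal_chain[OF X_dim n0])
  define x0 where "x0 = hd l"
  have x0: "x0 \<in> minimal_elems P_X (\<le>)" unfolding x0_def by (rule maximal_chain_hd_minimal[OF X_dim l])
  then have min: "minimal_elems P_X (\<le>) = {x0}" using X_min by (metis card_1_singletonE singletonD)
  have psi0: "\<psi> x0 = {\<zero>\<^bsub>B\<^esub>}"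
    unfolding x0_def by (rule embedded_bottom[OF psi_emb dB X_dim _ l]) (use X_dim psi_dim in simp)
  have covB: "covers (Spec B) (\<subseteq>) {\<zero>\<^bsub>B\<^esub>} (\<psi> x)" if x: "x \<in> ?H" for x
  proof -
    obtain a where a: "a \<in> minimal_elems P_X (\<le>)" "covers P_X (\<le>) a x"
      using height_one_covers[of P_X x] x by blast
    then have cov: "covers P_X (\<le>) x0 x" using min by simp
    then have "x0 \<in> P_X" "x \<in> P_X" unfolding covers_def by auto
    then have "covers (Spec B) (\<subseteq>) (\<psi> x0) (\<psi> x)"
      using psi_emb cov unfolding saturated_embedding_def by blast
    then show ?thesis using psi0 by simp
  qed
  have zero_in: "{\<zero>\<^bsub>B\<^esub>} \<subseteq> N" if "primeideal N B" for N
    using additive_subgroup.zero_closed[OF ideal.axioms(1)[OF primeideal.axioms(1)[OF that]]] by blast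
  have ht: "N = {\<zero>\<^bsub>B\<^esub>} \<or> N = \<psi> x" if "x \<in> ?H" "primeideal N B" "N \<subseteq> \<psi> x" for x N
  proof -
    have "\<not> (strictly (\<subseteq>) {\<zero>\<^bsub>B\<^esub>} N \<and> strictly (\<subseteq>) N (\<psi> x))"
      using covB[OF that(1)] that(2) unfolding covers_def Spec_def by blast
    then show ?thesis using zero_in[OF that(2)] that(3) unfolding strictly_def by blast
  qed
  have dense: "B.dense Q" if "x \<in> ?H" "Q \<in> Spec B" "\<psi> x \<subset> Q" for x Q
    using psi_cond that primeideal.axioms(1) unfolding B.dense_def Spec_def by blast
  \<comment> \<open>As \<open>n \<ge> 2\<close>, a longest chain starts with \<open>x0\<close>,
    \<open>b\<close>, \<open>c\<close>; an element of height one below \<open>b\<close> then has its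
    image strictly below that of \<open>c\<close>, hence strictly below \<open>M\<close>.\<close>
  have dM: "B.dense M"
  proof -
    obtain b c r where bcr: "l = x0 # b # c # r"
      using l(2) n_ge unfolding x0_def
      by (metis (no_types, lifting) Suc_le_length_iff Suc_le_mono le_SucI list.sel(1) numeral_2_eq_2)
    have ch: "b \<in> P_X" "c \<in> P_X" "x0 \<in> P_X" "strictly (\<le>) x0 b" "strictly (\<le>) b c"
      using l(1) unfolding bcr is_chain_def by auto
    \<comment> \<open>A minimal element of this finite set covers \<open>x0\<close>; for
      \<open>b\<close> itself this has not been established.\<close>
    let ?C = "{y \<in> P_X. x0 < y \<and> y \<le> b}"
    have "finite ?C" "b \<in> ?C" using X_fin ch unfolding strictly_def by auto
    then obtain y where y: "y \<in> ?C" "\<forall>z\<in>?C. z \<le> y \<longrightarrow> y = z"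
      using finite_has_minimal[of ?C] by blast
    have "covers P_X (\<le>) x0 y"
      unfolding covers_def
    proof (intro conjI notI)
      assume "\<exists>z\<in>P_X. strictly (\<le>) x0 z \<and> strictly (\<le>) z y"
      then obtain z where z: "z \<in> P_X" "x0 < z" "z \<le> y" "z \<noteq> y"
        unfolding strictly_def by auto
      then have "z \<in> ?C" using y(1) by auto
      then show False using y(2) z(3,4) by blast
    qed (use y(1) ch(3) in \<open>auto simp: strictly_def\<close>)
    then have yH: "y \<in> ?H" using height_one_if_covers[OF min] y(1) by blast
    have "strictly (\<le>) y c" using y(1) ch(5) unfolding strictly_def by auto
    then have "\<psi> y \<subset> \<psi> c" using saturated_embedding_strictly[OF psi_emb _ ch(2)] y(1) by blast
    also have "\<psi> c \<subseteq> M" by (rule B.prime_subset_M[OF prime[OF ch(2)]])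
    finally have "\<psi> y \<subset> M" .
    moreover have "M \<in> Spec B" using B.maximalideal_prime[OF mB] unfolding Spec_def by simp
    ultimately show ?thesis using dense[OF yH] by blast
  qed
  have card: "|carrier B| \<le>o |carrier (B Quot M)|"
    using B_card unfolding eqpoll_def card_of_ordIso[symmetric]
    by (intro ordIso_imp_ordLeq) (simp add: card_of_ordIso)
  have "\<exists>A x. B.saturated A \<and> (\<forall>p\<in>\<psi> ` ?H. x p \<in> A \<and> x p \<noteq> \<zero>\<^bsub>B\<^esub> \<and> x p \<in> p \<and>
     p \<inter> A = PIdl\<^bsub>B\<lparr>carrier := A\<rparr>\<^esub> (x p) \<and> (\<forall>q\<in>\<psi> ` P_X. \<not> p \<subseteq> q \<longrightarrow> x p \<notin> q))"
  proof (rule B.exists_saturated_with_primes[OF B_Q B_unc card])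
    show "finite (\<psi> ` ?H)" "finite (\<psi> ` P_X)" using X_fin by simp_all
    fix q assume "q \<in> \<psi> ` P_X" then show "primeideal q B" using prime by blast
  next
    fix p assume "p \<in> \<psi> ` ?H"
    then obtain x where x: "x \<in> ?H" "p = \<psi> x" by blast
    then show "primeideal p B \<and> p \<noteq> {\<zero>\<^bsub>B\<^esub>}"
      using prime covB[OF x(1)] unfolding covers_def strictly_def by auto
  next
    fix p N assume "p \<in> \<psi> ` ?H" "primeideal N B" "N \<subseteq> p"
    then show "N = {\<zero>\<^bsub>B\<^esub>} \<or> N = p" using ht by blast
  next
    fix p Q assume "p \<in> \<psi> ` ?H" "primeideal Q B" "p \<subset> Q"
    then show "B.dense Q" using dense unfolding Spec_def by blast
  qed
  then obtain A x where sat: "B.saturated A"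
    and x: "\<forall>p\<in>\<psi> ` ?H. x p \<in> A \<and> x p \<noteq> \<zero>\<^bsub>B\<^esub> \<and> x p \<in> p \<and>
     p \<inter> A = PIdl\<^bsub>B\<lparr>carrier := A\<rparr>\<^esub> (x p) \<and> (\<forall>q\<in>\<psi> ` P_X. \<not> p \<subseteq> q \<longrightarrow> x p \<notin> q)" by blast
  define xt where "xt = (\<lambda>y. x (\<psi> y))"
  have xt: "xt y \<in> A" "xt y \<noteq> \<zero>\<^bsub>B\<^esub>" "xt y \<in> \<psi> y" "\<psi> y \<inter> A = PIdl\<^bsub>B\<lparr>carrier := A\<rparr>\<^esub> (xt y)"
      "\<And>z. z \<in> P_X \<Longrightarrow> \<not> y \<le> z \<Longrightarrow> xt y \<notin> \<psi> z" if y: "y \<in> ?H" for y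
  proof -
    have "\<psi> y \<in> \<psi> ` ?H" using y by blast
    note * = x[rule_format, OF this]
    show "xt y \<in> A" "xt y \<noteq> \<zero>\<^bsub>B\<^esub>" "xt y \<in> \<psi> y" "\<psi> y \<inter> A = PIdl\<^bsub>B\<lparr>carrier := A\<rparr>\<^esub> (xt y)"
      unfolding xt_def using * by auto
    fix z assume z: "z \<in> P_X" "\<not> y \<le> z"
    then have "\<not> \<psi> y \<subseteq> \<psi> z" using embD(2)[of y z] y by blast
    then show "xt y \<notin> \<psi> z" unfolding xt_def using * z(1) by blast
  qed
  have ext: "Idl\<^bsub>B\<^esub> (A \<inter> P) = P" if "P \<in> Spec B" "\<exists>x\<in>P_X. poset_ht P_X (\<le>) x = 1 \<and> \<psi> x \<subset> P" for P
  proof -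
    have "B.dense P" using that dense by blast
    moreover have "P \<subseteq> M" using that(1) B.prime_subset_M unfolding Spec_def by blast
    ultimately show ?thesis by (rule B.extension_contraction_dense[OF sat])
  qed
  have inj: "inj_on xt ?H"
  proof (rule inj_onI)
    fix y z assume y: "y \<in> ?H" and z: "z \<in> ?H" and eq: "xt y = xt z"
    have "y \<le> z" using xt(5)[OF y, of z] xt(3)[OF z] eq z by auto
    moreover have "z \<le> y" using xt(5)[OF z, of y] xt(3)[OF y] eq y by auto
    ultimately show "y = z" by (rule antisym)
  qed
  have order: "y \<le> z \<longleftrightarrow> \<psi> y \<inter> A \<subseteq> \<psi> z \<inter> A" if "y \<in> P_X" "z \<in> P_X" "poset_ht P_X (\<le>) y = 1" for y z
  proof
    assume "y \<le> z"
    then show "\<psi> y \<inter> A \<subseteq> \<psi> z \<inter> A" using embD(2)[OF that(1,2)] by blast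
  next
    \<comment> \<open>The generator alone decides: \<open>xt y\<close> was chosen outside every
      \<open>\<psi> z\<close> for which \<open>y \<le> z\<close> fails.\<close>
    assume sub: "\<psi> y \<inter> A \<subseteq> \<psi> z \<inter> A"
    have y: "y \<in> ?H" using that by simp
    have "xt y \<in> \<psi> z" using sub xt(1,3)[OF y] by blast
    then show "y \<le> z" using xt(5)[OF y that(2)] by blast
  qed
  show ?thesis
  proof (intro exI[of _ A] conjI)
    show "A \<subseteq> carrier B" "subring A B" using B.saturatedD(3,4)[OF sat] by blast+
    show "local_domain (B\<lparr>carrier := A\<rparr>) (M \<inter> A)" by (rule B.saturated_local_domain[OF sat B_Q])
    show "factorial_domain (B\<lparr>carrier := A\<rparr>)" by (rule B.saturated_factorial[OF sat B_Q])
    show "induced_completion_map B M \<in>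
        ring_iso (completion (B\<lparr>carrier := A\<rparr>) (M \<inter> A)) (completion B M)"
      by (rule B.saturated_completion[OF sat B_Q dM])
    show "\<exists>xt :: 'x \<Rightarrow> 'b. inj_on xt ?H \<and>
        (\<forall>x\<in>P_X. poset_ht P_X (\<le>) x = 1 \<longrightarrow>
           xt x \<in> A \<and> xt x \<noteq> \<zero>\<^bsub>B\<^esub> \<and> \<psi> x \<inter> A = PIdl\<^bsub>B\<lparr>carrier := A\<rparr>\<^esub> (xt x))"
      using inj xt(1,2,4) by (intro exI[of _ xt]) simp
    show "\<forall>x\<in>P_X. \<forall>y\<in>P_X. poset_ht P_X (\<le>) x = 1 \<longrightarrow> (x \<le> y \<longleftrightarrow> \<psi> x \<inter> A \<subseteq> \<psi> y \<inter> A)"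
      using order by blast
    show "(\<lambda>P. A \<inter> P) ` Spec B = Spec (B\<lparr>carrier := A\<rparr>)" by (rule B.saturated_Spec[OF sat B_Q])
    show "\<forall>P\<in>Spec B. (\<exists>x\<in>P_X. poset_ht P_X (\<le>) x = 1 \<and> \<psi> x \<subset> P) \<longrightarrow> Idl\<^bsub>B\<^esub> (A \<inter> P) = P"
      using ext by blast
    show "\<forall>P1\<in>Spec B. \<forall>P2\<in>Spec B.
        (\<exists>x\<in>P_X. poset_ht P_X (\<le>) x = 1 \<and> \<psi> x \<subset> P1) \<longrightarrow>
        (\<exists>x\<in>P_X. poset_ht P_X (\<le>) x = 1 \<and> \<psi> x \<subset> P2) \<longrightarrow>
        A \<inter> P1 = A \<inter> P2 \<longrightarrow> P1 = P2"
    proof (intro ballI impI)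
      fix P1 P2
      assume "P1 \<in> Spec B" "P2 \<in> Spec B" "\<exists>x\<in>P_X. poset_ht P_X (\<le>) x = 1 \<and> \<psi> x \<subset> P1"
        "\<exists>x\<in>P_X. poset_ht P_X (\<le>) x = 1 \<and> \<psi> x \<subset> P2" and eq: "A \<inter> P1 = A \<inter> P2"
      then have P: "Idl\<^bsub>B\<^esub> (A \<inter> P1) = P1" "Idl\<^bsub>B\<^esub> (A \<inter> P2) = P2" using ext by blast+
      show "P1 = P2" by (rule trans[OF P(1)[symmetric] P(2)[unfolded eq[symmetric]]])
    qed
  qed
qed

end
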